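(* Let $D\subset\mathbb{R}^3$ be an open, bounded domain with Lipschitz boundary, and let the probability space, the ergodic dynamical system $(T_x)_{x\in\mathbb{R}^3}$, the random parameters $a,\kappa,M_{\mathrm{sat}}$, the random anisotropy density $\varphi$ and the applied field $h_a$ be as in the context. For $\tilde\omega\in\Omega$ and $\varepsilon>0$ set $$\mathcal{A}_\varepsilon(m)=\int_D\varphi(T_{x/\varepsilon}\tilde\omega,m(x))\,dx,\qquad \mathcal{Z}_\varepsilon(m)=-\mu_0\int_Dh_a\cdot M_{\mathrm{sat}}(T_{x/\varepsilon}\tilde\omega)\,m(x)\,dx .$$ Then for $\mathbb{P}$-almost every $\tilde\omega\in\Omega$ the families $(\mathcal{A}_\varepsilon)_{\varepsilon>0}$ and $(\mathcal{Z}_\varepsilon)_{\varepsilon>0}$ continuously $\Gamma$-converge with respect to the strong $L^2(D;\mathbb{S}^2)$-topology, and hence also with respect to the weak topology on $H^1(D;\mathbb{S}^2)$, to the energy functionals $$\mathcal{A}_{\mathrm{hom}}(m)=\int_D\mathbb{E}[\varphi](m)\,dx,\qquad \mathcal{Z}_{\mathrm{hom}}(m)=-\mu_0\int_Dh_a\cdot\mathbb{E}[M_{\mathrm{sat}}]\,m\,dx ,$$ respectively.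
   Context: **Stochastic setting.** $(\Omega,\Sigma,\mathbb{P})$ is a probability space, $\Omega$ is a compact metric space, $\Sigma$ is a complete $\sigma$-algebra on $\Omega$, and $\mathbb{E}[f]=\int_\Omega f\,d\mathbb{P}$. $(T_x)_{x\in\mathbb{R}^3}$ is a family of measurable bijections $T_x:\Omega\to\Omega$ with: $T_0=\mathrm{Id}$ and $T_{x+y}=T_x\circ T_y$; $\mathbb{P}(T_x^{-1}(B))=\mathbb{P}(B)$ for all $x\in\mathbb{R}^3$, $B\in\Sigma$; $(x,\omega)\mapsto T_x\omega$ is measurable and continuous from $\mathbb{R}^3\times\Omega$ to $\Omega$; ergodicity: every $A\in\Sigma$ with $T_xA=A$ (up to a null set) for all $x$ satisfies $\mathbb{P}(A)\in\{0,1\}$. **Parameters.** $a,\kappa,M_{\mathrm{sat}}\in L^\infty(\Omega)$ (exchange coefficient, Dzyaloshinskii-Moriya constant, saturation magnetization) with $0<c_{\mathrm{ex}}\le a(\omega)\le C_{\mathrm{ex}}$, $|\kappa(\omega)|\le C_{\mathrm{DMI}}$ and $0\le M_{\mathrm{sat}}(\omega)\le C_{\mathrm{sat}}$ for all $\omega\in\Omega$, for some positive constants; $a$ and $\kappa$ do not enter the functionals considered here. The anisotropy density $\varphi:\Omega\times\mathbb{S}^2\to\mathbb{R}^+$ satisfies $\varphi(\cdot,s)\in L^\infty(\Omega)$ for every $s\in\mathbb{S}^2$ and, for some $L_{\mathrm{an}}>0$, $\operatorname{ess\,sup}_{\omega\in\Omega}|\varphi(\omega,s_1)-\varphi(\omega,s_2)|\le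 L_{\mathrm{an}}|s_1-s_2|$ for all $s_1,s_2\in\mathbb{S}^2$; $\mathbb{E}[\varphi](s)=\int_\Omega\varphi(\omega,s)\,d\mathbb{P}(\omega)$. $\mu_0$ is the vacuum permeability, and $h_a$ is the externally applied magnetic field on $D$, with values in $\mathbb{R}^3$. **Notation.** $\mathbb{S}^2$ is the unit sphere in $\mathbb{R}^3$; $L^2(D;\mathbb{S}^2)$ (resp. $H^1(D;\mathbb{S}^2)$) is the set of $m\in L^2(D;\mathbb{R}^3)$ (resp. $H^1(D;\mathbb{R}^3)$) with values in $\mathbb{S}^2$ a.e. **Continuous $\Gamma$-convergence** of functionals $F_\varepsilon$ to $F$ in a given topology: whenever $m_\varepsilon\to m$ in that topology as $\varepsilon\to0$, one has $F_\varepsilon(m_\varepsilon)\to F(m)$.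
   Formalization: In A_ε, φ is replaced by any Carathéodory representative (equal to φ(·,s) a.e. for each s, continuous in s for a.e. ω; proved to exist), since the stated hypotheses on φ alone do not determine A_ε and the literal claim can fail; h_a is taken to be integrable on D. *)

theory Defs
  imports "HOL-Analysis.Analysis" "HOL-Probability.Probability"
begin

section \<open>The stochastic setting\<close>

text \<open>The joint map is required to be measurable on the \<^emph>\<open>completed\<close> product of Lebesgue measure
  and P. Since P is complete, measurability with respect to the plain product would already fail for
  the translations of a torus with its Lebesgue sets.\<close>

locale stochastic_setting = prob_space P + complete_measure P
  for P :: "'w::metric_space measure" +
  fixes T :: "real^3 \<Rightarrow> 'w \<Rightarrow> 'w"
  assumes compact_Omega: "compact (UNIV :: 'w set)"
    and space_Omega: "space P = UNIV"
    and T_measurable: "\<And>x. T x \<in> measurable P P"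
    and T_bij: "\<And>x. bij (T x)"
    and T_zero: "T 0 = id"
    and T_add: "\<And>x y. T (x + y) = T x \<circ> T y"
    and T_preserves: "\<And>x B. B \<in> sets P \<Longrightarrow> prob (T x -` B) = prob B"
    and T_joint_measurable: "(\<lambda>(x, \<omega>). T x \<omega>) \<in> measurable (completion (lborel \<Otimes>\<^sub>M P)) P"
    and T_joint_continuous: "continuous_on UNIV (\<lambda>(x, \<omega>). T x \<omega>)"
    and T_ergodic: "\<And>A. A \<in> sets P \<Longrightarrow> (\<And>x. sym_diff (T x ` A) A \<in> null_sets P)
                      \<Longrightarrow> prob A = 0 \<or> prob A = 1"

definition Linfty :: "'w measure \<Rightarrow> ('w \<Rightarrow> real) \<Rightarrow> bool" where
  "Linfty P f \<longleftrightarrow> f \<in> borel_measurable P \<and> esssup P (\<lambda>\<omega>. ereal \<bar>f \<omega>\<bar>) < \<infinity>"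

definition random_parameters ::
  "'w measure \<Rightarrow> ('w \<Rightarrow> real) \<Rightarrow> ('w \<Rightarrow> real) \<Rightarrow> ('w \<Rightarrow> real) \<Rightarrow> real \<Rightarrow> real \<Rightarrow> real \<Rightarrow> real \<Rightarrow> bool" where
  "random_parameters P a \<kappa> Msat c_ex C_ex C_DMI C_sat \<longleftrightarrow>
     Linfty P a \<and> Linfty P \<kappa> \<and> Linfty P Msat \<and>
     0 < c_ex \<and> 0 < C_ex \<and> 0 < C_DMI \<and> 0 < C_sat \<and>
     (\<forall>\<omega>\<in>space P. c_ex \<le> a \<omega> \<and> a \<omega> \<le> C_ex) \<and>
     (\<forall>\<omega>\<in>space P. \<bar>\<kappa> \<omega>\<bar> \<le> C_DMI) \<and>
     (\<forall>\<omega>\<in>space P. 0 \<le> Msat \<omega> \<and> Msat \<omega> \<le> C_sat)"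

abbreviation S2 :: "(real^3) set" where
  "S2 \<equiv> sphere 0 1"

definition anisotropy_density ::
  "'w measure \<Rightarrow> ('w \<Rightarrow> real^3 \<Rightarrow> real) \<Rightarrow> real \<Rightarrow> bool" where
  "anisotropy_density P \<phi> L_an \<longleftrightarrow> 0 < L_an \<and>
     (\<forall>\<omega>\<in>space P. \<forall>s\<in>S2. 0 \<le> \<phi> \<omega> s) \<and>
     (\<forall>s\<in>S2. Linfty P (\<lambda>\<omega>. \<phi> \<omega> s)) \<and>
     (\<forall>s1\<in>S2. \<forall>s2\<in>S2. esssup P (\<lambda>\<omega>. ereal \<bar>\<phi> \<omega> s1 - \<phi> \<omega> s2\<bar>) \<le> ereal (L_an * norm (s1 - s2)))"

text \<open>The hypotheses on an anisotropy density concern, for each s, only the class of \<open>\<phi>(\<cdot>,s)\<close> modulo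
  null sets that may depend on s. They do not determine the composite \<open>\<phi>(T\<^sub>x\<omega>, m(x))\<close>: changing \<open>\<phi>\<close>
  on \<open>{(\<omega>,s). s \<in> G \<omega>}\<close>, where G \<open>\<omega>\<close> is a countable dense set and every \<open>{\<omega>. s \<in> G \<omega>}\<close> is a
  null set, respects the hypotheses but alters the composite for a dense set of m.
  As usual the composite is therefore formed with a Caratheodory representative \<open>\<psi>\<close> of \<open>\<phi>\<close>. If
  \<open>\<phi>(\<omega>,\<cdot>)\<close> is Lipschitz for almost every \<open>\<omega>\<close>, then \<open>\<psi> = \<phi>\<close> is admissible.\<close>

definition caratheodory_representative ::
  "'w measure \<Rightarrow> ('w \<Rightarrow> real^3 \<Rightarrow> real) \<Rightarrow> ('w \<Rightarrow> real^3 \<Rightarrow> real) \<Rightarrow> bool" where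
  "caratheodory_representative P \<phi> \<psi> \<longleftrightarrow>
     (\<forall>s\<in>S2. AE \<omega> in P. \<psi> \<omega> s = \<phi> \<omega> s) \<and> (AE \<omega> in P. continuous_on S2 (\<psi> \<omega>))"

section \<open>Domains and function spaces\<close>

text \<open>Near each boundary point, D is the strict epigraph of a Lipschitz function of two variables in
  some orthonormal coordinate system.\<close>

definition lipschitz_boundary :: "(real^3) set \<Rightarrow> bool" where
  "lipschitz_boundary D \<longleftrightarrow>
     (\<forall>p\<in>frontier D. \<exists>(Q :: real^3 \<Rightarrow> real^3) r L (\<gamma> :: real \<times> real \<Rightarrow> real).
        orthogonal_transformation Q \<and> 0 < r \<and> lipschitz_on L UNIV \<gamma> \<and>
        (\<forall>x\<in>ball p r. x \<in> D \<longleftrightarrow> \<gamma> (Q x $ 1, Q x $ 2) < Q x $ 3))"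

text \<open>Elements of the function spaces over D are represented by functions on all of \<open>\<real>\<^sup>3\<close>, whose values
  outside D are irrelevant.\<close>

definition L2 :: "(real^3) set \<Rightarrow> (real^3 \<Rightarrow> real^3) set" where
  "L2 D = {u. u \<in> borel_measurable (lebesgue_on D) \<and> integrable (lebesgue_on D) (\<lambda>x. (norm (u x))\<^sup>2)}"

definition L2_norm :: "(real^3) set \<Rightarrow> (real^3 \<Rightarrow> real^3) \<Rightarrow> real" where
  "L2_norm D u = sqrt (\<integral>x. (norm (u x))\<^sup>2 \<partial>lebesgue_on D)"

definition L2_topology :: "(real^3) set \<Rightarrow> (real^3 \<Rightarrow> real^3) topology" where
  "L2_topology D =
     topology_generated_by {{v \<in> L2 D. L2_norm D (\<lambda>x. v x - u x) < r} | u r. u \<in> L2 D}"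

definition partial_deriv :: "3 \<Rightarrow> (real^3 \<Rightarrow> real) \<Rightarrow> real^3 \<Rightarrow> real" where
  "partial_deriv j f x = frechet_derivative f (at x) (axis j 1)"

primrec C_k :: "nat \<Rightarrow> (real^3 \<Rightarrow> real) \<Rightarrow> bool" where
  "C_k 0 f \<longleftrightarrow> continuous_on UNIV f"
| "C_k (Suc k) f \<longleftrightarrow> (\<forall>x. f differentiable (at x)) \<and> (\<forall>j. C_k k (partial_deriv j f))"

definition test_function :: "(real^3) set \<Rightarrow> (real^3 \<Rightarrow> real) \<Rightarrow> bool" where
  "test_function D \<eta> \<longleftrightarrow> (\<forall>k. C_k k \<eta>) \<and>
     compact (closure {x. \<eta> x \<noteq> 0}) \<and> closure {x. \<eta> x \<noteq> 0} \<subseteq> D"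

definition is_weak_partial ::
  "(real^3) set \<Rightarrow> 3 \<Rightarrow> (real^3 \<Rightarrow> real^3) \<Rightarrow> (real^3 \<Rightarrow> real^3) \<Rightarrow> bool" where
  "is_weak_partial D j u g \<longleftrightarrow>
     (\<forall>\<eta>. test_function D \<eta> \<longrightarrow>
        (\<integral>x. partial_deriv j \<eta> x *\<^sub>R u x \<partial>lebesgue_on D) = - (\<integral>x. \<eta> x *\<^sub>R g x \<partial>lebesgue_on D))"

definition H1 :: "(real^3) set \<Rightarrow> (real^3 \<Rightarrow> real^3) set" where
  "H1 D = {u \<in> L2 D. \<forall>j. \<exists>g\<in>L2 D. is_weak_partial D j u g}"

text \<open>The weak partial derivative is unique up to null sets, so the choice does not affect
  the norm below.\<close>

definition weak_partial :: "(real^3) set \<Rightarrow> 3 \<Rightarrow> (real^3 \<Rightarrow> real^3) \<Rightarrow> real^3 \<Rightarrow> real^3" where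
  "weak_partial D j u = (SOME g. g \<in> L2 D \<and> is_weak_partial D j u g)"

definition H1_norm :: "(real^3) set \<Rightarrow> (real^3 \<Rightarrow> real^3) \<Rightarrow> real" where
  "H1_norm D u = sqrt ((L2_norm D u)\<^sup>2 + (\<Sum>j\<in>UNIV. (L2_norm D (weak_partial D j u))\<^sup>2))"

definition H1_dual :: "(real^3) set \<Rightarrow> ((real^3 \<Rightarrow> real^3) \<Rightarrow> real) set" where
  "H1_dual D = {l.
     (\<forall>u\<in>H1 D. \<forall>v\<in>H1 D. l (\<lambda>x. u x + v x) = l u + l v) \<and>
     (\<forall>c. \<forall>u\<in>H1 D. l (\<lambda>x. c *\<^sub>R u x) = c * l u) \<and>
     (\<exists>C. \<forall>u\<in>H1 D. \<bar>l u\<bar> \<le> C * H1_norm D u)}"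

definition H1_weak_topology :: "(real^3) set \<Rightarrow> (real^3 \<Rightarrow> real^3) topology" where
  "H1_weak_topology D =
     topology_generated_by {{u \<in> H1 D. l u \<in> V} | l V. l \<in> H1_dual D \<and> open V}"

definition L2_sphere :: "(real^3) set \<Rightarrow> (real^3 \<Rightarrow> real^3) set" where
  "L2_sphere D = {m \<in> L2 D. AE x in lebesgue_on D. m x \<in> S2}"

definition H1_sphere :: "(real^3) set \<Rightarrow> (real^3 \<Rightarrow> real^3) set" where
  "H1_sphere D = {m \<in> H1 D. AE x in lebesgue_on D. m x \<in> S2}"

abbreviation strong_L2_sphere :: "(real^3) set \<Rightarrow> (real^3 \<Rightarrow> real^3) topology" where
  "strong_L2_sphere D \<equiv> subtopology (L2_topology D) (L2_sphere D)"

abbreviation weak_H1_sphere :: "(real^3) set \<Rightarrow> (real^3 \<Rightarrow> real^3) topology" where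
  "weak_H1_sphere D \<equiv> subtopology (H1_weak_topology D) (H1_sphere D)"

section \<open>Energies and convergence\<close>

definition continuously_Gamma_converges ::
  "'a topology \<Rightarrow> (real \<Rightarrow> 'a \<Rightarrow> real) \<Rightarrow> ('a \<Rightarrow> real) \<Rightarrow> bool" where
  "continuously_Gamma_converges X F F0 \<longleftrightarrow>
     (\<forall>m m0. limitin X m m0 (at_right 0) \<longrightarrow> ((\<lambda>\<epsilon>. F \<epsilon> (m \<epsilon>)) \<longlongrightarrow> F0 m0) (at_right 0))"

definition anisotropy_energy ::
  "(real^3 \<Rightarrow> 'w \<Rightarrow> 'w) \<Rightarrow> (real^3) set \<Rightarrow> ('w \<Rightarrow> real^3 \<Rightarrow> real) \<Rightarrow> 'w \<Rightarrow> real \<Rightarrow> (real^3 \<Rightarrow> real^3) \<Rightarrow> real" where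
  "anisotropy_energy T D \<psi> \<omega> \<epsilon> m = (\<integral>x. \<psi> (T (x /\<^sub>R \<epsilon>) \<omega>) (m x) \<partial>lebesgue_on D)"

definition anisotropy_energy_hom ::
  "'w measure \<Rightarrow> (real^3) set \<Rightarrow> ('w \<Rightarrow> real^3 \<Rightarrow> real) \<Rightarrow> (real^3 \<Rightarrow> real^3) \<Rightarrow> real" where
  "anisotropy_energy_hom P D \<phi> m = (\<integral>x. (\<integral>\<omega>. \<phi> \<omega> (m x) \<partial>P) \<partial>lebesgue_on D)"

definition Zeeman_energy ::
  "(real^3 \<Rightarrow> 'w \<Rightarrow> 'w) \<Rightarrow> (real^3) set \<Rightarrow> real \<Rightarrow> (real^3 \<Rightarrow> real^3) \<Rightarrow> ('w \<Rightarrow> real) \<Rightarrow> 'w \<Rightarrow> real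
     \<Rightarrow> (real^3 \<Rightarrow> real^3) \<Rightarrow> real" where
  "Zeeman_energy T D \<mu>0 h Msat \<omega> \<epsilon> m =
     - \<mu>0 * (\<integral>x. h x \<bullet> (Msat (T (x /\<^sub>R \<epsilon>) \<omega>) *\<^sub>R m x) \<partial>lebesgue_on D)"

definition Zeeman_energy_hom ::
  "'w measure \<Rightarrow> (real^3) set \<Rightarrow> real \<Rightarrow> (real^3 \<Rightarrow> real^3) \<Rightarrow> ('w \<Rightarrow> real) \<Rightarrow> (real^3 \<Rightarrow> real^3) \<Rightarrow> real" where
  "Zeeman_energy_hom P D \<mu>0 h Msat m =
     - \<mu>0 * (\<integral>x. h x \<bullet> ((\<integral>\<omega>. Msat \<omega> \<partial>P) *\<^sub>R m x) \<partial>lebesgue_on D)"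

end

theory Submission
  imports Defs
begin

text \<open>
  Both energies integrate over D a quantity that depends on x through the slow field m(x) and
  through the rapidly moving point \<open>T(x/\<epsilon>) \<omega>\<close> of \<open>\<Omega>\<close>. The ergodic theorem says that for almost
  every \<open>\<omega>\<close> the oscillating factor \<open>f(T(x/\<epsilon>) \<omega>)\<close> converges weakly-star to its expectation, that
  is, against every integrable weight k on space (lemma \<open>orbit_mean\<close>). The rest is a
  strong-times-weak argument: a strongly convergent field may be replaced by its limit, at a price
  controlled by an \<open>L\<^sup>1\<close> norm, and the limit field is then a fixed integrable weight.

  For one measure-preserving map and a bounded function, Garsia's maximal
  inequality shows that the limit superior of the Birkhoff means has integral at most that of the
  function; applied to f and -f this gives almost sure convergence (\<open>birkhoff_ergodic\<close>). For bounded
  functions this property survives composition of averaging operators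
  (\<open>averaging_scheme_compose\<close>), hence it holds for averages over three commuting maps, the
  translations along the three coordinate axes. Integrating f along the orbit against the signed
  indicator of the box spanned by the origin and a rational corner c turns such discrete averages
  into integrals over dilated boxes (\<open>corner_box_mean\<close>). Their limit is invariant under all
  translations, hence constant by ergodicity. From integer dilations one passes to all real ones
  because dilating a box by a factor close to 1 is a small change in \<open>L\<^sup>1\<close>, from corner boxes to all
  boxes by inclusion-exclusion, and from boxes to all integrable weights by Dynkin's theorem and
  \<open>L\<^sup>1\<close>-density (\<open>has_mean_against_integrable\<close>). Only the countably many rational corners are used, so
  one null set of \<open>\<omega>\<close> serves all weights.

  The weak \<open>H\<^sup>1\<close> topology reduces to the strong \<open>L\<^sup>2\<close> topology: if \<open>m\<^sub>\<epsilon>\<close> and \<open>m\<^sub>0\<close> have values in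
  the sphere, then \<open>\<integral>\<bar>m\<^sub>\<epsilon> - m\<^sub>0\<bar>\<^sup>2 = 2\<bar>D\<bar> - 2\<integral>m\<^sub>\<epsilon> \<bullet> m\<^sub>0\<close>, and pairing with \<open>m\<^sub>0\<close> is a bounded functional on
  \<open>H\<^sup>1\<close>. So weak convergence already implies strong \<open>L\<^sup>2\<close> convergence (\<open>weak_limit\<close>).

  The McShane formula \<open>inf\<^sub>q (\<phi>(\<omega>,q) + L \<bar>s - q\<bar>)\<close> over a countable
  dense set of q on the sphere yields a version of \<open>\<phi>\<close> which is Lipschitz in s for every \<open>\<omega>\<close>, and
  with which every Caratheodory representative agrees (\<open>anisotropy_representative\<close>). A partition of
  unity on the sphere approximates a Lipschitz density uniformly by a finite sum of products
  \<open>\<theta>\<^sub>q(s) \<phi>(\<omega>,q)\<close>, to which the ergodic theorem applies with the weights \<open>\<theta>\<^sub>q(m\<^sub>0(x))\<close>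
  (\<open>lipschitz_energy_converges\<close>).
\<close>

section \<open>Birkhoff averages of bounded functions\<close>

text \<open>The real value lets limits superior be integrated; it is the usual one whenever the sequence is
  bounded, as all sequences below are.\<close>

definition limsup_real :: "(nat \<Rightarrow> real) \<Rightarrow> real" where
  "limsup_real X = real_of_ereal (limsup (\<lambda>n. ereal (X n)))"

lemma limsup_real_ereal:
  assumes "\<And>n. \<bar>X n\<bar> \<le> C"
  shows "ereal (limsup_real X) = limsup (\<lambda>n. ereal (X n))"
proof -
  have "limsup (\<lambda>n. ereal (X n)) \<le> ereal C"
    using assms by (intro Limsup_bounded) (auto intro: always_eventually simp: abs_le_iff)
  moreover have "ereal (-C) \<le> limsup (\<lambda>n. ereal (X n))"
    using assms by (intro le_Limsup always_eventually) (auto simp: abs_le_iff minus_le_iff)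
  ultimately show ?thesis
    unfolding limsup_real_def by (cases "limsup (\<lambda>n. ereal (X n))") auto
qed

lemma limsup_real_bound:
  assumes "\<And>n. \<bar>X n\<bar> \<le> C"
  shows "\<bar>limsup_real X\<bar> \<le> C"
proof -
  have "ereal (limsup_real X) \<le> ereal C"
    unfolding limsup_real_ereal[OF assms]
    using assms by (intro Limsup_bounded) (auto intro: always_eventually simp: abs_le_iff)
  moreover have "ereal (-C) \<le> ereal (limsup_real X)"
    unfolding limsup_real_ereal[OF assms]
    using assms by (intro le_Limsup always_eventually) (auto simp: abs_le_iff minus_le_iff)
  ultimately show ?thesis by auto
qed

lemma limsup_real_frequently:
  assumes "\<And>n. \<bar>X n\<bar> \<le> C" "L < limsup_real X"
  shows "\<exists>n\<ge>N. L < X n"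
proof (rule ccontr)
  assume "\<not> ?thesis"
  then have "eventually (\<lambda>n. ereal (X n) \<le> ereal L) sequentially"
    by (auto simp: eventually_sequentially not_less)
  then have "limsup (\<lambda>n. ereal (X n)) \<le> ereal L" by (rule Limsup_bounded)
  then show False using assms(2) limsup_real_ereal[of X C, OF assms(1)]
    by (metis ereal_less_eq(3) not_less)
qed

lemma limsup_real_le:
  assumes "\<And>n. \<bar>X n\<bar> \<le> C" "eventually (\<lambda>n. X n \<le> Y n) sequentially" "Y \<longlonglongrightarrow> L"
  shows "limsup_real X \<le> L"
proof -
  have "limsup (\<lambda>n. ereal (X n)) \<le> limsup (\<lambda>n. ereal (Y n))"
    using assms(2) by (intro Limsup_mono) (auto elim: eventually_mono)
  also have "\<dots> = ereal L"
    using assms(3) by (intro lim_imp_Limsup) auto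
  finally show ?thesis
    using limsup_real_ereal[of X C, OF assms(1)] by (metis ereal_less_eq(3))
qed

lemma eventually_less_limsup_real:
  assumes "\<And>n. \<bar>X n\<bar> \<le> C" "limsup_real X < L"
  shows "eventually (\<lambda>n. X n < L) sequentially"
proof -
  have "limsup (\<lambda>n. ereal (X n)) < ereal L"
    using assms(2) limsup_real_ereal[of X C, OF assms(1)] by (metis ereal_less(2) less_ereal.simps(1))
  from Limsup_lessD[OF this] show ?thesis by simp
qed

lemma limsup_real_cong:
  assumes "\<And>n. \<bar>X n\<bar> \<le> C" "\<And>n. \<bar>Y n\<bar> \<le> C" "(\<lambda>n. X n - Y n) \<longlonglongrightarrow> 0"
  shows "limsup_real X = limsup_real Y"
proof -
  have "limsup_real X \<le> limsup_real Y"
    if a: "\<And>n. \<bar>X n\<bar> \<le> C" "\<And>n. \<bar>Y n\<bar> \<le> C" "(\<lambda>n. X n - Y n) \<longlonglongrightarrow> 0" for X Y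
  proof (rule field_le_epsilon)
    fix e :: real assume e: "0 < e"
    have "eventually (\<lambda>n. Y n < limsup_real Y + e / 2) sequentially"
      using e by (intro eventually_less_limsup_real[of Y C] a) auto
    moreover have "eventually (\<lambda>n. \<bar>X n - Y n\<bar> < e / 2) sequentially"
      using tendstoD[OF a(3), of "e / 2"] e by (simp add: dist_real_def)
    ultimately have "eventually (\<lambda>n. X n \<le> limsup_real Y + e) sequentially"
      by eventually_elim linarith
    then show "limsup_real X \<le> limsup_real Y + e"
      by (rule limsup_real_le[of X C, OF a(1)]) simp
  qed
  moreover have "(\<lambda>n. Y n - X n) \<longlonglongrightarrow> 0"
    using tendsto_minus[OF assms(3)] by simp
  ultimately show ?thesis using assms by (meson antisym)
qed

text \<open>The hypothesis says that the limit superior is at most the limit inferior, written as the negative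
  of the limit superior of the negated sequence.\<close>

lemma limsup_real_tendsto:
  assumes "\<And>n. \<bar>X n\<bar> \<le> C" "limsup_real X + limsup_real (\<lambda>n. - X n) \<le> 0"
  shows "X \<longlonglongrightarrow> limsup_real X"
proof (rule tendstoI)
  fix e :: real assume e: "0 < e"
  have "eventually (\<lambda>n. X n < limsup_real X + e) sequentially"
    using e by (intro eventually_less_limsup_real[of X C] assms) auto
  moreover have "eventually (\<lambda>n. - X n < limsup_real (\<lambda>n. - X n) + e) sequentially"
    using e assms(1) by (intro eventually_less_limsup_real[of _ C]) auto
  ultimately show "eventually (\<lambda>n. dist (X n) (limsup_real X) < e) sequentially"
    by eventually_elim (use assms(2) in \<open>auto simp: dist_real_def abs_less_iff\<close>)
qed

lemma limsup_real_measurable [measurable]: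
  assumes [measurable]: "\<And>n. f n \<in> borel_measurable M"
  shows "(\<lambda>x. limsup_real (\<lambda>n. f n x)) \<in> borel_measurable M"
  unfolding limsup_real_def by measurable

definition bdd_meas :: "'a measure \<Rightarrow> real \<Rightarrow> ('a \<Rightarrow> real) \<Rightarrow> bool" where
  "bdd_meas M C f \<longleftrightarrow> f \<in> borel_measurable M \<and> (\<forall>x\<in>space M. \<bar>f x\<bar> \<le> C)"

lemma (in finite_measure) bdd_meas_integrable: "bdd_meas M C f \<Longrightarrow> integrable M f"
  unfolding bdd_meas_def by (intro integrable_const_bound[where B=C]) auto

definition birkhoff_mean :: "('a \<Rightarrow> 'a) \<Rightarrow> nat \<Rightarrow> ('a \<Rightarrow> real) \<Rightarrow> 'a \<Rightarrow> real" where
  "birkhoff_mean S n f x = (\<Sum>k<n. f ((S ^^ k) x)) / real n"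

text \<open>The maximum of the first n+1 partial sums of g along the orbit, the empty sum included. In
  recursive form the inequality behind the maximal ergodic theorem is immediate.\<close>

primrec max_sum :: "('a \<Rightarrow> 'a) \<Rightarrow> ('a \<Rightarrow> real) \<Rightarrow> nat \<Rightarrow> 'a \<Rightarrow> real" where
  "max_sum S g 0 x = 0"
| "max_sum S g (Suc n) x = max 0 (g x + max_sum S g n (S x))"

lemma max_sum_nonneg: "0 \<le> max_sum S g n x"
  by (cases n) (auto simp: max_sum.simps(2))

lemma max_sum_Suc_ge: "max_sum S g n x \<le> max_sum S g (Suc n) x"
proof (induction n arbitrary: x)
  case (Suc n)
  show ?case
    unfolding max_sum.simps(2)[of S g n x] max_sum.simps(2)[of S g "Suc n" x]
    using Suc[of "S x"] by (intro max.mono add_left_mono) auto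
qed simp

declare max_sum.simps(2) [simp del]

lemma max_sum_mono: "n \<le> m \<Longrightarrow> max_sum S g n x \<le> max_sum S g m x"
  by (rule lift_Suc_mono_le[of "\<lambda>n. max_sum S g n x", OF max_sum_Suc_ge])

lemma max_sum_ge: "(\<Sum>k<n. g ((S ^^ k) x)) \<le> max_sum S g n x"
proof (induction n arbitrary: x)
  case (Suc n)
  have "(\<Sum>k<Suc n. g ((S ^^ k) x)) = g x + (\<Sum>k<n. g ((S ^^ k) (S x)))"
    by (subst sum.lessThan_Suc_shift) (simp add: funpow_swap1)
  then show ?case using Suc[of "S x"] by (simp add: max_sum.simps(2))
qed simp

lemma max_sum_bdd_meas:
  assumes "S \<in> measurable M M" "bdd_meas M C g"
  shows "bdd_meas M (real n * C) (max_sum S g n)"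
proof (induction n)
  case 0 then show ?case by (simp add: bdd_meas_def)
next
  case (Suc n)
  have [measurable]: "g \<in> borel_measurable M" "max_sum S g n \<in> borel_measurable M" "S \<in> measurable M M"
    using Suc assms by (auto simp: bdd_meas_def)
  have "\<bar>max 0 (g x + max_sum S g n (S x))\<bar> \<le> real (Suc n) * C" if x: "x \<in> space M" for x
  proof -
    have "S x \<in> space M" by (rule measurable_space[OF assms(1) x])
    then have "\<bar>max_sum S g n (S x)\<bar> \<le> real n * C" "\<bar>g x\<bar> \<le> C"
      using Suc assms(2) x by (auto simp: bdd_meas_def)
    then show ?thesis by (auto simp: algebra_simps)
  qed
  then show ?case by (auto simp: bdd_meas_def max_sum.simps(2)[abs_def])
qed

lemma measure_preserving_integral:
  fixes f :: "'a \<Rightarrow> real"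
  assumes "S \<in> measurable M M" "distr M M S = M" "f \<in> borel_measurable M"
  shows "(\<integral>x. f (S x) \<partial>M) = (\<integral>x. f x \<partial>M)"
  using integral_distr[OF assms(1,3)] assms(2) by simp

text \<open>Where the maximum m is positive, it equals g plus an earlier maximum at S x, hence is at most g
  plus m at S x. So the integrand dominates m - m o S everywhere, and the latter has integral 0.\<close>

lemma (in prob_space) maximal_ergodic:
  assumes S: "S \<in> measurable M M" "distr M M S = M" and g: "bdd_meas M C g"
  shows "0 \<le> (\<integral>x. (if 0 < max_sum S g (Suc n) x then g x else 0) \<partial>M)"
proof -
  let ?m = "max_sum S g (Suc n)"
  have m: "bdd_meas M (real (Suc n) * C) ?m" by (rule max_sum_bdd_meas[OF S(1) g])
  have [measurable]: "g \<in> borel_measurable M" "?m \<in> borel_measurable M" "S \<in> measurable M M"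
    using m g S by (auto simp: bdd_meas_def)
  have C: "0 \<le> C" using g not_empty by (force simp: bdd_meas_def)
  have mS: "bdd_meas M (real (Suc n) * C) (\<lambda>x. ?m (S x))"
    using m measurable_space[OF S(1)] unfolding bdd_meas_def by auto
  have gm: "bdd_meas M C (\<lambda>x. if 0 < ?m x then g x else 0)"
    using g C unfolding bdd_meas_def by auto
  have "0 = (\<integral>x. ?m x \<partial>M) - (\<integral>x. ?m (S x) \<partial>M)"
    by (subst measure_preserving_integral[OF S]) auto
  also have "\<dots> = (\<integral>x. ?m x - ?m (S x) \<partial>M)"
    by (intro Bochner_Integration.integral_diff[symmetric] bdd_meas_integrable[OF m] bdd_meas_integrable[OF mS])
  also have "\<dots> \<le> (\<integral>x. (if 0 < ?m x then g x else 0) \<partial>M)"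
  proof (rule integral_mono)
    show "integrable M (\<lambda>x. ?m x - ?m (S x))"
      by (intro Bochner_Integration.integrable_diff bdd_meas_integrable[OF m] bdd_meas_integrable[OF mS])
    show "integrable M (\<lambda>x. (if 0 < ?m x then g x else 0))" by (rule bdd_meas_integrable[OF gm])
    fix x
    show "?m x - ?m (S x) \<le> (if 0 < ?m x then g x else 0)"
    proof (cases "0 < ?m x")
      case True
      then have "?m x = g x + max_sum S g n (S x)" by (auto simp: max_sum.simps(2))
      then show ?thesis using True max_sum_Suc_ge[of S g n "S x"] by simp
    next
      case False
      then show ?thesis using max_sum_nonneg[of S g "Suc n" x] max_sum_nonneg[of S g "Suc n" "S x"]
        by simp
    qed
  qed
  finally show ?thesis .
qed

lemma funpow_space: "S \<in> measurable M M \<Longrightarrow> x \<in> space M \<Longrightarrow> (S ^^ k) x \<in> space M"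
  by (induction k) (auto simp: measurable_space)

lemma birkhoff_mean_bdd_meas:
  assumes S: "S \<in> measurable M M" and f: "bdd_meas M C f"
  shows "bdd_meas M C (birkhoff_mean S n f)"
proof -
  have [measurable]: "f \<in> borel_measurable M" using f by (simp add: bdd_meas_def)
  have [measurable]: "(S ^^ k) \<in> measurable M M" for k
    by (induction k) (use S in \<open>auto intro: measurable_comp\<close>)
  have "\<bar>birkhoff_mean S n f x\<bar> \<le> C" if x: "x \<in> space M" for x
  proof (cases "n = 0")
    case True
    then show ?thesis using f x by (force simp: birkhoff_mean_def bdd_meas_def)
  next
    case False
    have "\<bar>\<Sum>k<n. f ((S ^^ k) x)\<bar> \<le> (\<Sum>k<n. C)"
      using f x S by (intro order.trans[OF sum_abs] sum_mono) (auto simp: bdd_meas_def funpow_space)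
    then show ?thesis using False by (simp add: birkhoff_mean_def field_simps abs_divide)
  qed
  moreover have "birkhoff_mean S n f \<in> borel_measurable M"
    unfolding birkhoff_mean_def[abs_def] by measurable
  ultimately show ?thesis by (auto simp: bdd_meas_def)
qed

lemma birkhoff_mean_shift:
  "birkhoff_mean S n f (S x) - birkhoff_mean S n f x = (f ((S ^^ n) x) - f x) / real n"
proof -
  have "(\<Sum>k<n. f ((S ^^ k) (S x))) - (\<Sum>k<n. f ((S ^^ k) x)) = f ((S ^^ n) x) - f x"
    using sum_lessThan_telescope[of "\<lambda>k. f ((S ^^ k) x)" n]
    by (simp add: funpow_swap1 sum_subtractf)
  then show ?thesis by (simp add: birkhoff_mean_def diff_divide_distrib[symmetric])
qed

text \<open>The limit superior F of the means is S-invariant, so the partial sums of f - F + e behave like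
  those of f with a constant subtracted, and each orbit has a positive one. The sets in the maximal
  inequality for f - F + e therefore exhaust the space, which leaves \<open>\<integral>(f - F + e) \<ge> 0\<close>.\<close>

lemma (in prob_space) birkhoff_limsup_le:
  assumes S: "S \<in> measurable M M" "distr M M S = M" and f: "bdd_meas M C f"
  shows "(\<integral>x. limsup_real (\<lambda>n. birkhoff_mean S n f x) \<partial>M) \<le> (\<integral>x. f x \<partial>M)"
proof (rule field_le_epsilon)
  fix e :: real assume e: "0 < e"
  let ?F = "\<lambda>x. limsup_real (\<lambda>n. birkhoff_mean S n f x)"
  define g where "g x = f x - ?F x + e" for x
  have b: "\<bar>birkhoff_mean S n f x\<bar> \<le> C" if "x \<in> space M" for x n
    using birkhoff_mean_bdd_meas[OF S(1) f] that by (auto simp: bdd_meas_def)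
  have [measurable]: "f \<in> borel_measurable M" "\<And>n. birkhoff_mean S n f \<in> borel_measurable M"
    "S \<in> measurable M M"
    using f S birkhoff_mean_bdd_meas[OF S(1) f] by (auto simp: bdd_meas_def)
  have F: "bdd_meas M C ?F"
    unfolding bdd_meas_def using b by (auto intro!: limsup_real_bound)
  have g: "bdd_meas M (2 * C + e) g"
  proof -
    have "\<bar>g x\<bar> \<le> 2 * C + e" if "x \<in> space M" for x
    proof -
      have "\<bar>f x\<bar> \<le> C" "\<bar>?F x\<bar> \<le> C" using f F that by (auto simp: bdd_meas_def)
      then show ?thesis unfolding g_def using e by linarith
    qed
    then show ?thesis unfolding bdd_meas_def g_def by auto
  qed
  have [measurable]: "g \<in> borel_measurable M" using g by (simp add: bdd_meas_def)
  have [measurable]: "max_sum S g n \<in> borel_measurable M" for n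
    using max_sum_bdd_meas[OF S(1) g] by (auto simp: bdd_meas_def)
  have inv: "?F (S x) = ?F x" if x: "x \<in> space M" for x
  proof (rule limsup_real_cong)
    show "\<bar>birkhoff_mean S n f (S x)\<bar> \<le> C" "\<bar>birkhoff_mean S n f x\<bar> \<le> C" for n
      using b x measurable_space[OF S(1)] by auto
    have bd: "\<bar>(f ((S ^^ n) x) - f x)\<bar> \<le> 2 * C" for n
      using f x funpow_space[OF S(1) x, of n] unfolding bdd_meas_def by (smt (verit))
    have "(\<lambda>n. 2 * C / real n) \<longlonglongrightarrow> 0" by real_asymp
    then show "(\<lambda>n. birkhoff_mean S n f (S x) - birkhoff_mean S n f x) \<longlonglongrightarrow> 0"
      unfolding birkhoff_mean_shift
      by (rule Lim_null_comparison[rotated]) (use bd in \<open>auto simp: abs_divide intro!: divide_right_mono always_eventually\<close>)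
  qed
  have inv': "?F ((S ^^ k) x) = ?F x" if x: "x \<in> space M" for x k
    by (induction k) (auto simp: inv funpow_space[OF S(1) x])
  have pos: "\<exists>n. 0 < max_sum S g n x" if x: "x \<in> space M" for x
  proof -
    obtain n where n: "n \<ge> 1" "?F x - e < birkhoff_mean S n f x"
      using limsup_real_frequently[of "\<lambda>n. birkhoff_mean S n f x" C "?F x - e" 1] b[OF x] e by auto
    have "(\<Sum>k<n. g ((S ^^ k) x)) = (\<Sum>k<n. f ((S ^^ k) x)) - real n * (?F x - e)"
      using inv'[OF x] by (simp add: g_def sum.distrib sum_subtractf algebra_simps)
    also have "\<dots> > 0" using n by (simp add: birkhoff_mean_def field_simps)
    finally show ?thesis using max_sum_ge[of g S x n] by (metis less_le_trans)
  qed
  have "(\<lambda>n. \<integral>x. (if 0 < max_sum S g (Suc n) x then g x else 0) \<partial>M) \<longlonglongrightarrow> (\<integral>x. g x \<partial>M)"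
  proof (rule integral_dominated_convergence[where w="\<lambda>x. \<bar>g x\<bar>"])
    show "integrable M (\<lambda>x. \<bar>g x\<bar>)" using bdd_meas_integrable[OF g] by simp
    show "AE x in M. (\<lambda>n. if 0 < max_sum S g (Suc n) x then g x else 0) \<longlonglongrightarrow> g x"
    proof (rule AE_I2)
      fix x assume "x \<in> space M"
      then obtain N where N: "0 < max_sum S g N x" using pos by blast
      have "eventually (\<lambda>n. (if 0 < max_sum S g (Suc n) x then g x else 0) = g x) sequentially"
        unfolding eventually_sequentially
        by (rule exI[of _ N])
          (use N max_sum_mono[of N _ S g x] in \<open>auto simp del: max_sum.simps intro: less_le_trans\<close>)
      then show "(\<lambda>n. if 0 < max_sum S g (Suc n) x then g x else 0) \<longlonglongrightarrow> g x"
        by (rule tendsto_eventually)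
    qed
  qed (auto simp del: max_sum.simps)
  then have "0 \<le> (\<integral>x. g x \<partial>M)"
    by (rule LIMSEQ_le_const) (use maximal_ergodic[OF S g] in blast)
  also have "(\<integral>x. g x \<partial>M) = (\<integral>x. f x \<partial>M) - (\<integral>x. ?F x \<partial>M) + e"
    unfolding g_def using bdd_meas_integrable[OF f] bdd_meas_integrable[OF F] by (simp add: prob_space)
  finally show "(\<integral>x. ?F x \<partial>M) \<le> (\<integral>x. f x \<partial>M) + e" by simp
qed

text \<open>Applied to f and to -f, the previous bound says that the limit superior F and the limit inferior
  satisfy \<open>\<integral>F \<le> \<integral>f \<le> \<integral>liminf\<close>. Since the limit inferior is the smaller one, they agree almost
  everywhere.\<close>

lemma (in prob_space) birkhoff_ergodic:
  assumes S: "S \<in> measurable M M" "distr M M S = M" and f: "bdd_meas M C f"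
  shows "\<exists>F. bdd_meas M C F \<and> (AE x in M. (\<lambda>n. birkhoff_mean S n f x) \<longlonglongrightarrow> F x)
    \<and> (\<integral>x. F x \<partial>M) = (\<integral>x. f x \<partial>M)"
proof -
  have f': "bdd_meas M C (\<lambda>x. - f x)" using f by (simp add: bdd_meas_def)
  let ?F = "\<lambda>x. limsup_real (\<lambda>n. birkhoff_mean S n f x)"
  let ?F' = "\<lambda>x. limsup_real (\<lambda>n. - birkhoff_mean S n f x)"
  have m: "birkhoff_mean S n (\<lambda>x. - f x) x = - birkhoff_mean S n f x" for n x
    by (simp add: birkhoff_mean_def sum_negf)
  have b: "\<bar>birkhoff_mean S n f x\<bar> \<le> C" if "x \<in> space M" for x n
    using birkhoff_mean_bdd_meas[OF S(1) f] that by (auto simp: bdd_meas_def)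
  have [measurable]: "\<And>n. birkhoff_mean S n f \<in> borel_measurable M"
    using birkhoff_mean_bdd_meas[OF S(1) f] by (auto simp: bdd_meas_def)
  have F: "bdd_meas M C ?F" "bdd_meas M C ?F'"
    unfolding bdd_meas_def using b by (auto intro!: limsup_real_bound)
  note iF = F[THEN bdd_meas_integrable] bdd_meas_integrable[OF f]
  have ge: "0 \<le> ?F x + ?F' x" if x: "x \<in> space M" for x
  proof (rule ccontr)
    assume neg: "\<not> ?thesis"
    define e where "e = - (?F x + ?F' x) / 2"
    have e: "e > 0" using neg by (simp add: e_def)
    have "eventually (\<lambda>n. birkhoff_mean S n f x < ?F x + e) sequentially"
      using e b[OF x] by (intro eventually_less_limsup_real[of _ C]) auto
    moreover have "eventually (\<lambda>n. - birkhoff_mean S n f x < ?F' x + e) sequentially"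
      using e b[OF x] by (intro eventually_less_limsup_real[of _ C]) auto
    ultimately have "eventually (\<lambda>n::nat. False) sequentially"
      by eventually_elim (auto simp: e_def field_simps)
    then show False by simp
  qed
  have le: "(\<integral>x. ?F x \<partial>M) \<le> (\<integral>x. f x \<partial>M)" by (rule birkhoff_limsup_le[OF S f])
  have le': "(\<integral>x. ?F' x \<partial>M) \<le> - (\<integral>x. f x \<partial>M)"
    using birkhoff_limsup_le[OF S f'] by (simp add: m)
  have "0 \<le> (\<integral>x. ?F x + ?F' x \<partial>M)" using ge by (intro integral_nonneg_AE AE_I2)
  then have eq: "(\<integral>x. ?F x + ?F' x \<partial>M) = 0" "(\<integral>x. ?F x \<partial>M) = (\<integral>x. f x \<partial>M)"
    using le le' iF by auto
  have "AE x in M. ?F x + ?F' x = 0"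
    using eq(1) iF ge by (subst integral_nonneg_eq_0_iff_AE[symmetric]) auto
  then have "AE x in M. (\<lambda>n. birkhoff_mean S n f x) \<longlonglongrightarrow> ?F x"
    using AE_space by eventually_elim (intro limsup_real_tendsto[of _ C], use b in auto)
  with F(1) eq(2) show ?thesis by blast
qed

text \<open>The features of Birkhoff means that are needed to iterate them: bounds are kept, the operators are
  additive and monotone at every single point, and the pointwise ergodic theorem holds. They lead
  from one map to several commuting ones.\<close>

definition averaging_scheme :: "'a measure \<Rightarrow> (nat \<Rightarrow> ('a \<Rightarrow> real) \<Rightarrow> 'a \<Rightarrow> real) \<Rightarrow> bool" where
  "averaging_scheme M A \<longleftrightarrow>
     (\<forall>C f n. bdd_meas M C f \<longrightarrow> bdd_meas M C (A n f)) \<and>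
     (\<forall>n f g x. A n (\<lambda>y. f y - g y) x = A n f x - A n g x) \<and>
     (\<forall>n f g x. x \<in> space M \<longrightarrow> (\<forall>y\<in>space M. f y \<le> g y) \<longrightarrow> A n f x \<le> A n g x) \<and>
     (\<forall>C f. bdd_meas M C f \<longrightarrow> (\<exists>F. bdd_meas M C F \<and>
        (AE x in M. (\<lambda>n. A n f x) \<longlonglongrightarrow> F x) \<and> (\<integral>x. F x \<partial>M) = (\<integral>x. f x \<partial>M)))"

lemma (in prob_space) averaging_scheme_birkhoff:
  assumes S: "S \<in> measurable M M" "distr M M S = M"
  shows "averaging_scheme M (birkhoff_mean S)"
  unfolding averaging_scheme_def
proof (intro conjI allI impI)
  fix n x and f g :: "'a \<Rightarrow> real" assume "x \<in> space M" "\<forall>y\<in>space M. f y \<le> g y"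
  then show "birkhoff_mean S n f x \<le> birkhoff_mean S n g x"
    unfolding birkhoff_mean_def
    by (intro divide_right_mono sum_mono) (auto simp: funpow_space[OF S(1)])
next
  fix n x and f g :: "'a \<Rightarrow> real"
  show "birkhoff_mean S n (\<lambda>y. f y - g y) x = birkhoff_mean S n f x - birkhoff_mean S n g x"
    by (simp add: birkhoff_mean_def sum_subtractf diff_divide_distrib)
qed (use birkhoff_mean_bdd_meas[OF S(1)] birkhoff_ergodic[OF S] in blast)+

text \<open>Let \<open>B n f\<close> tend to G. The difference of \<open>A n (B n f)\<close> and \<open>A n G\<close> is at most \<open>A n (h N)\<close> for all
  n \<ge> N, where \<open>h N\<close> is the supremum of \<open>\<bar>B n f - G\<bar>\<close> over n \<ge> N. As n grows, \<open>A n (h N)\<close> tends to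
  a function with the integral of \<open>h N\<close>, and this integral tends to 0 because \<open>h N\<close> is bounded and
  decreases to 0 almost everywhere.\<close>

lemma (in prob_space) averaging_scheme_compose:
  assumes A: "averaging_scheme M A" and B: "averaging_scheme M B"
  shows "averaging_scheme M (\<lambda>n f. A n (B n f))"
proof -
  note Abd = A[unfolded averaging_scheme_def, THEN conjunct1, rule_format]
  note Bbd = B[unfolded averaging_scheme_def, THEN conjunct1, rule_format]
  note Adiff = A[unfolded averaging_scheme_def, THEN conjunct2, THEN conjunct1, rule_format]
  note Bdiff = B[unfolded averaging_scheme_def, THEN conjunct2, THEN conjunct1, rule_format]
  note Amono = A[unfolded averaging_scheme_def, THEN conjunct2, THEN conjunct2, THEN conjunct1, rule_format]
  note Bmono = B[unfolded averaging_scheme_def, THEN conjunct2, THEN conjunct2, THEN conjunct1, rule_format]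
  note Alim = A[unfolded averaging_scheme_def, THEN conjunct2, THEN conjunct2, THEN conjunct2, rule_format]
  note Blim = B[unfolded averaging_scheme_def, THEN conjunct2, THEN conjunct2, THEN conjunct2, rule_format]
  have A0: "A n (\<lambda>y. 0) x = 0" for n x
    using Adiff[of n "\<lambda>y. 0" "\<lambda>y. 0" x] by simp
  have Aabs: "\<bar>A n u x\<bar> \<le> A n v x" if "x \<in> space M" "\<And>y. y \<in> space M \<Longrightarrow> \<bar>u y\<bar> \<le> v y" for n u v x
  proof -
    have "A n u x \<le> A n v x" using that by (intro Amono) (auto simp: abs_le_iff)
    moreover have "A n (\<lambda>y. 0 - u y) x \<le> A n v x" using that by (intro Amono) (auto simp: abs_le_iff)
    moreover have "A n (\<lambda>y. 0 - u y) x = - A n u x" using Adiff[of n "\<lambda>y. 0" u x] A0 by simp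
    ultimately show ?thesis by (simp add: abs_le_iff)
  qed
  have "\<exists>F. bdd_meas M C F \<and> (AE x in M. (\<lambda>n. A n (B n f) x) \<longlonglongrightarrow> F x) \<and> (\<integral>x. F x \<partial>M) = (\<integral>x. f x \<partial>M)"
    if f: "bdd_meas M C f" for C f
  proof -
    obtain G where G: "bdd_meas M C G" "AE x in M. (\<lambda>n. B n f x) \<longlonglongrightarrow> G x"
      "(\<integral>x. G x \<partial>M) = (\<integral>x. f x \<partial>M)" using Blim[OF f] by blast
    obtain H where H: "bdd_meas M C H" "AE x in M. (\<lambda>n. A n G x) \<longlonglongrightarrow> H x"
      "(\<integral>x. H x \<partial>M) = (\<integral>x. G x \<partial>M)" using Alim[OF G(1)] by blast
    define d where "d n x = \<bar>B n f x - G x\<bar>" for n x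
    define h where "h N x = (SUP n. d (n + N) x)" for N x
    have [measurable]: "G \<in> borel_measurable M" "B n f \<in> borel_measurable M" for n
      using G(1) Bbd[OF f] by (auto simp: bdd_meas_def)
    have [measurable]: "d n \<in> borel_measurable M" for n unfolding d_def by measurable
    have d: "\<bar>d n x\<bar> \<le> 2 * C" if "x \<in> space M" for n x
      using that G(1) Bbd[OF f, of n] unfolding bdd_meas_def d_def by (smt (verit))
    have bd: "bdd_above (range (\<lambda>n. d (n + N) x))" if "x \<in> space M" for N x
      using d[OF that] by (intro bdd_aboveI2[where M="2*C"]) (auto simp: abs_le_iff)
    have dh: "d n x \<le> h N x" if "N \<le> n" "x \<in> space M" for n N x
      unfolding h_def using cSUP_upper[OF UNIV_I bd[OF that(2), of N], of "n - N"] that(1) by simp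
    have h: "bdd_meas M (2 * C) (h N)" for N
      unfolding bdd_meas_def
    proof (intro conjI ballI)
      show "h N \<in> borel_measurable M" unfolding h_def
        by (rule borel_measurable_cSUP) (auto simp: bd)
      fix x assume x: "x \<in> space M"
      have "h N x \<le> 2 * C" unfolding h_def using d[OF x] by (intro cSUP_least) (auto simp: abs_le_iff)
      moreover have "0 \<le> h N x" by (rule order.trans[OF _ dh[OF order.refl x]]) (simp add: d_def)
      ultimately show "\<bar>h N x\<bar> \<le> 2 * C" by simp
    qed
    have hlim: "AE x in M. (\<lambda>N. h N x) \<longlonglongrightarrow> 0"
      using G(2) AE_space
    proof eventually_elim
      fix x assume l: "(\<lambda>n. B n f x) \<longlonglongrightarrow> G x" and x: "x \<in> space M"
      show "(\<lambda>N. h N x) \<longlonglongrightarrow> 0"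
      proof (rule tendstoI)
        fix e :: real assume e: "0 < e"
        from tendstoD[OF l, of "e/2"] e obtain N where N: "\<And>n. n \<ge> N \<Longrightarrow> d n x < e / 2"
          by (auto simp: eventually_sequentially dist_real_def d_def)
        have "dist (h n x) 0 < e" if "n \<ge> N" for n
        proof -
          have "h n x \<le> e / 2" unfolding h_def by (intro cSUP_least) (use N that in \<open>auto intro!: less_imp_le\<close>)
          moreover have "0 \<le> h n x" by (rule order.trans[OF _ dh[OF order.refl x]]) (simp add: d_def)
          ultimately show ?thesis using e by simp
        qed
        then show "\<forall>\<^sub>F n in sequentially. dist (h n x) 0 < e"
          by (auto simp: eventually_sequentially)
      qed
    qed
    have "(\<lambda>N. \<integral>x. h N x \<partial>M) \<longlonglongrightarrow> (\<integral>x. 0 \<partial>M)"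
      by (rule integral_dominated_convergence[where w="\<lambda>x. 2 * C"])
         (use h hlim in \<open>auto simp: bdd_meas_def\<close>)
    then have hint: "(\<lambda>N. \<integral>x. h N x \<partial>M) \<longlonglongrightarrow> 0" by simp
    have "\<forall>N. \<exists>K. bdd_meas M (2 * C) K \<and> (AE x in M. (\<lambda>n. A n (h N) x) \<longlonglongrightarrow> K x) \<and>
        (\<integral>x. K x \<partial>M) = (\<integral>x. h N x \<partial>M)" using Alim[OF h] by blast
    from choice[OF this]
    obtain K where K: "\<And>N. bdd_meas M (2 * C) (K N)" "\<And>N. AE x in M. (\<lambda>n. A n (h N) x) \<longlonglongrightarrow> K N x"
      "\<And>N. (\<integral>x. K N x \<partial>M) = (\<integral>x. h N x \<partial>M)" by blast
    define X where "X n x = \<bar>A n (B n f) x - A n G x\<bar>" for n x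
    have [measurable]: "A n (B n f) \<in> borel_measurable M" "A n G \<in> borel_measurable M" for n
      using Abd[OF Bbd[OF f]] Abd[OF G(1)] by (auto simp: bdd_meas_def)
    have [measurable]: "X n \<in> borel_measurable M" for n unfolding X_def by measurable
    have Xb: "\<bar>X n x\<bar> \<le> 2 * C" if "x \<in> space M" for n x
      using that Abd[OF Bbd[OF f], of n n] Abd[OF G(1), of n] unfolding bdd_meas_def X_def by (smt (verit))
    have Xh: "X n x \<le> A n (h N) x" if "N \<le> n" "x \<in> space M" for n N x
      unfolding X_def Adiff[symmetric] using dh[OF that(1)]
      by (intro Aabs that) (auto simp: d_def)
    let ?D = "\<lambda>x. limsup_real (\<lambda>n. X n x)"
    have D: "bdd_meas M (2 * C) ?D"
      unfolding bdd_meas_def using Xb by (auto intro!: limsup_real_bound)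
    have DK: "AE x in M. ?D x \<le> K N x" for N
      using K(2)[of N] AE_space
    proof eventually_elim
      fix x assume "(\<lambda>n. A n (h N) x) \<longlonglongrightarrow> K N x" "x \<in> space M"
      then show "?D x \<le> K N x"
        using Xb Xh by (intro limsup_real_le[of _ "2 * C" "\<lambda>n. A n (h N) x"])
          (auto simp: eventually_sequentially intro!: exI[of _ N])
    qed
    have D0: "0 \<le> ?D x" if "x \<in> space M" for x
    proof (rule ccontr)
      assume "\<not> ?thesis"
      then have "eventually (\<lambda>n. X n x < 0) sequentially"
        using Xb[OF that] by (intro eventually_less_limsup_real[of _ "2*C"]) auto
      then show False by (auto simp: X_def eventually_sequentially)
    qed
    have "(\<integral>x. ?D x \<partial>M) \<le> (\<integral>x. h N x \<partial>M)" for N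
      unfolding K(3)[symmetric]
      by (rule integral_mono_AE[OF bdd_meas_integrable[OF D] bdd_meas_integrable[OF K(1)] DK])
    then have "(\<integral>x. ?D x \<partial>M) \<le> 0" by (intro LIMSEQ_le_const[OF hint]) auto
    moreover have "0 \<le> (\<integral>x. ?D x \<partial>M)" using D0 by (intro integral_nonneg_AE AE_I2)
    ultimately have "AE x in M. ?D x = 0"
      using D0 bdd_meas_integrable[OF D] by (subst integral_nonneg_eq_0_iff_AE[symmetric]) auto
    then have "AE x in M. (\<lambda>n. A n (B n f) x) \<longlonglongrightarrow> H x"
      using H(2) AE_space
    proof eventually_elim
      fix x assume D0: "?D x = 0" and l: "(\<lambda>n. A n G x) \<longlonglongrightarrow> H x" and x: "x \<in> space M"
      have "(\<lambda>n. A n (B n f) x - A n G x) \<longlonglongrightarrow> 0"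
      proof (rule tendstoI)
        fix e :: real assume "0 < e"
        then have "eventually (\<lambda>n. X n x < e) sequentially"
          using D0 Xb[OF x] by (intro eventually_less_limsup_real[of _ "2*C"]) auto
        then show "\<forall>\<^sub>F n in sequentially. dist (A n (B n f) x - A n G x) 0 < e"
          by (simp add: X_def)
      qed
      from tendsto_add[OF this l] show "(\<lambda>n. A n (B n f) x) \<longlonglongrightarrow> H x" by simp
    qed
    with H G show ?thesis by auto
  qed
  moreover have "bdd_meas M C (A n (B n f))" if "bdd_meas M C f" for C f n
    using that by (intro Abd Bbd)
  moreover have "A n (B n (\<lambda>y. f y - g y)) x = A n (B n f) x - A n (B n g) x" for n f g x
  proof -
    have "B n (\<lambda>y. f y - g y) = (\<lambda>y. B n f y - B n g y)" using Bdiff by auto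
    then show ?thesis using Adiff by simp
  qed
  moreover have "A n (B n f) x \<le> A n (B n g) x" if "x \<in> space M" "\<forall>y\<in>space M. f y \<le> g y" for n f g x
    using that by (intro Amono Bmono) auto
  ultimately show ?thesis unfolding averaging_scheme_def by blast
qed

section \<open>Bounded functions on space and their rescalings\<close>

definition heaviside :: "real \<Rightarrow> real" where
  "heaviside t = (if 0 < t then 1 else 0)"

text \<open>This is the indicator of (0, c] if c is positive, and minus the indicator of (c, 0] if c is
  negative. As a difference of two step functions it turns translation sums into telescoping sums,
  for both signs of c alike.\<close>

definition signed_interval :: "real \<Rightarrow> real \<Rightarrow> real" where
  "signed_interval c t = heaviside t - heaviside (t - c)"

text \<open>Up to a sign, the indicator of the box with opposite corners 0 and c. Since the signs of the
  components of c are arbitrary, all eight orthants are covered.\<close>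

definition corner_box :: "real^3 \<Rightarrow> real^3 \<Rightarrow> real" where
  "corner_box c x =
     signed_interval (c $ 1) (x $ 1) * signed_interval (c $ 2) (x $ 2) * signed_interval (c $ 3) (x $ 3)"

lemma measurable_vec_nth3 [measurable]: "(\<lambda>x::real^3. x $ i) \<in> borel_measurable borel"
  by (intro borel_measurable_continuous_onI continuous_intros)

lemma heaviside_measurable [measurable]: "heaviside \<in> borel_measurable borel"
  unfolding heaviside_def[abs_def] by measurable

lemma signed_interval_measurable [measurable]: "signed_interval c \<in> borel_measurable borel"
  unfolding signed_interval_def[abs_def] by measurable

lemma corner_box_measurable [measurable]: "corner_box c \<in> borel_measurable borel"
  unfolding corner_box_def[abs_def] by measurable

lemma isCont_heaviside: "t \<noteq> 0 \<Longrightarrow> isCont heaviside t"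
proof -
  assume t: "t \<noteq> 0"
  have "eventually (\<lambda>s. heaviside s = (if 0 < t then 1 else 0)) (nhds t)"
  proof (cases "0 < t")
    case True
    then show ?thesis
      using eventually_nhds_in_open[of "{0<..}" t] by (auto simp: heaviside_def elim: eventually_mono)
  next
    case False
    with t show ?thesis
      using eventually_nhds_in_open[of "{..<0}" t] by (auto simp: heaviside_def elim: eventually_mono)
  qed
  from isCont_cong[OF this] show ?thesis by simp
qed

lemma isCont_signed_interval: "t \<noteq> 0 \<Longrightarrow> t \<noteq> c \<Longrightarrow> isCont (signed_interval c) t"
  unfolding signed_interval_def[abs_def]
  by (rule isCont_diff[OF isCont_heaviside isCont_o2[where f="\<lambda>s. s - c" and g=heaviside]])
     (simp_all add: isCont_heaviside)

text \<open>The discontinuities lie on finitely many coordinate hyperplanes, which are null sets. This is what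
  makes dominated convergence applicable to perturbed boxes.\<close>

lemma isCont_corner_box:
  assumes "\<And>i. x $ i \<noteq> 0 \<and> x $ i \<noteq> c $ i"
  shows "isCont (corner_box c) x"
proof -
  have "isCont (\<lambda>x. signed_interval (c $ i) (x $ i)) x" for i
    using assms[of i]
    by (intro isCont_o2[where f="\<lambda>x. x $ i" and g="signed_interval (c $ i)"] isCont_signed_interval
        continuous_component continuous_ident) simp_all
  then show ?thesis unfolding corner_box_def[abs_def] by (intro continuous_mult)
qed

lemma AE_component_neq: "AE x in lborel. (x :: real^3) $ i \<noteq> a"
proof -
  have "{x::real^3. x $ i = a} \<in> null_sets lebesgue"
    using negligible_standard_hyperplane[of "axis i 1 :: real^3" a]
    by (simp add: negligible_iff_null_sets cart_eq_inner_axis axis_in_Basis_iff)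
  moreover have "{x::real^3. x $ i = a} \<in> sets borel" by measurable
  ultimately have "{x::real^3. x $ i = a} \<in> null_sets lborel"
    by (simp add: null_sets_completion_iff)
  from AE_not_in[OF this] show ?thesis by simp
qed

lemma AE_isCont_corner_box: "AE x in lborel. isCont (corner_box c) x"
proof -
  have "AE x in lborel. \<forall>i. (x :: real^3) $ i \<noteq> 0 \<and> x $ i \<noteq> c $ i"
    by (subst AE_all_countable) (auto intro: AE_component_neq)
  then show ?thesis by eventually_elim (rule isCont_corner_box, auto)
qed

lemma signed_interval_support: "signed_interval c t \<noteq> 0 \<Longrightarrow> \<bar>t\<bar> \<le> \<bar>c\<bar>"
  by (auto simp: signed_interval_def heaviside_def split: if_splits)

lemma signed_interval_le_1: "\<bar>signed_interval c t\<bar> \<le> 1"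
  by (auto simp: signed_interval_def heaviside_def)

lemma corner_box_le_1: "\<bar>corner_box c x\<bar> \<le> 1"
  unfolding corner_box_def abs_mult
  by (intro mult_le_one mult_nonneg_nonneg signed_interval_le_1) auto

lemma corner_box_support: "corner_box c x \<noteq> 0 \<Longrightarrow> norm x \<le> norm c"
proof -
  assume "corner_box c x \<noteq> 0"
  then have "\<bar>x $ 1\<bar> \<le> \<bar>c $ 1\<bar>" "\<bar>x $ 2\<bar> \<le> \<bar>c $ 2\<bar>" "\<bar>x $ 3\<bar> \<le> \<bar>c $ 3\<bar>"
    by (auto simp: corner_box_def intro!: signed_interval_support)
  then have "\<forall>i. \<bar>x $ i\<bar> \<le> \<bar>c $ i\<bar>" by (simp add: forall_3)
  then show ?thesis by (intro norm_le_componentwise_cart) auto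
qed

lemma integrable_indicator_cball [simp]: "integrable lborel (indicator (cball (a::real^3) r) :: _ \<Rightarrow> real)"
  by (rule integrable_real_indicator) (use emeasure_bounded_finite[OF bounded_cball, of a r] in auto)

lemma integrable_bounded_support:
  fixes f :: "real^3 \<Rightarrow> real"
  assumes [measurable]: "f \<in> borel_measurable borel"
    and "\<And>x. \<bar>f x\<bar> \<le> B" "\<And>x. f x \<noteq> 0 \<Longrightarrow> norm x \<le> R"
  shows "integrable lborel f"
proof (rule Bochner_Integration.integrable_bound)
  show "integrable lborel (\<lambda>x. B * indicator (cball (0::real^3) R) x)" by simp
  show "AE x in lborel. norm (f x) \<le> norm (B * indicator (cball 0 R) x)"
    using assms(2,3) by (intro AE_I2) (auto simp: indicator_def intro: order.trans[OF _ abs_ge_self])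
qed simp

lemma corner_box_integrable: "integrable lborel (corner_box c)"
  by (rule integrable_bounded_support[where B=1 and R="norm c"])
     (auto simp: corner_box_le_1 corner_box_support)

lemma integral_lborel_scale:
  fixes f :: "real^3 \<Rightarrow> real"
  assumes [measurable]: "f \<in> borel_measurable borel" and r: "0 < r"
  shows "(\<integral>x. f x \<partial>lborel) = r ^ 3 * (\<integral>x. f (r *\<^sub>R x) \<partial>lborel)"
proof -
  have "(\<integral>x. f x \<partial>lborel) =
      (\<integral>x. f x \<partial>density (distr lborel borel (\<lambda>x. 0 + r *\<^sub>R x)) (\<lambda>_. ennreal (\<bar>r\<bar>^DIM(real^3))))"
    using lborel_affine[of r "0::real^3"] r by simp
  also have "\<dots> = r ^ 3 * (\<integral>x. f (r *\<^sub>R x) \<partial>lborel)"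
    using r by (subst integral_density) (auto simp: integral_distr)
  finally show ?thesis .
qed

lemma integral_lborel_translate:
  fixes f :: "real^3 \<Rightarrow> real"
  assumes [measurable]: "f \<in> borel_measurable borel"
  shows "(\<integral>x. f (x + y) \<partial>lborel) = (\<integral>x. f x \<partial>lborel)"
proof -
  have "(\<integral>x. f x \<partial>lborel) = (\<integral>x. f x \<partial>distr lborel borel ((+) y))"
    by (simp add: lborel_distr_plus)
  also have "\<dots> = (\<integral>x. f (y + x) \<partial>lborel)" by (rule integral_distr) auto
  finally show ?thesis by (simp add: add.commute)
qed

text \<open>Translations and dilations act continuously on corner boxes in the \<open>L\<^sup>1\<close> norm, by dominated
  convergence. Tested against a bounded function, a slightly moved box gives almost the same
  integral, uniformly in that function.\<close>

lemma corner_box_affine_L1: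
  fixes r :: "nat \<Rightarrow> real" and z :: "nat \<Rightarrow> real^3"
  assumes r: "r \<longlonglongrightarrow> 1" and z: "z \<longlonglongrightarrow> 0"
  shows "(\<lambda>n. \<integral>x. \<bar>r n ^ 3 * corner_box c (r n *\<^sub>R x - z n) - corner_box c x\<bar> \<partial>lborel) \<longlonglongrightarrow> 0"
proof -
  \<comment> \<open>The dominating function needs the parameters to be close to their limits, which holds for large n
  only; the terms with smaller n are replaced by 0.\<close>
  define ok where "ok n \<longleftrightarrow> 1/2 \<le> r n \<and> r n \<le> 2 \<and> norm (z n) \<le> 1" for n
  define s where "s n x = (if ok n then \<bar>r n ^ 3 * corner_box c (r n *\<^sub>R x - z n) - corner_box c x\<bar> else 0)"
    for n x
  have "eventually (\<lambda>n. dist (r n) 1 < 1/2) sequentially" using tendstoD[OF r, of "1/2"] by simp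
  moreover have "eventually (\<lambda>n. dist (z n) 0 < 1) sequentially" using tendstoD[OF z, of 1] by simp
  ultimately have ok: "eventually ok sequentially"
    by eventually_elim (auto simp: ok_def dist_real_def abs_if split: if_splits)
  have "(\<lambda>n. \<integral>x. s n x \<partial>lborel) \<longlonglongrightarrow> (\<integral>x. 0 \<partial>(lborel :: (real^3) measure))"
  proof (rule integral_dominated_convergence[where w="\<lambda>x. 9 * indicator (cball 0 (2 * (norm c + 1))) x"])
    show "AE x in lborel. (\<lambda>n. s n x) \<longlonglongrightarrow> 0"
      using AE_isCont_corner_box[of c]
    proof eventually_elim
      fix x assume x: "isCont (corner_box c) x"
      have "(\<lambda>n. r n *\<^sub>R x - z n) \<longlonglongrightarrow> 1 *\<^sub>R x - 0" by (intro tendsto_intros r z)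
      then have "(\<lambda>n. corner_box c (r n *\<^sub>R x - z n)) \<longlonglongrightarrow> corner_box c x"
        by (intro isCont_tendsto_compose[OF x]) simp
      then have "(\<lambda>n. \<bar>r n ^ 3 * corner_box c (r n *\<^sub>R x - z n) - corner_box c x\<bar>)
          \<longlonglongrightarrow> \<bar>1 ^ 3 * corner_box c x - corner_box c x\<bar>"
        by (intro tendsto_intros r)
      then have "(\<lambda>n. \<bar>r n ^ 3 * corner_box c (r n *\<^sub>R x - z n) - corner_box c x\<bar>) \<longlonglongrightarrow> 0" by simp
      then show "(\<lambda>n. s n x) \<longlonglongrightarrow> 0"
        by (rule Lim_transform_eventually) (use ok in \<open>auto simp: s_def elim: eventually_mono\<close>)
    qed
    show "AE x in lborel. norm (s n x) \<le> 9 * indicator (cball 0 (2 * (norm c + 1))) x" for n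
    proof (rule AE_I2)
      fix x :: "real^3"
      show "norm (s n x) \<le> 9 * indicator (cball 0 (2 * (norm c + 1))) x"
      proof (cases "ok n \<and> (corner_box c (r n *\<^sub>R x - z n) \<noteq> 0 \<or> corner_box c x \<noteq> 0)")
        case True
        then have rz: "1/2 \<le> r n" "r n \<le> 2" "norm (z n) \<le> 1" by (auto simp: ok_def)
        have "norm x \<le> 2 * (norm c + 1)"
        proof (cases "corner_box c x = 0")
          case True
          with \<open>ok n \<and> _\<close> have "norm (r n *\<^sub>R x - z n) \<le> norm c" by (intro corner_box_support) auto
          then have "norm (r n *\<^sub>R x) \<le> norm c + 1"
            using rz norm_triangle_ineq[of "r n *\<^sub>R x - z n" "z n"] by simp
          moreover have "1/2 * norm x \<le> norm (r n *\<^sub>R x)"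
            using mult_right_mono[OF rz(1) norm_ge_zero[of x]] rz by simp
          ultimately show ?thesis by simp
        next
          case False
          then have "norm x \<le> norm c" by (rule corner_box_support)
          then show ?thesis using norm_ge_zero[of c] by (smt (verit))
        qed
        moreover have "\<bar>r n ^ 3 * corner_box c (r n *\<^sub>R x - z n) - corner_box c x\<bar> \<le> 9"
        proof -
          have "\<bar>r n ^ 3 * corner_box c (r n *\<^sub>R x - z n)\<bar> \<le> 2 ^ 3 * 1"
            unfolding abs_mult power_abs using rz
            by (intro mult_mono power_mono corner_box_le_1) auto
          then show ?thesis using corner_box_le_1[of c x] by simp
        qed
        ultimately show ?thesis using True by (simp add: s_def)
      qed (auto simp: s_def)
    qed
    show "s n \<in> borel_measurable lborel" for n unfolding s_def by measurable
  qed auto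
  then have "(\<lambda>n. \<integral>x. s n x \<partial>lborel) \<longlonglongrightarrow> 0" by simp
  then show ?thesis
    by (rule Lim_transform_eventually) (use ok in \<open>auto simp: s_def elim: eventually_mono\<close>)
qed

lemma integrable_mult_bounded:
  fixes k u :: "real^3 \<Rightarrow> real"
  assumes "integrable lborel k" "u \<in> borel_measurable borel" "\<And>x. \<bar>u x\<bar> \<le> C"
  shows "integrable lborel (\<lambda>x. k x * u x)"
proof (rule Bochner_Integration.integrable_bound)
  show "integrable lborel (\<lambda>x. C * k x)" using assms(1) by simp
  show "(\<lambda>x. k x * u x) \<in> borel_measurable lborel" using assms(1,2) by auto
  have "\<bar>k x\<bar> * \<bar>u x\<bar> \<le> \<bar>C\<bar> * \<bar>k x\<bar>" for x
    using assms(3)[of x] by (subst mult.commute) (intro mult_right_mono; linarith)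
  then show "AE x in lborel. norm (k x * u x) \<le> norm (C * k x)"
    by (simp add: abs_mult)
qed

lemma integral_mult_bounded_diff:
  fixes k k' u :: "real^3 \<Rightarrow> real"
  assumes k: "integrable lborel k" "integrable lborel k'"
    and u: "u \<in> borel_measurable borel" "\<And>x. \<bar>u x\<bar> \<le> C"
  shows "\<bar>(\<integral>x. k x * u x \<partial>lborel) - (\<integral>x. k' x * u x \<partial>lborel)\<bar> \<le> C * (\<integral>x. \<bar>k x - k' x\<bar> \<partial>lborel)"
proof -
  have i: "integrable lborel (\<lambda>x. (k x - k' x) * u x)"
    by (intro integrable_mult_bounded[where C=C] u Bochner_Integration.integrable_diff k)
  have "(\<integral>x. k x * u x \<partial>lborel) - (\<integral>x. k' x * u x \<partial>lborel) = (\<integral>x. (k x - k' x) * u x \<partial>lborel)"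
    using integrable_mult_bounded[OF k(1) u] integrable_mult_bounded[OF k(2) u]
    by (simp add: left_diff_distrib)
  also have "\<bar>\<dots>\<bar> \<le> (\<integral>x. \<bar>(k x - k' x) * u x\<bar> \<partial>lborel)"
    by (rule integral_abs_bound)
  also have "\<dots> \<le> (\<integral>x. C * \<bar>k x - k' x\<bar> \<partial>lborel)"
  proof (rule integral_mono)
    show "integrable lborel (\<lambda>x. \<bar>(k x - k' x) * u x\<bar>)" using i by simp
    show "integrable lborel (\<lambda>x. C * \<bar>k x - k' x\<bar>)" using k by simp
    show "\<bar>(k x - k' x) * u x\<bar> \<le> C * \<bar>k x - k' x\<bar>" for x
      unfolding abs_mult using u(2)[of x] by (subst mult.commute) (intro mult_right_mono; simp)
  qed
  finally show ?thesis by simp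
qed

text \<open>Translates by multiples of c tile the interval from 0 to n c.\<close>

lemma signed_interval_telescope: "(\<Sum>k<n. signed_interval c (t - real k * c)) = signed_interval (real n * c) t"
  by (induction n) (auto simp: signed_interval_def algebra_simps)

text \<open>The sum factorises over the coordinates, and each factor telescopes. The translation vectors appear
  in the form that three nested Birkhoff sums produce.\<close>

lemma corner_box_tiling:
  assumes "0 < n"
  shows "(\<Sum>i<n. \<Sum>j<n. \<Sum>k<n. corner_box c (x - (real k *\<^sub>R axis 3 (c $ 3) + (real j *\<^sub>R axis 2 (c $ 2) + real i *\<^sub>R axis 1 (c $ 1)))))
     = corner_box c (x /\<^sub>R real n)"
proof -
  let ?s = "\<lambda>l i. signed_interval (c $ l) (x $ l - real i * c $ l)"
  have "(\<Sum>i<n. \<Sum>j<n. \<Sum>k<n. corner_box c (x - (real k *\<^sub>R axis 3 (c $ 3) + (real j *\<^sub>R axis 2 (c $ 2) + real i *\<^sub>R axis 1 (c $ 1)))))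
      = (\<Sum>i<n. \<Sum>j<n. \<Sum>k<n. ?s 1 i * ?s 2 j * ?s 3 k)"
    by (simp add: corner_box_def axis_def)
  also have "\<dots> = (\<Sum>i<n. ?s 1 i) * (\<Sum>j<n. ?s 2 j) * (\<Sum>k<n. ?s 3 k)"
    by (simp only: sum_distrib_left[symmetric] sum_distrib_right[symmetric])
  also have "\<dots> = signed_interval (real n * c $ 1) (x $ 1) * signed_interval (real n * c $ 2) (x $ 2)
      * signed_interval (real n * c $ 3) (x $ 3)"
    by (simp add: signed_interval_telescope)
  also have "\<dots> = corner_box c (x /\<^sub>R real n)"
  proof -
    have "signed_interval (real n * a) t = signed_interval a (inverse (real n) * t)" for a t
      using assms by (auto simp: signed_interval_def heaviside_def field_simps)
    then show ?thesis by (simp add: corner_box_def)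
  qed
  finally show ?thesis .
qed

text \<open>For bounded u, this for all integrable k is weak-star convergence of the rescaled functions
  \<open>x \<mapsto> u(x/\<epsilon>)\<close> to the constant \<open>\<mu>\<close>.\<close>

definition has_mean_against :: "(real^3 \<Rightarrow> real) \<Rightarrow> real \<Rightarrow> (real^3 \<Rightarrow> real) \<Rightarrow> bool" where
  "has_mean_against u \<mu> k \<longleftrightarrow>
     ((\<lambda>\<epsilon>. \<integral>x. k x * u (x /\<^sub>R \<epsilon>) \<partial>lborel) \<longlongrightarrow> \<mu> * (\<integral>x. k x \<partial>lborel)) (at_right 0)"

text \<open>Convergence along the scales 1/n suffices: for small \<open>\<epsilon>\<close> let n be the integer part of \<open>1/\<epsilon>\<close>.
  Substituting \<open>n \<epsilon> y\<close> for x replaces the scale \<open>\<epsilon>\<close> by 1/n at the price of dilating the box by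
  \<open>n \<epsilon>\<close>, a factor close to 1.\<close>

lemma has_mean_against_corner_box:
  assumes u [measurable]: "u \<in> borel_measurable borel" "\<And>x. \<bar>u x\<bar> \<le> C"
    and lim: "(\<lambda>n. \<integral>x. corner_box c x * u (real n *\<^sub>R x) \<partial>lborel) \<longlonglongrightarrow> \<mu> * (\<integral>x. corner_box c x \<partial>lborel)"
  shows "has_mean_against u \<mu> (corner_box c)"
  unfolding has_mean_against_def
proof (rule tendsto_at_right_sequentially[of 0 1])
  fix e :: "nat \<Rightarrow> real" assume e: "\<And>n. 0 < e n" "\<And>n. e n < 1" "e \<longlonglongrightarrow> 0"
  define n where "n k = nat \<lfloor>1 / e k\<rfloor>" for k
  define r where "r k = real (n k) * e k" for k
  have n1: "real (n k) \<le> 1 / e k" "1 / e k < real (n k) + 1" "1 \<le> n k" for k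
  proof -
    have "1 \<le> 1 / e k" using e(1)[of k] e(2)[of k] by simp
    then have f: "1 \<le> \<lfloor>1 / e k\<rfloor>" by simp
    then show "1 \<le> n k" unfolding n_def by linarith
    have "real (n k) = of_int \<lfloor>1 / e k\<rfloor>" using f unfolding n_def by (intro of_nat_nat) linarith
    then show "real (n k) \<le> 1 / e k" "1 / e k < real (n k) + 1" by linarith+
  qed
  have r: "0 < r k" "\<bar>r k - 1\<bar> \<le> e k" for k
  proof -
    show "0 < r k" using n1(3)[of k] e(1)[of k] by (simp add: r_def)
    have "r k \<le> 1" "1 < r k + e k"
      using n1(1,2)[of k] e(1)[of k] by (simp_all add: r_def field_simps)
    then show "\<bar>r k - 1\<bar> \<le> e k" by simp
  qed
  have "(\<lambda>k. r k - 1) \<longlonglongrightarrow> 0"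
    by (rule Lim_null_comparison[OF _ e(3)]) (use r in auto)
  then have rlim: "r \<longlonglongrightarrow> 1" by (simp add: LIM_zero_iff)
  have nlim: "filterlim n at_top sequentially"
    unfolding filterlim_at_top
  proof
    fix Z :: nat
    have "eventually (\<lambda>k. dist (e k) 0 < 1 / (real Z + 1)) sequentially"
      by (rule tendstoD[OF e(3)]) simp
    then show "eventually (\<lambda>k. Z \<le> n k) sequentially"
    proof eventually_elim
      fix k assume "dist (e k) 0 < 1 / (real Z + 1)"
      then have "real Z + 1 < 1 / e k" using e(1)[of k] by (simp add: field_simps)
      then have "real Z < real (n k)" using n1(2)[of k] by linarith
      then show "Z \<le> n k" by simp
    qed
  qed
  let ?I = "\<lambda>k. \<integral>x. corner_box c x * u (real (n k) *\<^sub>R x) \<partial>lborel"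
  have I: "?I \<longlonglongrightarrow> \<mu> * (\<integral>x. corner_box c x \<partial>lborel)"
    by (rule filterlim_compose[OF lim nlim])
  have eq: "(\<integral>x. corner_box c x * u (x /\<^sub>R e k) \<partial>lborel)
      = (\<integral>x. (r k ^ 3 * corner_box c (r k *\<^sub>R x)) * u (real (n k) *\<^sub>R x) \<partial>lborel)" for k
  proof -
    have "(r k *\<^sub>R x) /\<^sub>R e k = real (n k) *\<^sub>R x" for x :: "real^3"
      using e(1)[of k] by (simp add: r_def field_simps)
    then show ?thesis
      by (subst integral_lborel_scale[OF _ r(1)[of k]]) (simp_all only: mult.assoc integral_mult_right_zero, measurable)
  qed
  have ib: "integrable lborel (\<lambda>x. r k ^ 3 * corner_box c (r k *\<^sub>R x))" for k
  proof (rule integrable_bounded_support[where B="r k ^ 3" and R="norm c / r k"])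
    show "\<bar>r k ^ 3 * corner_box c (r k *\<^sub>R x)\<bar> \<le> r k ^ 3" for x
      using r(1)[of k] corner_box_le_1[of c "r k *\<^sub>R x"] by (simp add: abs_mult)
    fix x assume "r k ^ 3 * corner_box c (r k *\<^sub>R x) \<noteq> 0"
    then have "norm (r k *\<^sub>R x) \<le> norm c" by (intro corner_box_support) auto
    then show "norm x \<le> norm c / r k" using r(1)[of k] by (simp add: field_simps)
  qed auto
  have d: "\<bar>(\<integral>x. corner_box c x * u (x /\<^sub>R e k) \<partial>lborel) - ?I k\<bar>
      \<le> C * (\<integral>x. \<bar>r k ^ 3 * corner_box c (r k *\<^sub>R x - 0) - corner_box c x\<bar> \<partial>lborel)" for k
    unfolding eq using integral_mult_bounded_diff[OF ib corner_box_integrable, of "\<lambda>x. u (real (n k) *\<^sub>R x)" C] u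
    by (simp only: diff_zero) simp
  have "(\<lambda>k. (\<integral>x. corner_box c x * u (x /\<^sub>R e k) \<partial>lborel) - ?I k) \<longlonglongrightarrow> 0"
    by (rule Lim_null_comparison[OF always_eventually
          tendsto_mult_right_zero[OF corner_box_affine_L1[OF rlim tendsto_const], of C c]])
       (unfold real_norm_def, rule allI, rule d)
  from tendsto_add[OF this I]
  show "(\<lambda>k. \<integral>x. corner_box c x * u (x /\<^sub>R e k) \<partial>lborel) \<longlonglongrightarrow> \<mu> * (\<integral>x. corner_box c x \<partial>lborel)"
    by simp
qed simp

context
  fixes u :: "real^3 \<Rightarrow> real" and C \<mu> :: real
  assumes u [measurable]: "u \<in> borel_measurable borel" and ub: "\<And>x. \<bar>u x\<bar> \<le> C"
begin

lemma has_mean_against_add: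
  assumes "integrable lborel k" "has_mean_against u \<mu> k" "integrable lborel k'" "has_mean_against u \<mu> k'"
  shows "has_mean_against u \<mu> (\<lambda>x. k x + k' x)"
proof -
  have "(\<integral>x. (k x + k' x) * u (x /\<^sub>R \<epsilon>) \<partial>lborel)
      = (\<integral>x. k x * u (x /\<^sub>R \<epsilon>) \<partial>lborel) + (\<integral>x. k' x * u (x /\<^sub>R \<epsilon>) \<partial>lborel)" for \<epsilon>
    using integrable_mult_bounded[of k "\<lambda>x. u (x /\<^sub>R \<epsilon>)" C]
      integrable_mult_bounded[of k' "\<lambda>x. u (x /\<^sub>R \<epsilon>)" C] assms ub
    by (simp add: distrib_right)
  then show ?thesis
    using tendsto_add[OF assms(2,4)[unfolded has_mean_against_def]] assms
    by (simp add: has_mean_against_def distrib_left)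
qed

lemma has_mean_against_cmult:
  assumes "has_mean_against u \<mu> k"
  shows "has_mean_against u \<mu> (\<lambda>x. a * k x)"
  using tendsto_mult_left[OF assms[unfolded has_mean_against_def], of a]
  by (simp add: has_mean_against_def mult.assoc mult.left_commute)

lemma has_mean_against_diff:
  assumes "integrable lborel k" "has_mean_against u \<mu> k" "integrable lborel k'" "has_mean_against u \<mu> k'"
  shows "has_mean_against u \<mu> (\<lambda>x. k x - k' x)"
  using has_mean_against_add[OF assms(1,2) _ has_mean_against_cmult[OF assms(4), of "-1"]] assms(3)
  by simp

text \<open>The functionals in question are bounded on \<open>L\<^sup>1\<close> uniformly in \<open>\<epsilon>\<close>, because u is bounded.\<close>

lemma has_mean_against_L1_limit:
  assumes s: "\<And>n. integrable lborel (s n)" "\<And>n. has_mean_against u \<mu> (s n)"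
    and k: "integrable lborel k" and lim: "(\<lambda>n. \<integral>x. \<bar>s n x - k x\<bar> \<partial>lborel) \<longlonglongrightarrow> 0"
  shows "has_mean_against u \<mu> k"
  unfolding has_mean_against_def
proof (rule tendstoI)
  fix e :: real assume e: "0 < e"
  define B where "B = \<bar>C\<bar> + \<bar>\<mu>\<bar> + 1"
  have B: "0 < B" "C \<le> B" "\<bar>\<mu>\<bar> \<le> B" by (auto simp: B_def)
  have "eventually (\<lambda>n. dist (\<integral>x. \<bar>s n x - k x\<bar> \<partial>lborel) 0 < e / (3 * B)) sequentially"
    using B e by (intro tendstoD[OF lim]) simp
  then obtain n where n: "dist (\<integral>x. \<bar>s n x - k x\<bar> \<partial>lborel) 0 < e / (3 * B)"
    using eventually_happens by force
  define J where "J = (\<integral>x. \<bar>s n x - k x\<bar> \<partial>lborel)"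
  have J: "0 \<le> J" "B * J < e / 3" using n B by (auto simp: J_def field_simps)
  have CJ: "C * J \<le> B * J" "\<bar>\<mu>\<bar> * J \<le> B * J" using B J by (auto intro: mult_right_mono)
  have "eventually (\<lambda>\<epsilon>. dist (\<integral>x. s n x * u (x /\<^sub>R \<epsilon>) \<partial>lborel) (\<mu> * (\<integral>x. s n x \<partial>lborel)) < e / 3) (at_right 0)"
    using s(2)[of n] e unfolding has_mean_against_def by (intro tendstoD) auto
  then show "eventually (\<lambda>\<epsilon>. dist (\<integral>x. k x * u (x /\<^sub>R \<epsilon>) \<partial>lborel) (\<mu> * (\<integral>x. k x \<partial>lborel)) < e) (at_right 0)"
  proof eventually_elim
    case (elim \<epsilon>)
    have "\<bar>(\<integral>x. s n x * u (x /\<^sub>R \<epsilon>) \<partial>lborel) - (\<integral>x. k x * u (x /\<^sub>R \<epsilon>) \<partial>lborel)\<bar> \<le> C * J"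
      unfolding J_def using ub by (intro integral_mult_bounded_diff s k) auto
    moreover have "\<bar>\<mu> * (\<integral>x. s n x \<partial>lborel) - \<mu> * (\<integral>x. k x \<partial>lborel)\<bar> \<le> \<bar>\<mu>\<bar> * J"
    proof -
      have "\<mu> * (\<integral>x. s n x \<partial>lborel) - \<mu> * (\<integral>x. k x \<partial>lborel) = \<mu> * (\<integral>x. s n x - k x \<partial>lborel)"
        using s(1)[of n] k by (simp add: right_diff_distrib)
      also have "\<bar>\<dots>\<bar> \<le> \<bar>\<mu>\<bar> * J"
        unfolding abs_mult J_def by (intro mult_left_mono integral_abs_bound) auto
      finally show ?thesis .
    qed
    ultimately show ?case using elim J CJ unfolding dist_real_def by linarith
  qed
qed

lemma has_mean_against_cong_AE:
  assumes "has_mean_against u \<mu> k" "AE x in lborel. k x = k' x"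
    "k \<in> borel_measurable borel" "k' \<in> borel_measurable borel"
  shows "has_mean_against u \<mu> k'"
proof -
  have "(\<integral>x. k x * u (x /\<^sub>R \<epsilon>) \<partial>lborel) = (\<integral>x. k' x * u (x /\<^sub>R \<epsilon>) \<partial>lborel)" for \<epsilon>
    using assms by (intro integral_cong_AE) (auto elim: eventually_mono)
  moreover have "(\<integral>x. k x \<partial>lborel) = (\<integral>x. k' x \<partial>lborel)"
    using assms by (intro integral_cong_AE) auto
  ultimately show ?thesis using assms(1) by (simp add: has_mean_against_def)
qed

text \<open>The admissible weights form a linear space that is closed in \<open>L\<^sup>1\<close>. It contains the indicators of
  rational boxes, which are signed sums of eight corner boxes up to null sets, hence by Dynkin's
  theorem those of bounded Borel sets, and so everything integrable.\<close>

lemma has_mean_against_integrable: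
  assumes corner: "\<And>c. (\<And>i. c $ i \<in> \<rat>) \<Longrightarrow> has_mean_against u \<mu> (corner_box c)"
    and k: "integrable lborel k"
  shows "has_mean_against u \<mu> k"
proof -
  let ?R = "\<lambda>a::real^3. \<forall>i. a $ i \<in> \<rat>"
  have mean_zero: "has_mean_against u \<mu> (\<lambda>x. 0)" by (simp add: has_mean_against_def)
  have box: "has_mean_against u \<mu> (indicator (box a b))" if ab: "?R a" "?R b" for a b :: "real^3"
  proof (cases "\<forall>i. a $ i \<le> b $ i")
    case True
    let ?v = "\<lambda>p q r. vector [p, q, r] :: real^3"
    have R: "?R (?v p q r)" if "p \<in> \<rat>" "q \<in> \<rat>" "r \<in> \<rat>" for p q r
      using that by (simp add: forall_3)
    let ?K = "\<lambda>p q r. corner_box (?v p q r)"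
    have mK: "has_mean_against u \<mu> (?K p q r)" if "p \<in> \<rat>" "q \<in> \<rat>" "r \<in> \<rat>" for p q r
      using R[OF that] by (intro corner) auto
    \<comment> \<open>The product over the three coordinates of the interval weight for b minus the one for a, multiplied
    out; each factor is the indicator of the interval from a to b, up to its end points.\<close>
    let ?S = "\<lambda>x. (((?K (b$1) (b$2) (b$3) x - ?K (b$1) (b$2) (a$3) x)
        - (?K (b$1) (a$2) (b$3) x - ?K (b$1) (a$2) (a$3) x))
        - ((?K (a$1) (b$2) (b$3) x - ?K (a$1) (b$2) (a$3) x)
        - (?K (a$1) (a$2) (b$3) x - ?K (a$1) (a$2) (a$3) x)))"
    define good where "good k \<longleftrightarrow> integrable lborel k \<and> has_mean_against u \<mu> k" for k
    have good_K: "good (?K p q r)" if "p \<in> \<rat>" "q \<in> \<rat>" "r \<in> \<rat>" for p q r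
      using mK[OF that] corner_box_integrable by (simp add: good_def)
    have good_diff: "good (\<lambda>x. k x - k' x)" if "good k" "good k'" for k k'
      using that by (auto simp: good_def intro: has_mean_against_diff)
    have "good ?S"
      by (rule good_diff good_K ab(1)[rule_format] ab(2)[rule_format])+
    then have "has_mean_against u \<mu> ?S" by (simp add: good_def)
    moreover have "AE x in lborel. ?S x = indicator (box a b) x"
    proof -
      have "AE x in lborel. \<forall>i. (x :: real^3) $ i \<noteq> a $ i \<and> x $ i \<noteq> b $ i"
        by (subst AE_all_countable) (auto intro: AE_component_neq)
      then show ?thesis
      proof eventually_elim
        fix x assume x: "\<forall>i. x $ i \<noteq> a $ i \<and> x $ i \<noteq> b $ i"
        have d: "signed_interval (b $ i) (x $ i) - signed_interval (a $ i) (x $ i)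
            = (if a $ i < x $ i \<and> x $ i < b $ i then 1 else 0)" for i
          using True[rule_format, of i] x[rule_format, of i]
          by (auto simp: signed_interval_def heaviside_def)
        have "?S x = (signed_interval (b $ 1) (x $ 1) - signed_interval (a $ 1) (x $ 1))
            * (signed_interval (b $ 2) (x $ 2) - signed_interval (a $ 2) (x $ 2))
            * (signed_interval (b $ 3) (x $ 3) - signed_interval (a $ 3) (x $ 3))"
          by (simp add: corner_box_def algebra_simps)
        also have "\<dots> = indicator (box a b) x"
          unfolding d by (auto simp: mem_box_cart forall_3 indicator_def)
        finally show "?S x = indicator (box a b) x" .
      qed
    qed
    ultimately show ?thesis by (rule has_mean_against_cong_AE) auto
  next
    case False
    then have "box a b = {}" unfolding interval_eq_empty_cart by (auto intro: less_imp_le simp: not_le)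
    moreover have "indicator {} = (\<lambda>x::real^3. 0::real)" by auto
    ultimately show ?thesis using mean_zero by simp
  qed
  define G where "G = {box a b | a b :: real^3. ?R a \<and> ?R b}"
  have Int: "Int_stable G"
  proof (rule Int_stableI)
    fix A B assume "A \<in> G" "B \<in> G"
    then obtain a b c d where "A = box a b" "B = box c d" "?R a" "?R b" "?R c" "?R d"
      unfolding G_def by blast
    moreover have "box a b \<inter> box c d = box (\<chi> i. max (a $ i) (c $ i)) (\<chi> i. min (b $ i) (d $ i))"
      by (auto simp: mem_box_cart)
    moreover have "?R (\<chi> i. max (a $ i) (c $ i))" "?R (\<chi> i. min (b $ i) (d $ i))"
      using calculation by (auto simp: max_def min_def)
    ultimately show "A \<inter> B \<in> G" unfolding G_def by blast
  qed
  have sig: "sets (borel :: (real^3) measure) = sigma_sets UNIV G"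
  proof -
    have "M \<in> sigma_sets UNIV G" if "open M" for M
    proof -
      let ?a = "\<lambda>f :: real^3 \<Rightarrow> real \<times> real. (\<Sum>(i::real^3)\<in>Basis. fst (f i) *\<^sub>R i)"
      let ?b = "\<lambda>f :: real^3 \<Rightarrow> real \<times> real. (\<Sum>(i::real^3)\<in>Basis. snd (f i) *\<^sub>R i)"
      have in_G: "box (?a f) (?b f) \<in> G" if "f \<in> Basis \<rightarrow>\<^sub>E \<rat> \<times> \<rat>" for f
      proof -
        have "?a f $ i \<in> \<rat>" "?b f $ i \<in> \<rat>" for i
        proof -
          have "axis i 1 \<in> (Basis :: (real^3) set)" by (auto simp: Basis_vec_def)
          moreover have "?a f $ i = fst (f (axis i 1))" "?b f $ i = snd (f (axis i 1))"
            using \<open>axis i 1 \<in> Basis\<close> by (simp_all add: cart_eq_inner_axis)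
          ultimately show "?a f $ i \<in> \<rat>" "?b f $ i \<in> \<rat>"
            using that by (auto simp: PiE_iff mem_Times_iff)
        qed
        then show ?thesis unfolding G_def by blast
      qed
      show "M \<in> sigma_sets UNIV G"
        by (subst open_UNION_box[OF \<open>open M\<close>])
          (rule sigma_sets_UNION, auto intro!: countable_PiE countable_Collect countable_image
             sigma_sets.Basic in_G intro: countable_rat)
    qed
    then have "sigma_sets UNIV {S. open S} \<subseteq> sigma_sets UNIV G"
      by (intro sigma_sets_mono) auto
    moreover have "sigma_sets UNIV G \<subseteq> sets borel"
    proof -
      have "G \<subseteq> sets borel" by (auto simp: G_def)
      then show ?thesis using sets.sigma_sets_subset[of G borel] by simp
    qed
    ultimately show ?thesis by (simp add: borel_def)
  qed
  \<comment> \<open>Dynkin systems are closed under complements, but the complement of a bounded set is not integrable.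
  The induction therefore runs over sets cut off at the cubes Q N.\<close>
  define Q :: "nat \<Rightarrow> (real^3) set" where "Q N = box (\<chi> i. - real N) (\<chi> i. real N)" for N
  have QG: "Q N \<in> G" for N
    unfolding G_def Q_def by (intro CollectI exI conjI refl) auto
  have Qfin: "integrable lborel (indicator (A \<inter> Q N) :: real^3 \<Rightarrow> real)" if "A \<in> sets borel" for A N
  proof (rule integrable_real_indicator)
    have "emeasure lborel (A \<inter> Q N) \<le> emeasure lborel (Q N)"
      by (rule emeasure_mono) (auto simp: Q_def)
    also have "\<dots> < \<infinity>" unfolding Q_def by (rule emeasure_bounded_finite) simp
    finally show "emeasure lborel (A \<inter> Q N) < \<infinity>" .
    show "A \<inter> Q N \<in> sets lborel" using that by (simp add: Q_def)
  qed
  have Qfin1: "integrable lborel (indicator (Q N) :: real^3 \<Rightarrow> real)" for N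
    using Qfin[of UNIV N] by simp
  have local: "\<forall>N. has_mean_against u \<mu> (indicator (A \<inter> Q N))" if "A \<in> sigma_sets UNIV G" for A
  proof -
    have "G \<subseteq> Pow UNIV" by simp
    with Int show ?thesis
      using that
      proof (induction rule: sigma_sets_induct_disjoint)
        case (basic A)
        have "has_mean_against u \<mu> (indicator (A \<inter> Q N))" for N
        proof -
          have "A \<inter> Q N \<in> G" by (rule Int_stableD[OF Int basic QG])
          then obtain a b where "A \<inter> Q N = box a b" "?R a" "?R b" unfolding G_def by blast
          then show ?thesis using box by simp
        qed
        then show ?case by blast
      next
        case empty
        have "indicator {} = (\<lambda>x::real^3. 0::real)" by auto
        then show ?case using mean_zero by simp
      next
        case (compl A)
        have A: "A \<in> sets borel" using compl sig by simp
        have mQ: "has_mean_against u \<mu> (indicator (Q N))" for N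
          unfolding Q_def by (rule box) auto
        have "has_mean_against u \<mu> (\<lambda>x. indicator (Q N) x - indicator (A \<inter> Q N) x)" for N
          by (rule has_mean_against_diff[OF Qfin1 mQ Qfin[OF A] compl(2)[rule_format]])
        moreover have "(\<lambda>x. indicator (Q N) x - indicator (A \<inter> Q N) x) = (indicator ((UNIV - A) \<inter> Q N) :: _ \<Rightarrow> real)" for N
          by (auto simp: indicator_def)
        ultimately show ?case by simp
      next
        case (union A)
        have A: "A i \<in> sets borel" for i using union sig by auto
        then have UA: "(\<Union>i<n. A i) \<in> sets borel" "(\<Union>i. A i) \<in> sets borel" for n :: nat by auto
        show ?case
        proof
          fix N
          have fin: "has_mean_against u \<mu> (indicator ((\<Union>i<n. A i) \<inter> Q N))" for n :: nat
          proof (induction n)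
            case 0
            have "indicator {} = (\<lambda>x::real^3. 0::real)" by auto
            then show ?case using mean_zero by simp
          next
            case (Suc n)
            have "x \<notin> A n" if "x \<in> A i" "i < n" for x i
              using disjoint_family_onD[OF union(1), of i n] that by auto
            then have "indicator ((\<Union>i<Suc n. A i) \<inter> Q N) =
              (\<lambda>x. indicator ((\<Union>i<n. A i) \<inter> Q N) x + indicator (A n \<inter> Q N) x :: real)"
              by (intro ext) (auto simp: indicator_def less_Suc_eq)
            moreover have "has_mean_against u \<mu> (\<lambda>x. indicator ((\<Union>i<n. A i) \<inter> Q N) x + indicator (A n \<inter> Q N) x)"
              using Suc union(3) by (intro has_mean_against_add Qfin UA A) auto
            ultimately show ?case by simp
          qed
          show "has_mean_against u \<mu> (indicator ((\<Union>i. A i) \<inter> Q N))"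
          proof (rule has_mean_against_L1_limit[OF Qfin[OF UA(1)] fin Qfin[OF UA(2)]])
            have "(\<lambda>n. \<integral>x. \<bar>indicator ((\<Union>i<n. A i) \<inter> Q N) x - indicator ((\<Union>i. A i) \<inter> Q N) x\<bar> \<partial>lborel)
              \<longlonglongrightarrow> (\<integral>x. 0 \<partial>(lborel :: (real^3) measure) :: real)"
            proof (rule integral_dominated_convergence[where w="indicator (Q N)"])
              show "AE x in lborel. (\<lambda>n. \<bar>indicator ((\<Union>i<n. A i) \<inter> Q N) x - indicator ((\<Union>i. A i) \<inter> Q N) x\<bar>) \<longlonglongrightarrow> (0::real)"
              proof (rule AE_I2)
                fix x
                show "(\<lambda>n. \<bar>indicator ((\<Union>i<n. A i) \<inter> Q N) x - indicator ((\<Union>i. A i) \<inter> Q N) x\<bar>) \<longlonglongrightarrow> (0::real)"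
                proof (cases "\<exists>i. x \<in> A i")
                  case True
                  then obtain i where "x \<in> A i" ..
                  then have "eventually (\<lambda>n. \<bar>indicator ((\<Union>i<n. A i) \<inter> Q N) x - indicator ((\<Union>i. A i) \<inter> Q N) x\<bar> = (0::real)) sequentially"
                    unfolding eventually_sequentially by (intro exI[of _ "Suc i"]) (auto simp: indicator_def)
                  then show ?thesis by (rule tendsto_eventually)
                qed (auto simp: indicator_def)
              qed
              show "(\<lambda>x. \<bar>indicator ((\<Union>i<n. A i) \<inter> Q N) x - indicator ((\<Union>i. A i) \<inter> Q N) x\<bar> :: real) \<in> borel_measurable lborel" for n
                using Qfin[OF UA(1), of n N] Qfin[OF UA(2), of N] by simp
              show "AE x in lborel. norm \<bar>indicator ((\<Union>i<n. A i) \<inter> Q N) x - indicator ((\<Union>i. A i) \<inter> Q N) x :: real\<bar> \<le> indicator (Q N) x" for n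
                by (intro AE_I2) (auto simp: indicator_def)
            qed (auto simp: Qfin1)
            then show "(\<lambda>n. \<integral>x. \<bar>indicator ((\<Union>i<n. A i) \<inter> Q N) x - indicator ((\<Union>i. A i) \<inter> Q N) x\<bar> \<partial>lborel) \<longlonglongrightarrow> (0::real)"
              by simp
          qed
        qed
      qed
  qed
  show ?thesis
    using k
  proof (induction rule: integrable_induct)
    case (base A c)
    then have A: "A \<in> sets borel" and Aint: "integrable lborel (indicator A :: real^3 \<Rightarrow> real)" by auto
    have "has_mean_against u \<mu> (indicator A)"
    proof (rule has_mean_against_L1_limit[OF Qfin[OF A] _ Aint])
      show "has_mean_against u \<mu> (indicator (A \<inter> Q N))" for N using local A sig by simp
      have "(\<lambda>n. \<integral>x. \<bar>indicator (A \<inter> Q n) x - indicator A x\<bar> \<partial>lborel)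
          \<longlonglongrightarrow> (\<integral>x. 0 \<partial>(lborel :: (real^3) measure) :: real)"
      proof (rule integral_dominated_convergence[where w="indicator A"])
        show "AE x in lborel. (\<lambda>n. \<bar>indicator (A \<inter> Q n) x - indicator A x\<bar>) \<longlonglongrightarrow> (0::real)"
        proof (rule AE_I2)
          fix x :: "real^3"
          obtain m :: nat where m: "norm x < real m" using reals_Archimedean2 by blast
          have "x \<in> Q n" if "m \<le> n" for n
          proof -
            have "\<bar>x $ i\<bar> < real n" for i
              using component_le_norm_cart[of x i] m that by linarith
            then show ?thesis unfolding Q_def by (auto simp: mem_box_cart abs_less_iff minus_less_iff)
          qed
          then have "eventually (\<lambda>n. \<bar>indicator (A \<inter> Q n) x - indicator A x\<bar> = (0::real)) sequentially"
            unfolding eventually_sequentially by (intro exI[of _ m]) (auto simp: indicator_def)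
          then show "(\<lambda>n. \<bar>indicator (A \<inter> Q n) x - indicator A x\<bar>) \<longlonglongrightarrow> (0::real)"
            by (rule tendsto_eventually)
        qed
        show "(\<lambda>x. \<bar>indicator (A \<inter> Q n) x - indicator A x\<bar> :: real) \<in> borel_measurable lborel" for n
          using Qfin[OF A, of n] Aint by simp
        show "AE x in lborel. norm \<bar>indicator (A \<inter> Q n) x - indicator A x :: real\<bar> \<le> indicator A x" for n
          by (intro AE_I2) (auto simp: indicator_def)
      qed (use Aint in auto)
      then show "(\<lambda>n. \<integral>x. \<bar>indicator (A \<inter> Q n) x - indicator A x\<bar> \<partial>lborel) \<longlonglongrightarrow> (0::real)"
        by simp
    qed
    from has_mean_against_cmult[OF this, of c] show ?case by (simp add: mult.commute)
  next
    case (add f g)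
    then show ?case by (intro has_mean_against_add)
  next
    case (lim f s)
    show ?case
    proof (rule has_mean_against_L1_limit[OF lim.hyps(1) lim.IH lim.hyps(4)])
      have "(\<lambda>n. \<integral>x. \<bar>s n x - f x\<bar> \<partial>lborel) \<longlonglongrightarrow> (\<integral>x. 0 \<partial>(lborel :: (real^3) measure) :: real)"
      proof (rule integral_dominated_convergence[where w="\<lambda>x. 3 * \<bar>f x\<bar>"])
        show "AE x in lborel. (\<lambda>n. \<bar>s n x - f x\<bar>) \<longlonglongrightarrow> 0"
        proof (rule AE_I2)
          fix x
          have "(\<lambda>n. \<bar>s n x - f x\<bar>) \<longlonglongrightarrow> \<bar>f x - f x\<bar>" by (intro tendsto_intros lim.hyps(2)) simp
          then show "(\<lambda>n. \<bar>s n x - f x\<bar>) \<longlonglongrightarrow> 0" by simp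
        qed
        show "AE x in lborel. norm \<bar>s n x - f x\<bar> \<le> 3 * \<bar>f x\<bar>" for n
        proof (rule AE_I2)
          fix x
          have "\<bar>s n x\<bar> \<le> 2 * \<bar>f x\<bar>" using lim.hyps(3)[of x n] by simp
          then show "norm \<bar>s n x - f x\<bar> \<le> 3 * \<bar>f x\<bar>" by simp
        qed
        show "(\<lambda>x. \<bar>s n x - f x\<bar>) \<in> borel_measurable lborel" for n
          using lim.hyps(1)[of n] lim.hyps(4) by simp
      qed (use lim.hyps(4) in auto)
      then show "(\<lambda>n. \<integral>x. \<bar>s n x - f x\<bar> \<partial>lborel) \<longlonglongrightarrow> 0" by simp
    qed
  qed
qed

end

section \<open>The ergodic theorem along orbits\<close>

text \<open>In a complete space a function is measurable as soon as it agrees almost everywhere with a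
  measurable one. The maps \<open>x \<mapsto> f(T(x/\<epsilon>) \<omega>)\<close> are only accessible in this way.\<close>

lemma (in complete_measure) borel_measurable_AE_cong:
  fixes f g :: "'a \<Rightarrow> 'b::topological_space"
  assumes g: "g \<in> borel_measurable M" and eq: "AE x in M. f x = g x"
  shows "f \<in> borel_measurable M"
proof (rule measurableI)
  fix A :: "'b set" assume A: "A \<in> sets borel"
  show "f -` A \<inter> space M \<in> sets M"
  proof (rule in_sets_AE)
    show "g -` A \<inter> space M \<in> sets M" using g A by (rule measurable_sets)
    show "AE x in M. x \<in> g -` A \<inter> space M \<longleftrightarrow> x \<in> f -` A \<inter> space M"
      using eq by eventually_elim auto
  qed auto
qed simp

lemma AE_lborel_scale:
  fixes pr :: "real^3 \<Rightarrow> bool"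
  assumes "AE x in lborel. pr x" "c \<noteq> 0"
  shows "AE x in lborel. pr (c *\<^sub>R x)"
proof -
  have "AE x in density (distr lborel borel (\<lambda>x::real^3. 0 + c *\<^sub>R x)) (\<lambda>_. \<bar>c\<bar>^DIM(real^3)). pr x"
    by (subst lborel_affine[OF assms(2), of "0::real^3", symmetric]) (rule assms(1))
  then have "AE x in distr lborel borel (\<lambda>x::real^3. 0 + c *\<^sub>R x). pr x"
    using assms(2) by (subst (asm) AE_density) auto
  then have "AE x in lborel. pr (0 + c *\<^sub>R x)"
    by (intro AE_distrD[where f="\<lambda>x::real^3. 0 + c *\<^sub>R x"]) auto
  then show ?thesis by simp
qed

lemma AE_lborel_translate:
  fixes pr :: "real^3 \<Rightarrow> bool"
  assumes "AE x in lborel. pr x"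
  shows "AE x in lborel. pr (x + y)"
proof -
  have "AE x in distr lborel borel ((+) y). pr x" using assms by (subst lborel_distr_plus)
  then have "AE x in lborel. pr (y + x)" by (intro AE_distrD[where f="(+) y"]) auto
  then show ?thesis by (simp add: add.commute)
qed

context stochastic_setting
begin

lemma T_distr: "distr P P (T x) = P"
proof (rule measure_eqI)
  fix A assume "A \<in> sets (distr P P (T x))"
  then have A: "A \<in> sets P" by simp
  show "emeasure (distr P P (T x)) A = emeasure P A"
    using A T_preserves[OF A, of x]
    by (simp add: emeasure_distr[OF T_measurable A] emeasure_eq_measure space_Omega)
qed simp

lemma AE_translate:
  assumes "AE \<omega> in P. pr \<omega>"
  shows "AE \<omega> in P. pr (T y \<omega>)"
proof (rule AE_distrD[OF T_measurable])
  show "AE \<omega> in distr P P (T y). pr \<omega>" using assms by (subst T_distr)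
qed

text \<open>The joint map \<open>(x,\<omega>) \<mapsto> T x \<omega>\<close> is measurable for the completed product only, to which Fubini's theorem
  does not apply. The function g is a version of f along orbits that is measurable for the product
  itself, and almost every orbit sees no difference between the two.\<close>

lemma orbit_version:
  assumes f: "f \<in> borel_measurable P" and C: "\<And>\<omega>. \<bar>f \<omega>\<bar> \<le> C"
  obtains g :: "(real^3) \<times> 'w \<Rightarrow> real" where "g \<in> borel_measurable (lborel \<Otimes>\<^sub>M P)" "\<And>z. \<bar>g z\<bar> \<le> C"
    "AE x in lborel. AE \<omega> in P. g (x, \<omega>) = f (T x \<omega>)"
    "AE \<omega> in P. AE x in lborel. g (x, \<omega>) = f (T x \<omega>)"
proof -
  interpret LP: pair_sigma_finite "lborel :: (real^3) measure" P ..
  interpret PL: pair_sigma_finite P "lborel :: (real^3) measure" ..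
  have "(\<lambda>z. f (case z of (x, \<omega>) \<Rightarrow> T x \<omega>)) \<in> borel_measurable (completion (lborel \<Otimes>\<^sub>M P))"
    by (rule measurable_compose[OF T_joint_measurable f])
  from completion_ex_borel_measurable_real[OF this]
  obtain g' where g' [measurable]: "g' \<in> borel_measurable (lborel \<Otimes>\<^sub>M P)"
    and eq: "AE z in lborel \<Otimes>\<^sub>M P. f (case z of (x, \<omega>) \<Rightarrow> T x \<omega>) = g' z" by blast
  define g where "g z = max (- C) (min C (g' z))" for z
  have C0: "0 \<le> C" using C[of undefined] by simp
  have eq': "AE z in lborel \<Otimes>\<^sub>M P. g z = f (T (fst z) (snd z))"
    using eq
  proof eventually_elim
    case (elim z)
    then show ?case using C[of "T (fst z) (snd z)"] by (auto simp: g_def split: prod.splits)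
  qed
  then have "AE z in distr (P \<Otimes>\<^sub>M lborel) (lborel \<Otimes>\<^sub>M P) (\<lambda>(x, y). (y, x)). g z = f (T (fst z) (snd z))"
    by (subst LP.distr_pair_swap[symmetric])
  then have "AE z in P \<Otimes>\<^sub>M lborel. g (case z of (x, y) \<Rightarrow> (y, x)) = f (T (snd z) (fst z))"
    by (drule_tac AE_distrD[rotated]) (auto simp: case_prod_beta)
  note swapped = this
  have "g \<in> borel_measurable (lborel \<Otimes>\<^sub>M P)" unfolding g_def by measurable
  moreover have "\<bar>g z\<bar> \<le> C" for z using C0 by (auto simp: g_def max_def min_def abs_if)
  ultimately show thesis
    by (rule that) (use PL.AE_pair[OF swapped] LP.AE_pair[OF eq'] in simp_all)
qed

text \<open>By invariance, each fixed x has \<open>pr(T x \<omega>)\<close> for almost every \<open>\<omega>\<close>; Fubini's theorem exchanges the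
  two quantifiers.\<close>

lemma AE_orbit:
  assumes "AE \<omega> in P. pr \<omega>"
  shows "AE \<omega> in P. AE x in lborel. pr (T x \<omega>)"
proof -
  interpret LP: pair_sigma_finite "lborel :: (real^3) measure" P ..
  let ?N = "{\<omega>. \<not> pr \<omega>}"
  have N: "?N \<in> null_sets P" using assms unfolding AE_iff_null_sets by (simp add: space_Omega)
  then have m: "(indicator ?N :: 'w \<Rightarrow> real) \<in> borel_measurable P" by auto
  have i1: "\<bar>indicator ?N \<omega> :: real\<bar> \<le> 1" for \<omega> by (simp add: indicator_def)
  obtain g :: "(real^3) \<times> 'w \<Rightarrow> real" where g [measurable]: "g \<in> borel_measurable (lborel \<Otimes>\<^sub>M P)"
    and g1: "AE x in lborel. AE \<omega> in P. g (x, \<omega>) = indicator ?N (T x \<omega>)"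
    and g2: "AE \<omega> in P. AE x in lborel. g (x, \<omega>) = indicator ?N (T x \<omega>)"
    by (rule orbit_version[OF m i1]) (rule that)
  have "AE x in lborel. AE \<omega> in P. g (x, \<omega>) = 0"
    using g1
  proof eventually_elim
    case (elim x)
    with AE_translate[OF assms, of x] show ?case by eventually_elim auto
  qed
  then have "AE \<omega> in P. AE x in lborel. g (x, \<omega>) = 0"
    by (subst (asm) LP.AE_commute) measurable
  with g2 show ?thesis
  proof eventually_elim
    case (elim \<omega>)
    then show ?case by eventually_elim (auto simp: indicator_def split: if_splits)
  qed
qed

lemma AE_orbit_scaled:
  assumes "AE \<omega> in P. pr \<omega>"
  shows "AE \<omega> in P. \<forall>\<epsilon>>0. AE x in lborel. pr (T (x /\<^sub>R \<epsilon>) \<omega>)"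
  using AE_orbit[OF assms]
proof eventually_elim
  case (elim \<omega>)
  from AE_lborel_scale[OF elim] show ?case by auto
qed

text \<open>The sets where G exceeds its mean and where it falls below it are invariant, so each has measure 0
  or 1. Measure 1 is impossible: a function cannot lie strictly on one side of its own mean.\<close>

lemma invariant_AE_const:
  assumes G: "bdd_meas P C G" and inv: "\<And>y. AE \<omega> in P. G (T y \<omega>) = G \<omega>"
  shows "AE \<omega> in P. G \<omega> = expectation G"
proof -
  have [measurable]: "G \<in> borel_measurable P" using G by (simp add: bdd_meas_def)
  have iG: "integrable P G" by (rule bdd_meas_integrable[OF G])
  have zero_one: "prob {\<omega>. pr (G \<omega>)} = 0 \<or> prob {\<omega>. pr (G \<omega>)} = 1"
    if [measurable]: "Measurable.pred borel pr" for pr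
  proof (rule T_ergodic)
    have "{\<omega> \<in> space P. pr (G \<omega>)} \<in> sets P" by measurable
    then show s: "{\<omega>. pr (G \<omega>)} \<in> sets P" by (simp add: space_Omega)
    fix x
    have im: "T x ` {\<omega>. pr (G \<omega>)} = {\<omega>. pr (G (T (- x) \<omega>))}"
    proof -
      have i: "T (- x) (T x \<omega>) = \<omega>" "T x (T (- x) \<omega>) = \<omega>" for \<omega>
        using T_add[of "-x" x] T_add[of x "-x"] by (simp_all add: T_zero fun_eq_iff)
      show ?thesis
      proof safe
        fix \<omega> assume "pr (G (T (- x) \<omega>))"
        then show "\<omega> \<in> T x ` {\<omega>. pr (G \<omega>)}" by (intro image_eqI[of _ _ "T (- x) \<omega>"]) (auto simp: i)
      qed (simp add: i)
    qed
    show "sym_diff (T x ` {\<omega>. pr (G \<omega>)}) {\<omega>. pr (G \<omega>)} \<in> null_sets P"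
      unfolding im null_sets_iff_AE using inv[of "- x"]
      by (auto simp: space_Omega elim!: eventually_mono)
  qed
  have not_less: "prob {\<omega>. expectation G < G \<omega>} \<noteq> 1" "prob {\<omega>. G \<omega> < expectation G} \<noteq> 1"
  proof -
    have m: "{\<omega> \<in> space P. expectation G < G \<omega>} \<in> sets P" "{\<omega> \<in> space P. G \<omega> < expectation G} \<in> sets P"
      by measurable
    show "prob {\<omega>. expectation G < G \<omega>} \<noteq> 1"
    proof
      assume "prob {\<omega>. expectation G < G \<omega>} = 1"
      then have "AE \<omega> in P. \<omega> \<in> {\<omega>. expectation G < G \<omega>}" using m by (subst AE_in_set_eq_1) (auto simp: space_Omega)
      then have "expectation (\<lambda>_. expectation G) < expectation G"
        using iG by (intro integral_less_AE_space) (auto simp: emeasure_space_1)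
      then show False by (simp add: prob_space)
    qed
    show "prob {\<omega>. G \<omega> < expectation G} \<noteq> 1"
    proof
      assume "prob {\<omega>. G \<omega> < expectation G} = 1"
      then have "AE \<omega> in P. \<omega> \<in> {\<omega>. G \<omega> < expectation G}" using m by (subst AE_in_set_eq_1) (auto simp: space_Omega)
      then have "expectation G < expectation (\<lambda>_. expectation G)"
        using iG by (intro integral_less_AE_space) (auto simp: emeasure_space_1)
      then show False by (simp add: prob_space)
    qed
  qed
  have "{\<omega> \<in> space P. expectation G < G \<omega>} \<in> sets P" "{\<omega> \<in> space P. G \<omega> < expectation G} \<in> sets P"
    by measurable
  then have "{\<omega>. expectation G < G \<omega>} \<in> null_sets P" "{\<omega>. G \<omega> < expectation G} \<in> null_sets P"
    using zero_one[of "\<lambda>t. expectation G < t"] zero_one[of "\<lambda>t. t < expectation G"] not_less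
    by (auto simp: space_Omega null_sets_def emeasure_eq_measure)
  from this[THEN AE_not_in] show ?thesis by eventually_elim auto
qed

lemma T_funpow: "(T a ^^ k) \<omega> = T (real k *\<^sub>R a) \<omega>"
  by (induction k) (auto simp: T_zero T_add algebra_simps)

text \<open>Let F \<open>\<omega>\<close> be the integral of the orbit of \<open>\<omega>\<close> over the corner box of c. Because the translates of
  the box tile its dilations, the Birkhoff means of F for the translations by \<open>c\<^sub>1 e\<^sub>1\<close>, \<open>c\<^sub>2 e\<^sub>2\<close> and
  \<open>c\<^sub>3 e\<^sub>3\<close> are the averages of the orbit over the dilated boxes, so these converge almost surely. A
  translation of the starting point by y becomes a translation of the box by y/n after rescaling and
  is invisible in the limit, which is therefore invariant and equal to its expectation.\<close>

lemma corner_box_mean: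
  assumes f: "f \<in> borel_measurable P" "\<And>\<omega>. \<bar>f \<omega>\<bar> \<le> C"
    and g [measurable]: "g \<in> borel_measurable (lborel \<Otimes>\<^sub>M P)" and gC: "\<And>z. \<bar>g z\<bar> \<le> C"
    and g1: "AE x in lborel. AE \<omega> in P. g (x, \<omega>) = f (T x \<omega>)"
    and g2: "AE \<omega> in P. AE x in lborel. g (x, \<omega>) = f (T x \<omega>)"
  shows "AE \<omega> in P. (\<lambda>n. \<integral>x. corner_box c x * g (real n *\<^sub>R x, \<omega>) \<partial>lborel)
    \<longlonglongrightarrow> expectation f * (\<integral>x. corner_box c x \<partial>lborel)"
proof -
  interpret LP: pair_sigma_finite "lborel :: (real^3) measure" P ..
  have gm [measurable]: "(\<lambda>x. g (x, \<omega>)) \<in> borel_measurable borel" for \<omega>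
  proof -
    have "\<omega> \<in> space P" by (simp add: space_Omega)
    then show ?thesis by measurable
  qed
  define F where "F \<omega> = (\<integral>x. corner_box c x * g (x, \<omega>) \<partial>lborel)" for \<omega>
  define M where "M n \<omega> = (\<integral>x. corner_box c x * g (real n *\<^sub>R x, \<omega>) \<partial>lborel)" for n \<omega>
  define w where "w = (\<integral>x. \<bar>corner_box c x\<bar> \<partial>lborel)"
  have F: "bdd_meas P (C * w) F"
    unfolding bdd_meas_def
  proof (intro conjI ballI)
    show "F \<in> borel_measurable P" unfolding F_def
      by (rule lborel.borel_measurable_lebesgue_integral) measurable
    fix \<omega>
    show "\<bar>F \<omega>\<bar> \<le> C * w"
      unfolding F_def w_def
      using integral_mult_bounded_diff[OF corner_box_integrable[of c] integrable_zero, of "\<lambda>x. g (x, \<omega>)" C] gC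
      by simp
  qed
  \<comment> \<open>Fubini's theorem, with \<open>T x\<close> preserving expectations for each x.\<close>
  have EF: "expectation F = expectation f * (\<integral>x. corner_box c x \<partial>lborel)"
  proof -
    have int: "integrable (lborel \<Otimes>\<^sub>M P) (case_prod (\<lambda>x \<omega>. corner_box c x * g (x, \<omega>)))"
    proof (rule LP.Fubini_integrable)
      have b: "norm (corner_box c x * g (x, \<omega>)) \<le> C * \<bar>corner_box c x\<bar>" for x \<omega>
        using mult_left_mono[OF gC[of "(x, \<omega>)"] abs_ge_zero[of "corner_box c x"]]
        by (simp add: abs_mult mult.commute)
      have gx: "(\<lambda>\<omega>. corner_box c x * g (x, \<omega>)) \<in> borel_measurable P" for x by measurable
      have gx': "integrable P (\<lambda>\<omega>. corner_box c x * g (x, \<omega>))" for x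
        by (rule integrable_const_bound[where B="C * \<bar>corner_box c x\<bar>"]) (use b gx in auto)
      then show "AE x in lborel. integrable P (\<lambda>y. case (x, y) of (x, \<omega>) \<Rightarrow> corner_box c x * g (x, \<omega>))" by simp
      show "integrable lborel (\<lambda>x. \<integral>y. norm (case (x, y) of (x, \<omega>) \<Rightarrow> corner_box c x * g (x, \<omega>)) \<partial>P)"
      proof (rule Bochner_Integration.integrable_bound)
        show "integrable lborel (\<lambda>x. C * \<bar>corner_box c x\<bar>)" using corner_box_integrable by simp
        show "(\<lambda>x. \<integral>y. norm (case (x, y) of (x, \<omega>) \<Rightarrow> corner_box c x * g (x, \<omega>)) \<partial>P) \<in> borel_measurable lborel"
          by (rule borel_measurable_lebesgue_integral) measurable
        show "AE x in lborel. norm (\<integral>y. norm (case (x, y) of (x, \<omega>) \<Rightarrow> corner_box c x * g (x, \<omega>)) \<partial>P)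
            \<le> norm (C * \<bar>corner_box c x\<bar>)"
        proof (rule AE_I2)
          fix x
          have "(\<integral>y. norm (corner_box c x * g (x, y)) \<partial>P) \<le> (\<integral>y. C * \<bar>corner_box c x\<bar> \<partial>P)"
            using gx'[of x] b by (intro integral_mono) (auto intro!: integrable_abs)
          moreover have "0 \<le> (\<integral>y. norm (corner_box c x * g (x, y)) \<partial>P)" by simp
          ultimately show "norm (\<integral>y. norm (case (x, y) of (x, \<omega>) \<Rightarrow> corner_box c x * g (x, \<omega>)) \<partial>P)
            \<le> norm (C * \<bar>corner_box c x\<bar>)" by (simp add: prob_space)
        qed
      qed
    qed measurable
    have "expectation F = (\<integral>x. (\<integral>\<omega>. corner_box c x * g (x, \<omega>) \<partial>P) \<partial>lborel)"
      unfolding F_def by (rule LP.Fubini_integral[OF int])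
    also have "\<dots> = (\<integral>x. corner_box c x * expectation f \<partial>lborel)"
    proof (rule integral_cong_AE)
      show "(\<lambda>x. \<integral>\<omega>. corner_box c x * g (x, \<omega>) \<partial>P) \<in> borel_measurable lborel"
        by (rule borel_measurable_lebesgue_integral) measurable
      show "AE x in lborel. (\<integral>\<omega>. corner_box c x * g (x, \<omega>) \<partial>P) = corner_box c x * expectation f"
        using g1
      proof eventually_elim
        case (elim x)
        have "(\<integral>\<omega>. g (x, \<omega>) \<partial>P) = (\<integral>\<omega>. f (T x \<omega>) \<partial>P)"
          using elim by (intro integral_cong_AE) (auto intro: measurable_compose[OF T_measurable f(1)])
        also have "\<dots> = expectation f"
          by (rule measure_preserving_integral[OF T_measurable T_distr f(1)])
        finally show ?case by simp
      qed
    qed measurable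
    finally show ?thesis by simp
  qed
  \<comment> \<open>The group law, read off for f along the orbit and carried over to the version g.\<close>
  have shift: "AE \<omega> in P. AE x in lborel. g (x, T y \<omega>) = g (x + y, \<omega>)" for y
    using AE_translate[OF g2, of y] g2
  proof eventually_elim
    case (elim \<omega>)
    from elim(1) AE_lborel_translate[OF elim(2), of y] show ?case
      by eventually_elim (simp add: T_add)
  qed
  have F_shift: "AE \<omega> in P. F (T y \<omega>) = (\<integral>x. corner_box c (x - y) * g (x, \<omega>) \<partial>lborel)" for y
    using shift[of y]
  proof eventually_elim
    case (elim \<omega>)
    have "F (T y \<omega>) = (\<integral>x. corner_box c x * g (x + y, \<omega>) \<partial>lborel)"
      unfolding F_def using elim by (intro integral_cong_AE) (auto elim: eventually_mono)
    also have "\<dots> = (\<integral>x. corner_box c (x - y) * g (x, \<omega>) \<partial>lborel)"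
      using integral_lborel_translate[of "\<lambda>x. corner_box c (x - y) * g (x, \<omega>)" y] by simp
    finally show ?case .
  qed
  let ?S = "\<lambda>l::3. T (axis l (c $ l))"
  let ?A = "\<lambda>n f. birkhoff_mean (?S 1) n (birkhoff_mean (?S 2) n (birkhoff_mean (?S 3) n f))"
  have b: "averaging_scheme P (birkhoff_mean (?S l))" for l
    by (rule averaging_scheme_birkhoff[OF T_measurable T_distr])
  have scheme: "averaging_scheme P ?A"
    by (rule averaging_scheme_compose[OF b[of 1] averaging_scheme_compose[OF b[of 2] b[of 3]]])
  obtain G where G: "bdd_meas P (C * w) G" "AE \<omega> in P. (\<lambda>n. ?A n F \<omega>) \<longlonglongrightarrow> G \<omega>" "expectation G = expectation F"
    using scheme F unfolding averaging_scheme_def by blast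
  have AM: "AE \<omega> in P. \<forall>n>0. ?A n F \<omega> = M n \<omega>"
  proof -
    let ?v = "\<lambda>i j k. real k *\<^sub>R axis 3 (c $ 3) + (real j *\<^sub>R axis 2 (c $ 2) + real i *\<^sub>R axis 1 (c $ 1)) :: real^3"
    have "AE \<omega> in P. \<forall>i j k. F (T (?v i j k) \<omega>) = (\<integral>x. corner_box c (x - ?v i j k) * g (x, \<omega>) \<partial>lborel)"
      by (simp only: AE_all_countable) (intro allI F_shift)
    then show ?thesis
    proof eventually_elim
      case (elim \<omega>)
      have ig: "integrable lborel (\<lambda>x. corner_box c (x - y) * g (x, \<omega>))" for y
      proof (rule integrable_mult_bounded[where C=C])
        show "integrable lborel (\<lambda>x. corner_box c (x - y))"
        proof (rule integrable_bounded_support[where B=1 and R="norm c + norm y"])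
          fix x assume "corner_box c (x - y) \<noteq> 0"
          then have "norm (x - y) \<le> norm c" by (rule corner_box_support)
          then show "norm x \<le> norm c + norm y" using norm_triangle_ineq[of "x - y" y] by simp
        qed (auto simp: corner_box_le_1)
      qed (auto simp: gC)
      show ?case
      proof (intro allI impI)
        fix n :: nat assume n: "0 < n"
        have "?A n F \<omega> = (\<Sum>i<n. \<Sum>j<n. \<Sum>k<n. F (T (?v i j k) \<omega>)) / real n ^ 3"
          using n by (simp add: birkhoff_mean_def T_funpow T_add sum_divide_distrib[symmetric] power3_eq_cube)
        also have "(\<Sum>i<n. \<Sum>j<n. \<Sum>k<n. F (T (?v i j k) \<omega>))
            = (\<integral>x. (\<Sum>i<n. \<Sum>j<n. \<Sum>k<n. corner_box c (x - ?v i j k) * g (x, \<omega>)) \<partial>lborel)"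
          using elim ig by simp
        also have "\<dots> = (\<integral>x. corner_box c (x /\<^sub>R real n) * g (x, \<omega>) \<partial>lborel)"
          unfolding sum_distrib_right[symmetric] corner_box_tiling[OF n] ..
        also have "\<dots> = real n ^ 3 * (\<integral>x. corner_box c ((real n *\<^sub>R x) /\<^sub>R real n) * g (real n *\<^sub>R x, \<omega>) \<partial>lborel)"
          using n by (intro integral_lborel_scale) auto
        also have "\<dots> = real n ^ 3 * M n \<omega>"
          using n by (simp add: M_def)
        finally show "?A n F \<omega> = M n \<omega>" using n by simp
      qed
    qed
  qed
  have MG: "AE \<omega> in P. (\<lambda>n. M n \<omega>) \<longlonglongrightarrow> G \<omega>"
    using AM G(2)
  proof eventually_elim
    case (elim \<omega>)
    show ?case
      by (rule Lim_transform_eventually[OF elim(2)])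
        (use elim(1) in \<open>auto simp: eventually_sequentially intro!: exI[of _ 1]\<close>)
  qed
  have inv: "AE \<omega> in P. G (T y \<omega>) = G \<omega>" for y
    using MG AE_translate[OF MG, of y] shift[of y]
  proof eventually_elim
    case (elim \<omega>)
    \<comment> \<open>Moving the starting point by y moves the rescaled box by y/n.\<close>
    have d: "\<bar>M n (T y \<omega>) - M n \<omega>\<bar> \<le> C * (\<integral>x. \<bar>1 ^ 3 * corner_box c (1 *\<^sub>R x - y /\<^sub>R real n) - corner_box c x\<bar> \<partial>lborel)"
      if n: "0 < n" for n
    proof -
      have "M n (T y \<omega>) = (\<integral>x. corner_box c x * g (real n *\<^sub>R x + y, \<omega>) \<partial>lborel)"
        unfolding M_def using AE_lborel_scale[OF elim(3), of "real n"] n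
        by (intro integral_cong_AE) (auto elim: eventually_mono)
      also have "\<dots> = (\<integral>x. corner_box c (x - y /\<^sub>R real n) * g (real n *\<^sub>R x, \<omega>) \<partial>lborel)"
        using integral_lborel_translate[of "\<lambda>x. corner_box c (x - y /\<^sub>R real n) * g (real n *\<^sub>R x, \<omega>)" "y /\<^sub>R real n"] n
        by (simp add: scaleR_add_right)
      finally have e: "M n (T y \<omega>) = (\<integral>x. corner_box c (x - y /\<^sub>R real n) * g (real n *\<^sub>R x, \<omega>) \<partial>lborel)" .
      have i: "integrable lborel (\<lambda>x. corner_box c (x - y /\<^sub>R real n))"
      proof (rule integrable_bounded_support[where B=1 and R="norm c + norm (y /\<^sub>R real n)"])
        fix x assume "corner_box c (x - y /\<^sub>R real n) \<noteq> 0"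
        then have "norm (x - y /\<^sub>R real n) \<le> norm c" by (rule corner_box_support)
        then show "norm x \<le> norm c + norm (y /\<^sub>R real n)" using norm_triangle_ineq[of "x - y /\<^sub>R real n" "y /\<^sub>R real n"] by simp
      qed (auto simp: corner_box_le_1)
      show ?thesis
        using integral_mult_bounded_diff[OF i corner_box_integrable[of c], of "\<lambda>x. g (real n *\<^sub>R x, \<omega>)" C] gC
        by (subst e) (simp add: M_def)
    qed
    have "(\<lambda>n. y /\<^sub>R real n) \<longlonglongrightarrow> 0"
      using tendsto_scaleR[OF lim_inverse_n tendsto_const[of y]] by simp
    from tendsto_mult_right_zero[OF corner_box_affine_L1[OF tendsto_const this], of C c]
    have "(\<lambda>n. M n (T y \<omega>) - M n \<omega>) \<longlonglongrightarrow> 0"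
      by (rule Lim_null_comparison[rotated])
        (unfold eventually_sequentially real_norm_def, intro exI[of _ 1] allI impI d, simp)
    moreover have "(\<lambda>n. M n (T y \<omega>) - M n \<omega>) \<longlonglongrightarrow> G (T y \<omega>) - G \<omega>"
      using elim by (intro tendsto_diff)
    ultimately show ?case using LIMSEQ_unique by force
  qed
  from invariant_AE_const[OF G(1) inv] MG show ?thesis
    by eventually_elim (simp add: M_def G(3) EF)
qed

text \<open>Clipping changes f on a null set only, and almost every orbit avoids that set at almost every time.
  Hence the bounded function g of the orbit version may stand in for f. The exceptional set of \<open>\<omega>\<close>
  comes from the countably many rational corners and is the same for all weights k and scales \<open>\<epsilon>\<close>.\<close>

lemma orbit_mean:
  fixes f :: "'w \<Rightarrow> real"
  assumes f: "f \<in> borel_measurable P" and C: "AE \<omega> in P. \<bar>f \<omega>\<bar> \<le> C"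
  shows "AE \<omega> in P. (\<forall>\<epsilon>>0. (\<lambda>x. f (T (x /\<^sub>R \<epsilon>) \<omega>)) \<in> borel_measurable lebesgue) \<and>
    (\<forall>k. integrable lebesgue k \<longrightarrow>
      ((\<lambda>\<epsilon>. \<integral>x. k x * f (T (x /\<^sub>R \<epsilon>) \<omega>) \<partial>lebesgue) \<longlongrightarrow> expectation f * (\<integral>x. k x \<partial>lebesgue)) (at_right 0))"
proof -
  define f' where "f' \<omega> = max (- \<bar>C\<bar>) (min \<bar>C\<bar> (f \<omega>))" for \<omega>
  note [measurable] = f
  have f' [measurable]: "f' \<in> borel_measurable P" unfolding f'_def by measurable
  have f'C: "\<bar>f' \<omega>\<bar> \<le> \<bar>C\<bar>" for \<omega> by (auto simp: f'_def max_def min_def abs_if)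
  have eq: "AE \<omega> in P. f' \<omega> = f \<omega>"
    using C by eventually_elim (auto simp: f'_def max_def min_def abs_if split: if_splits)
  have Ef: "expectation f' = expectation f"
    using f eq by (intro integral_cong_AE) auto
  obtain g where g [measurable]: "g \<in> borel_measurable (lborel \<Otimes>\<^sub>M P)" and gC: "\<And>z. \<bar>g z\<bar> \<le> \<bar>C\<bar>"
    and g1: "AE x in lborel. AE \<omega> in P. g (x, \<omega>) = f' (T x \<omega>)"
    and g2: "AE \<omega> in P. AE x in lborel. g (x, \<omega>) = f' (T x \<omega>)"
    using orbit_version[OF f' f'C] by blast
  have gm [measurable]: "(\<lambda>x. g (x, \<omega>)) \<in> borel_measurable borel" for \<omega>
  proof -
    have "\<omega> \<in> space P" by (simp add: space_Omega)
    then show ?thesis by measurable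
  qed
  have cnt: "countable {c::real^3. \<forall>i. c $ i \<in> \<rat>}"
  proof (rule countable_subset)
    show "{c::real^3. \<forall>i. c $ i \<in> \<rat>} \<subseteq> (\<lambda>(p, q, r). vector [p, q, r]) ` (\<rat> \<times> \<rat> \<times> \<rat>)"
    proof
      fix c :: "real^3" assume "c \<in> {c. \<forall>i. c $ i \<in> \<rat>}"
      moreover have "c = vector [c $ 1, c $ 2, c $ 3]" by (simp add: vec_eq_iff forall_3)
      ultimately show "c \<in> (\<lambda>(p, q, r). vector [p, q, r]) ` (\<rat> \<times> \<rat> \<times> \<rat>)"
        by (intro image_eqI[of _ _ "(c $ 1, c $ 2, c $ 3)"]) auto
    qed
    show "countable ((\<lambda>(p, q, r). vector [p, q, r] :: real^3) ` (\<rat> \<times> \<rat> \<times> \<rat>))"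
      by (intro countable_image countable_SIGMA countable_rat)
  qed
  have "AE \<omega> in P. \<forall>c\<in>{c::real^3. \<forall>i. c $ i \<in> \<rat>}. (\<lambda>n. \<integral>x. corner_box c x * g (real n *\<^sub>R x, \<omega>) \<partial>lborel)
    \<longlonglongrightarrow> expectation f' * (\<integral>x. corner_box c x \<partial>lborel)"
    unfolding AE_ball_countable[OF cnt] using corner_box_mean[OF f' f'C g gC g1 g2] by blast
  moreover note g2 AE_orbit[OF eq]
  ultimately show ?thesis
  proof eventually_elim
    case (elim \<omega>)
    have mean: "has_mean_against (\<lambda>x. g (x, \<omega>)) (expectation f) k" if "integrable lborel k" for k
    proof (rule has_mean_against_integrable[OF gm gC _ that])
      fix c :: "real^3" assume "\<And>i. c $ i \<in> \<rat>"
      then show "has_mean_against (\<lambda>x. g (x, \<omega>)) (expectation f) (corner_box c)"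
        using elim(1) by (intro has_mean_against_corner_box[OF gm gC]) (auto simp: Ef)
    qed
    have fg: "AE x in lebesgue. f (T (x /\<^sub>R \<epsilon>) \<omega>) = g (x /\<^sub>R \<epsilon>, \<omega>)" if "0 < \<epsilon>" for \<epsilon>
    proof -
      have "AE x in lborel. f (T x \<omega>) = g (x, \<omega>)" using elim(2,3) by eventually_elim simp
      from AE_lborel_scale[OF this, of "inverse \<epsilon>"] that show ?thesis by (intro AE_completion) simp
    qed
    have gl: "(\<lambda>x. g (x /\<^sub>R \<epsilon>, \<omega>)) \<in> borel_measurable lebesgue" for \<epsilon>
      by (intro measurable_completion) measurable
    have fm: "(\<lambda>x. f (T (x /\<^sub>R \<epsilon>) \<omega>)) \<in> borel_measurable lebesgue" if "0 < \<epsilon>" for \<epsilon>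
      by (rule completion.borel_measurable_AE_cong[OF gl fg[OF that]])
    moreover have "((\<lambda>\<epsilon>. \<integral>x. k x * f (T (x /\<^sub>R \<epsilon>) \<omega>) \<partial>lebesgue) \<longlongrightarrow> expectation f * (\<integral>x. k x \<partial>lebesgue)) (at_right 0)"
      if k: "integrable lebesgue k" for k
    proof -
      have km: "k \<in> borel_measurable lebesgue" using k by simp
      from completion_ex_borel_measurable_real[OF this] obtain k'
        where k' [measurable]: "k' \<in> borel_measurable lborel" and kk: "AE x in lborel. k x = k' x" by blast
      have kk': "AE x in lebesgue. k x = k' x" by (rule AE_completion[OF kk])
      have k'l: "k' \<in> borel_measurable lebesgue" by (rule measurable_completion[OF k'])
      have "integrable lebesgue k'" using k kk' km k'l integrable_cong_AE by blast
      then have "integrable lborel k'" by (simp add: integrable_completion)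
      note mean' = mean[OF this, unfolded has_mean_against_def]
      have "(\<integral>x. k x \<partial>lebesgue) = (\<integral>x. k' x \<partial>lborel)"
        using integral_cong_AE[OF km k'l kk'] by (simp add: integral_completion)
      moreover have "(\<integral>x. k' x * g (x /\<^sub>R \<epsilon>, \<omega>) \<partial>lborel) = (\<integral>x. k x * f (T (x /\<^sub>R \<epsilon>) \<omega>) \<partial>lebesgue)"
        if "0 < \<epsilon>" for \<epsilon>
      proof -
        have "(\<integral>x. k x * f (T (x /\<^sub>R \<epsilon>) \<omega>) \<partial>lebesgue) = (\<integral>x. k' x * g (x /\<^sub>R \<epsilon>, \<omega>) \<partial>lebesgue)"
        proof (rule integral_cong_AE)
          show "AE x in lebesgue. k x * f (T (x /\<^sub>R \<epsilon>) \<omega>) = k' x * g (x /\<^sub>R \<epsilon>, \<omega>)"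
            using kk' fg[OF that] by eventually_elim simp
        qed (intro borel_measurable_times km fm k'l gl that)+
        also have "\<dots> = (\<integral>x. k' x * g (x /\<^sub>R \<epsilon>, \<omega>) \<partial>lborel)"
          by (rule integral_completion) measurable
        finally show ?thesis by simp
      qed
      ultimately show ?thesis
        using Lim_transform_eventually[OF mean'] by (auto simp: eventually_at_right_less eventually_at_filter)
    qed
    ultimately show ?case by blast
  qed
qed

end

section \<open>Convergence of sphere-valued fields\<close>

lemma complete_measure_restrict_space:
  assumes "complete_measure M" "\<Omega> \<in> sets M"
  shows "complete_measure (restrict_space M \<Omega>)"
proof
  interpret complete_measure M by fact
  fix A B assume AB: "A \<subseteq> B" "B \<in> null_sets (restrict_space M \<Omega>)"
  then have B: "B \<subseteq> \<Omega>" "B \<in> null_sets M" by (simp_all add: null_sets_restrict_space[OF assms(2)])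
  have "A \<in> null_sets M" by (rule complete2[OF AB(1) B(2)])
  moreover have "A \<subseteq> \<Omega>" using AB(1) B(1) by (rule order.trans)
  ultimately have "A \<in> null_sets (restrict_space M \<Omega>)"
    by (simp add: null_sets_restrict_space[OF assms(2)])
  then show "A \<in> sets (restrict_space M \<Omega>)" by (rule null_setsD2)
qed

locale bounded_domain =
  fixes D :: "(real^3) set"
  assumes D_open: "open D" and D_bounded: "bounded D"
begin

lemma D_lebesgue [measurable]: "D \<in> sets lebesgue"
  using D_open by simp

sublocale finite_measure "lebesgue_on D"
proof
  have "D \<in> lmeasurable" by (rule bounded_set_imp_lmeasurable[OF D_bounded D_lebesgue])
  then have "emeasure lebesgue D \<noteq> \<infinity>" by (auto simp: fmeasurable_def)
  then show "emeasure (lebesgue_on D) (space (lebesgue_on D)) \<noteq> \<infinity>"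
    by (simp add: emeasure_restrict_space)
qed

sublocale complete_measure "lebesgue_on D"
  by (rule complete_measure_restrict_space[OF completion.complete_measure_axioms D_lebesgue])

lemma L2_inner_integrable:
  assumes "u \<in> L2 D" "v \<in> L2 D"
  shows "integrable (lebesgue_on D) (\<lambda>x. u x \<bullet> v x)"
proof (rule Bochner_Integration.integrable_bound)
  have [measurable]: "u \<in> borel_measurable (lebesgue_on D)" "v \<in> borel_measurable (lebesgue_on D)"
    using assms by (auto simp: L2_def)
  show "integrable (lebesgue_on D) (\<lambda>x. (norm (u x))\<^sup>2 + (norm (v x))\<^sup>2)"
    using assms by (auto simp: L2_def)
  show "(\<lambda>x. u x \<bullet> v x) \<in> borel_measurable (lebesgue_on D)" by measurable
  show "AE x in lebesgue_on D. norm (u x \<bullet> v x) \<le> norm ((norm (u x))\<^sup>2 + (norm (v x))\<^sup>2)"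
  proof (rule AE_I2)
    fix x
    have "\<bar>u x \<bullet> v x\<bar> \<le> norm (u x) * norm (v x)" by (rule Cauchy_Schwarz_ineq2)
    moreover have "2 * (norm (u x) * norm (v x)) \<le> (norm (u x))\<^sup>2 + (norm (v x))\<^sup>2"
      using sum_squares_bound[of "norm (u x)" "norm (v x)"] by (simp add: mult.assoc)
    moreover have "0 \<le> norm (u x) * norm (v x)" by simp
    ultimately show "norm (u x \<bullet> v x) \<le> norm ((norm (u x))\<^sup>2 + (norm (v x))\<^sup>2)" by simp
  qed
qed

lemma L2_norm_integrable: "u \<in> L2 D \<Longrightarrow> integrable (lebesgue_on D) (\<lambda>x. norm (u x))"
  by (rule square_integrable_imp_integrable) (auto simp: L2_def)

text \<open>The Cauchy-Schwarz inequality against a constant, from \<open>0 \<le> \<integral>(\<bar>u\<bar> - t)\<^sup>2\<close> with the optimal t up to the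
  summand 1, which keeps the denominator positive.\<close>

lemma L1_le_L2_norm:
  assumes u: "u \<in> L2 D"
  shows "(\<integral>x. norm (u x) \<partial>lebesgue_on D) \<le> sqrt (measure (lebesgue_on D) (space (lebesgue_on D)) + 1) * L2_norm D u"
proof -
  define V where "V = measure (lebesgue_on D) (space (lebesgue_on D))"
  define a where "a = (\<integral>x. norm (u x) \<partial>lebesgue_on D)"
  define b where "b = (\<integral>x. (norm (u x))\<^sup>2 \<partial>lebesgue_on D)"
  define t where "t = a / (V + 1)"
  have V: "0 \<le> V" by (simp add: V_def)
  have "0 \<le> (\<integral>x. (norm (u x) - t)\<^sup>2 \<partial>lebesgue_on D)" by simp
  also have "\<dots> = (\<integral>x. (norm (u x))\<^sup>2 - 2 * t * norm (u x) + t\<^sup>2 \<partial>lebesgue_on D)"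
    by (simp add: power2_diff algebra_simps)
  also have "\<dots> = b - 2 * t * a + t\<^sup>2 * V"
    using u L2_norm_integrable[OF u] by (simp add: a_def b_def V_def L2_def)
  also have "\<dots> \<le> b - 2 * t * a + t\<^sup>2 * (V + 1)" by (simp add: mult_left_mono)
  also have "\<dots> = b - a\<^sup>2 / (V + 1)" 
  proof -
    have "t * (V + 1) = a" using V by (simp add: t_def)
    then have "t\<^sup>2 * (V + 1) = t * a" by (simp only: power2_eq_square mult.assoc)
    moreover have "a\<^sup>2 / (V + 1) = t * a" by (simp add: t_def power2_eq_square)
    ultimately show ?thesis by simp
  qed
  finally have "a\<^sup>2 \<le> (V + 1) * b" using V by (simp add: field_simps)
  moreover have "0 \<le> b" by (simp add: b_def)
  ultimately have "a \<le> sqrt ((V + 1) * b)" by (intro real_le_rsqrt)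
  then show ?thesis by (simp add: real_sqrt_mult a_def b_def V_def L2_norm_def)
qed

text \<open>The common consequence of strong \<open>L\<^sup>2\<close> and of weak \<open>H\<^sup>1\<close> convergence on which both energy limits rest.\<close>

definition sphere_converges :: "(real \<Rightarrow> real^3 \<Rightarrow> real^3) \<Rightarrow> (real^3 \<Rightarrow> real^3) \<Rightarrow> bool" where
  "sphere_converges m m0 \<longleftrightarrow> eventually (\<lambda>\<epsilon>. m \<epsilon> \<in> L2_sphere D) (at_right 0) \<and> m0 \<in> L2_sphere D \<and>
     ((\<lambda>\<epsilon>. \<integral>x. (norm (m \<epsilon> x - m0 x))\<^sup>2 \<partial>lebesgue_on D) \<longlongrightarrow> 0) (at_right 0)"

lemma strong_limit:
  assumes lim: "limitin (strong_L2_sphere D) m m0 (at_right 0)"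
  shows "sphere_converges m m0"
proof -
  have m0: "m0 \<in> L2_sphere D" and ev: "\<And>U. openin (strong_L2_sphere D) U \<Longrightarrow> m0 \<in> U \<Longrightarrow>
      eventually (\<lambda>\<epsilon>. m \<epsilon> \<in> U) (at_right 0)"
    using lim by (auto simp: limitin_def)
  have m0L: "m0 \<in> L2 D" using m0 by (simp add: L2_sphere_def)
  have ball: "eventually (\<lambda>\<epsilon>. m \<epsilon> \<in> {v \<in> L2 D. L2_norm D (\<lambda>x. v x - m0 x) < r} \<inter> L2_sphere D) (at_right 0)"
    if r: "0 < r" for r
  proof (rule ev)
    show "openin (strong_L2_sphere D) ({v \<in> L2 D. L2_norm D (\<lambda>x. v x - m0 x) < r} \<inter> L2_sphere D)"
      using m0L by (intro openin_subtopology_Int)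
        (unfold L2_topology_def, rule topology_generated_by_Basis, blast)
    show "m0 \<in> {v \<in> L2 D. L2_norm D (\<lambda>x. v x - m0 x) < r} \<inter> L2_sphere D"
      using m0 m0L r by (simp add: L2_norm_def)
  qed
  have nn: "0 \<le> L2_norm D u" for u by (simp add: L2_norm_def)
  have "((\<lambda>\<epsilon>. L2_norm D (\<lambda>x. m \<epsilon> x - m0 x)) \<longlongrightarrow> 0) (at_right 0)"
  proof (rule tendstoI)
    fix r :: real assume "0 < r"
    from ball[OF this] show "eventually (\<lambda>\<epsilon>. dist (L2_norm D (\<lambda>x. m \<epsilon> x - m0 x)) 0 < r) (at_right 0)"
      by eventually_elim (simp add: nn)
  qed
  from tendsto_power[OF this, of 2]
  have "((\<lambda>\<epsilon>. \<integral>x. (norm (m \<epsilon> x - m0 x))\<^sup>2 \<partial>lebesgue_on D) \<longlongrightarrow> 0) (at_right 0)"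
    by (simp add: L2_norm_def)
  moreover have "eventually (\<lambda>\<epsilon>. m \<epsilon> \<in> L2_sphere D) (at_right 0)"
    using ball[of 1] by (auto elim: eventually_mono)
  ultimately show ?thesis using m0 by (simp add: sphere_converges_def)
qed

text \<open>The \<open>H\<^sup>1\<close> norm dominates the \<open>L\<^sup>2\<close> norm, which on a domain of finite measure controls the pairing
  with a field of unit length.\<close>

lemma inner_in_H1_dual:
  assumes v: "v \<in> L2_sphere D"
  shows "(\<lambda>u. \<integral>x. u x \<bullet> v x \<partial>lebesgue_on D) \<in> H1_dual D"
proof -
  have vL: "v \<in> L2 D" and v1: "AE x in lebesgue_on D. norm (v x) = 1"
    using v by (auto simp: L2_sphere_def elim: eventually_mono)
  let ?K = "sqrt (measure (lebesgue_on D) (space (lebesgue_on D)) + 1)"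
  have bound: "\<bar>\<integral>x. u x \<bullet> v x \<partial>lebesgue_on D\<bar> \<le> ?K * H1_norm D u" if u: "u \<in> L2 D" for u
  proof -
    have "\<bar>\<integral>x. u x \<bullet> v x \<partial>lebesgue_on D\<bar> \<le> (\<integral>x. \<bar>u x \<bullet> v x\<bar> \<partial>lebesgue_on D)"
      by (rule integral_abs_bound)
    also have "\<dots> \<le> (\<integral>x. norm (u x) \<partial>lebesgue_on D)"
    proof (rule integral_mono_AE)
      show "AE x in lebesgue_on D. \<bar>u x \<bullet> v x\<bar> \<le> norm (u x)"
        using v1
      proof eventually_elim
        case (elim x)
        then show ?case using Cauchy_Schwarz_ineq2[of "u x" "v x"] by simp
      qed
    qed (use L2_inner_integrable[OF u vL] L2_norm_integrable[OF u] in auto)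
    also have "\<dots> \<le> ?K * L2_norm D u" by (rule L1_le_L2_norm[OF u])
    also have "\<dots> \<le> ?K * H1_norm D u"
    proof (rule mult_left_mono)
      have "L2_norm D u \<le> sqrt ((L2_norm D u)\<^sup>2 + (\<Sum>j\<in>UNIV. (L2_norm D (weak_partial D j u))\<^sup>2))"
        by (intro real_le_rsqrt) (simp add: sum_nonneg)
      then show "L2_norm D u \<le> H1_norm D u" by (simp add: H1_norm_def)
    qed simp
    finally show ?thesis .
  qed
  have HL: "u \<in> L2 D" if "u \<in> H1 D" for u using that by (simp add: H1_def)
  show ?thesis
    unfolding H1_dual_def
  proof (intro CollectI conjI ballI allI exI)
    fix u w assume "u \<in> H1 D" "w \<in> H1 D"
    then show "(\<integral>x. (u x + w x) \<bullet> v x \<partial>lebesgue_on D)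
        = (\<integral>x. u x \<bullet> v x \<partial>lebesgue_on D) + (\<integral>x. w x \<bullet> v x \<partial>lebesgue_on D)"
      using L2_inner_integrable[OF HL vL] by (simp add: inner_add_left)
  qed (use bound HL in auto)
qed

text \<open>On the sphere \<open>\<bar>u - m\<^sub>0\<bar>\<^sup>2 = 2 - 2 u \<bullet> m\<^sub>0\<close>. So the squared \<open>L\<^sup>2\<close> distance to \<open>m\<^sub>0\<close> is an affine function
  of a single functional in the dual of \<open>H\<^sup>1\<close>, and weak convergence controls it.\<close>

lemma weak_limit:
  assumes lim: "limitin (weak_H1_sphere D) m m0 (at_right 0)"
  shows "sphere_converges m m0"
proof -
  have m0: "m0 \<in> H1_sphere D" and ev: "\<And>U. openin (weak_H1_sphere D) U \<Longrightarrow> m0 \<in> U \<Longrightarrow>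
      eventually (\<lambda>\<epsilon>. m \<epsilon> \<in> U) (at_right 0)"
    using lim by (auto simp: limitin_def)
  have HS: "u \<in> L2_sphere D" if "u \<in> H1_sphere D" for u
    using that by (auto simp: H1_sphere_def L2_sphere_def H1_def)
  define l where "l u = (\<integral>x. u x \<bullet> m0 x \<partial>lebesgue_on D)" for u
  have l: "l \<in> H1_dual D" unfolding l_def using inner_in_H1_dual[OF HS[OF m0]] .
  have m0H: "m0 \<in> H1 D" using m0 by (simp add: H1_sphere_def)
  have nbh: "eventually (\<lambda>\<epsilon>. m \<epsilon> \<in> {u \<in> H1 D. l u \<in> ball (l m0) r} \<inter> H1_sphere D) (at_right 0)"
    if r: "0 < r" for r
  proof (rule ev)
    show "openin (weak_H1_sphere D) ({u \<in> H1 D. l u \<in> ball (l m0) r} \<inter> H1_sphere D)"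
      using l open_ball[of "l m0" r] by (intro openin_subtopology_Int)
        (unfold H1_weak_topology_def, rule topology_generated_by_Basis, blast)
    show "m0 \<in> {u \<in> H1 D. l u \<in> ball (l m0) r} \<inter> H1_sphere D" using m0 m0H r by simp
  qed
  have sph: "eventually (\<lambda>\<epsilon>. m \<epsilon> \<in> L2_sphere D) (at_right 0)"
    using nbh[of 1] by (auto elim!: eventually_mono intro: HS)
  have lim_l: "((\<lambda>\<epsilon>. l (m \<epsilon>)) \<longlongrightarrow> l m0) (at_right 0)"
  proof (rule tendstoI)
    fix r :: real assume "0 < r"
    from nbh[OF this] show "eventually (\<lambda>\<epsilon>. dist (l (m \<epsilon>)) (l m0) < r) (at_right 0)"
      by eventually_elim (simp add: dist_commute)
  qed
  let ?V = "measure (lebesgue_on D) (space (lebesgue_on D))"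
  have exp: "(\<integral>x. (norm (u x - m0 x))\<^sup>2 \<partial>lebesgue_on D) = 2 * ?V - 2 * l u" if u: "u \<in> L2_sphere D" for u
  proof -
    have uL: "u \<in> L2 D" "m0 \<in> L2 D" using u HS[OF m0] by (auto simp: L2_sphere_def)
    have [measurable]: "u \<in> borel_measurable (lebesgue_on D)" "m0 \<in> borel_measurable (lebesgue_on D)"
      using uL by (auto simp: L2_def)
    have "AE x in lebesgue_on D. norm (u x) = 1" "AE x in lebesgue_on D. norm (m0 x) = 1"
      using u HS[OF m0] by (auto simp: L2_sphere_def elim: eventually_mono)
    then have "AE x in lebesgue_on D. (norm (u x - m0 x))\<^sup>2 = 2 - 2 * (u x \<bullet> m0 x)"
      by eventually_elim
        (simp add: norm_eq_1 power2_norm_eq_inner inner_diff_left inner_diff_right inner_commute)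
    then have "(\<integral>x. (norm (u x - m0 x))\<^sup>2 \<partial>lebesgue_on D) = (\<integral>x. 2 - 2 * (u x \<bullet> m0 x) \<partial>lebesgue_on D)"
      by (intro integral_cong_AE) auto
    also have "\<dots> = 2 * ?V - 2 * l u"
      unfolding l_def using L2_inner_integrable[OF uL] by simp
    finally show ?thesis .
  qed
  have lm0: "l m0 = ?V" using exp[OF HS[OF m0]] by simp
  have "((\<lambda>\<epsilon>. 2 * ?V - 2 * l (m \<epsilon>)) \<longlongrightarrow> 2 * ?V - 2 * l m0) (at_right 0)"
    by (intro tendsto_intros lim_l)
  then have "((\<lambda>\<epsilon>. 2 * ?V - 2 * l (m \<epsilon>)) \<longlongrightarrow> 0) (at_right 0)" by (simp add: lm0)
  then have "((\<lambda>\<epsilon>. \<integral>x. (norm (m \<epsilon> x - m0 x))\<^sup>2 \<partial>lebesgue_on D) \<longlongrightarrow> 0) (at_right 0)"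
    by (rule Lim_transform_eventually) (use sph in \<open>auto elim!: eventually_mono simp: exp\<close>)
  then show ?thesis using sph HS[OF m0] by (simp add: sphere_converges_def)
qed

text \<open>The weight is only integrable, but the fields are uniformly bounded: the part of p above a large
  level n contributes little since \<open>\<bar>m\<^sub>\<epsilon> - m\<^sub>0\<bar> \<le> 2\<close>, and below that level \<open>L\<^sup>2\<close> convergence on a
  domain of finite measure is enough.\<close>

lemma sphere_converges_weighted:
  fixes p :: "real^3 \<Rightarrow> real"
  assumes conv: "sphere_converges m m0" and p: "integrable (lebesgue_on D) p" and p0: "\<And>x. 0 \<le> p x"
  shows "((\<lambda>\<epsilon>. \<integral>x. p x * norm (m \<epsilon> x - m0 x) \<partial>lebesgue_on D) \<longlongrightarrow> 0) (at_right 0)"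
proof (rule tendstoI)
  fix e :: real assume e: "0 < e"
  let ?V = "measure (lebesgue_on D) (space (lebesgue_on D))"
  have [measurable]: "p \<in> borel_measurable (lebesgue_on D)" using p by simp
  have m0L: "m0 \<in> L2_sphere D" using conv by (simp add: sphere_converges_def)
  have "(\<lambda>n. \<integral>x. p x - min (p x) (real n) \<partial>lebesgue_on D) \<longlonglongrightarrow> (\<integral>x. 0 \<partial>lebesgue_on D)"
  proof (rule integral_dominated_convergence[where w=p])
    show "AE x in lebesgue_on D. (\<lambda>n. p x - min (p x) (real n)) \<longlonglongrightarrow> 0"
    proof (rule AE_I2)
      fix x
      obtain N :: nat where N: "p x \<le> real N" using real_arch_simple by blast
      have "eventually (\<lambda>n. p x - min (p x) (real n) = 0) sequentially"
        unfolding eventually_sequentially by (rule exI[of _ N]) (use N in auto)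
      then show "(\<lambda>n. p x - min (p x) (real n)) \<longlonglongrightarrow> 0" by (rule tendsto_eventually)
    qed
    show "AE x in lebesgue_on D. norm (p x - min (p x) (real n)) \<le> p x" for n
      using p0 by (intro AE_I2) (auto simp: min_def)
  qed (use p in auto)
  then have "(\<lambda>n. \<integral>x. p x - min (p x) (real n) \<partial>lebesgue_on D) \<longlonglongrightarrow> 0" by simp
  from tendstoD[OF this, of "e / 8"] e obtain n where
    n: "\<bar>\<integral>x. p x - min (p x) (real n) \<partial>lebesgue_on D\<bar> < e / 8"
    by (auto simp: eventually_sequentially dist_real_def)
  define \<delta> where "\<delta> = e / (4 * (?V + 1))"
  have \<delta>: "0 < \<delta>" "\<delta> * ?V \<le> e / 4"
  proof -
    have "0 \<le> ?V" by simp
    then have "0 < 4 * (?V + 1)" by (intro mult_pos_pos add_nonneg_pos) simp_all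
    then show "0 < \<delta>" unfolding \<delta>_def by (intro divide_pos_pos e)
    then have "\<delta> * ?V \<le> \<delta> * (?V + 1)" by (intro mult_left_mono) simp_all
    also have "\<dots> = e / 4"
    proof -
      have "e / (4 * b) * b = e / 4" if "b \<noteq> 0" for b :: real using that by simp
      then show ?thesis unfolding \<delta>_def by (rule meta_mp) (use \<open>0 < 4 * (?V + 1)\<close> in auto)
    qed
    finally show "\<delta> * ?V \<le> e / 4" .
  qed
  define c where "c = (real n)\<^sup>2 / \<delta>"
  \<comment> \<open>Below the level n this is Young's inequality \<open>n v \<le> \<delta> + (n v)\<^sup>2 / \<delta>\<close>.\<close>
  have split: "p x * v \<le> 2 * (p x - min (p x) (real n)) + (\<delta> + c * v\<^sup>2)" if v: "0 \<le> v" "v \<le> 2" for x v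
  proof -
    have "p x * v = (p x - min (p x) (real n)) * v + min (p x) (real n) * v" by (simp add: algebra_simps)
    moreover have "(p x - min (p x) (real n)) * v \<le> (p x - min (p x) (real n)) * 2"
      using v by (intro mult_left_mono) auto
    moreover have "min (p x) (real n) * v \<le> real n * v"
      using v by (intro mult_right_mono) auto
    moreover have "real n * v \<le> \<delta> + c * v\<^sup>2"
    proof -
      have "2 * (real n * v) * \<delta> \<le> (real n * v)\<^sup>2 + \<delta>\<^sup>2" by (rule sum_squares_bound)
      moreover have "0 \<le> real n * v * \<delta>" using v \<delta>(1) by simp
      ultimately have "real n * v * \<delta> \<le> (real n * v)\<^sup>2 + \<delta>\<^sup>2" by linarith
      then have "real n * v \<le> ((real n * v)\<^sup>2 + \<delta>\<^sup>2) / \<delta>" using \<delta>(1) by (simp only: pos_le_divide_eq)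
      also have "\<dots> = \<delta> + c * v\<^sup>2"
        using \<delta>(1) by (simp add: c_def add_divide_distrib power_mult_distrib power2_eq_square)
      finally show ?thesis .
    qed
    ultimately show ?thesis by linarith
  qed
  have "((\<lambda>\<epsilon>. c * (\<integral>x. (norm (m \<epsilon> x - m0 x))\<^sup>2 \<partial>lebesgue_on D)) \<longlongrightarrow> 0) (at_right 0)"
    using conv by (intro tendsto_mult_right_zero) (simp add: sphere_converges_def)
  from tendstoD[OF this, of "e / 4"] e
  have "eventually (\<lambda>\<epsilon>. c * (\<integral>x. (norm (m \<epsilon> x - m0 x))\<^sup>2 \<partial>lebesgue_on D) < e / 4) (at_right 0)"
    by (auto simp: dist_real_def elim: eventually_mono)
  moreover have "eventually (\<lambda>\<epsilon>. m \<epsilon> \<in> L2_sphere D) (at_right 0)"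
    using conv by (simp add: sphere_converges_def)
  ultimately show "eventually (\<lambda>\<epsilon>. dist (\<integral>x. p x * norm (m \<epsilon> x - m0 x) \<partial>lebesgue_on D) 0 < e) (at_right 0)"
  proof eventually_elim
    case (elim \<epsilon>)
    have [measurable]: "m \<epsilon> \<in> borel_measurable (lebesgue_on D)" "m0 \<in> borel_measurable (lebesgue_on D)"
      using elim(2) m0L by (auto simp: L2_sphere_def L2_def)
    have "AE x in lebesgue_on D. norm (m \<epsilon> x) = 1" "AE x in lebesgue_on D. norm (m0 x) = 1"
      using elim(2) m0L by (auto simp: L2_sphere_def elim: eventually_mono)
    then have le2: "AE x in lebesgue_on D. norm (m \<epsilon> x - m0 x) \<le> 2"
      by eventually_elim (use norm_triangle_ineq4 in \<open>metis one_add_one\<close>)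
    have i2: "integrable (lebesgue_on D) (\<lambda>x. (norm (m \<epsilon> x - m0 x))\<^sup>2)"
    proof (rule integrable_const_bound)
      show "AE x in lebesgue_on D. norm ((norm (m \<epsilon> x - m0 x))\<^sup>2) \<le> 2\<^sup>2"
        using le2
      proof eventually_elim
        case (elim x)
        then have "(norm (m \<epsilon> x - m0 x))\<^sup>2 \<le> 2\<^sup>2" by (rule power_mono) simp
        then show ?case by simp
      qed
    qed measurable
    have ip: "integrable (lebesgue_on D) (\<lambda>x. p x - min (p x) (real n))"
      using p p0 by (intro Bochner_Integration.integrable_bound[OF p]) (auto simp: min_def)
    have "(\<integral>x. p x * norm (m \<epsilon> x - m0 x) \<partial>lebesgue_on D)
        \<le> (\<integral>x. 2 * (p x - min (p x) (real n)) + (\<delta> + c * (norm (m \<epsilon> x - m0 x))\<^sup>2) \<partial>lebesgue_on D)"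
    proof (rule integral_mono_AE)
      show "integrable (lebesgue_on D) (\<lambda>x. p x * norm (m \<epsilon> x - m0 x))"
      proof (rule Bochner_Integration.integrable_bound)
        show "integrable (lebesgue_on D) (\<lambda>x. p x * 2)" using p by simp
        show "AE x in lebesgue_on D. norm (p x * norm (m \<epsilon> x - m0 x)) \<le> norm (p x * 2)"
          using le2 by eventually_elim (use p0 in \<open>auto simp: abs_mult intro: mult_left_mono\<close>)
      qed simp
      show "AE x in lebesgue_on D. p x * norm (m \<epsilon> x - m0 x)
          \<le> 2 * (p x - min (p x) (real n)) + (\<delta> + c * (norm (m \<epsilon> x - m0 x))\<^sup>2)"
        using le2 by eventually_elim (rule split, auto)
    qed (intro Bochner_Integration.integrable_add integrable_mult_right integrable_const i2 ip)
    also have "\<dots> = 2 * (\<integral>x. p x - min (p x) (real n) \<partial>lebesgue_on D)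
        + (\<delta> * ?V + c * (\<integral>x. (norm (m \<epsilon> x - m0 x))\<^sup>2 \<partial>lebesgue_on D))"
    proof -
      have "(\<integral>x. 2 * a x + (\<delta> + c * b x) \<partial>lebesgue_on D)
          = 2 * (\<integral>x. a x \<partial>lebesgue_on D) + (\<delta> * ?V + c * (\<integral>x. b x \<partial>lebesgue_on D))"
        if "integrable (lebesgue_on D) a" "integrable (lebesgue_on D) b" for a b :: "real^3 \<Rightarrow> real"
        using that by simp
      from this[OF ip i2] show ?thesis .
    qed
    also have "\<dots> < e" using n \<delta>(2) elim(1) by linarith
    finally show ?case using p0 by simp
  qed
qed

end

section \<open>Lipschitz functions and the Zeeman energy\<close>

text \<open>McShane's formula recovers a Lipschitz function from its values on a dense set. The
  bound compares values with the one at s alone, so that the formula can be used where the Lipschitz bound is known for countably many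
  pairs of points.\<close>

lemma lipschitz_eq_INF:
  fixes f :: "'a::metric_space \<Rightarrow> real"
  assumes L: "0 \<le> L" and s: "s \<in> closure Q" and lip: "\<And>q. q \<in> Q \<Longrightarrow> \<bar>f s - f q\<bar> \<le> L * dist s q"
  shows "f s = (INF q\<in>Q. f q + L * dist s q)"
proof (rule antisym)
  have ne: "Q \<noteq> {}" using s by auto
  have lb: "f s \<le> f q + L * dist s q" if "q \<in> Q" for q
    using lip[OF that] by (simp add: abs_le_iff)
  show "f s \<le> (INF q\<in>Q. f q + L * dist s q)"
    by (rule cINF_greatest[OF ne lb])
  show "(INF q\<in>Q. f q + L * dist s q) \<le> f s"
  proof (rule field_le_epsilon)
    fix e :: real assume e: "0 < e"
    obtain q where q: "q \<in> Q" "dist q s < e / (2 * L + 1)"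
      using s e L unfolding closure_approachable by (metis add_nonneg_pos divide_pos_pos mult_nonneg_nonneg zero_le_numeral zero_less_one)
    have "(INF q\<in>Q. f q + L * dist s q) \<le> f q + L * dist s q"
      by (rule cINF_lower[OF _ q(1)]) (use lb in \<open>auto intro!: bdd_belowI2[where m="f s"]\<close>)
    also have "\<dots> \<le> f s + 2 * (L * dist s q)"
      using lip[OF q(1)] by (simp add: abs_le_iff)
    also have "2 * (L * dist s q) \<le> (2 * L + 1) * dist q s"
      by (simp add: dist_commute distrib_right)
    also have "(2 * L + 1) * dist q s \<le> e"
      using q(2) L by (simp add: pos_less_divide_eq mult.commute less_imp_le)
    finally show "(INF q\<in>Q. f q + L * dist s q) \<le> f s + e" by simp
  qed
qed

text \<open>McShane's formula writes \<open>F x (m x)\<close> as a countable infimum of measurable functions of x.\<close>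

lemma lipschitz_composite_measurable:
  fixes F :: "'a \<Rightarrow> 'b::{metric_space, second_countable_topology} \<Rightarrow> real"
  assumes L: "0 \<le> L" and Q: "countable Q" and ne: "Q \<noteq> {}"
    and lip: "\<And>x s t. \<bar>F x s - F x t\<bar> \<le> L * dist s t"
    and F [measurable]: "\<And>q. q \<in> Q \<Longrightarrow> (\<lambda>x. F x q) \<in> borel_measurable M"
    and m [measurable]: "m \<in> borel_measurable M"
    and M: "complete_measure M" and mQ: "AE x in M. m x \<in> closure Q"
  shows "(\<lambda>x. F x (m x)) \<in> borel_measurable M"
proof -
  interpret complete_measure M by fact
  have "(\<lambda>x. INF q\<in>Q. F x q + L * dist (m x) q) \<in> borel_measurable M"
  proof (rule borel_measurable_cINF[OF Q])
    fix x
    show "bdd_below ((\<lambda>q. F x q + L * dist (m x) q) ` Q)"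
      using lip[of x "m x"] by (intro bdd_belowI2[where m="F x (m x)"]) (auto simp: abs_le_iff algebra_simps)
  qed measurable
  moreover have "AE x in M. F x (m x) = (INF q\<in>Q. F x q + L * dist (m x) q)"
    using mQ by eventually_elim (rule lipschitz_eq_INF[OF L _ lip])
  ultimately show ?thesis by (rule borel_measurable_AE_cong)
qed

text \<open>The functions \<open>\<theta> q\<close> are tents of radius \<open>\<delta>\<close> around the points of a finite net, divided by their sum.
  Where \<open>\<theta> q s\<close> is not zero, q is within \<open>\<delta>\<close> of s, so the weighted mean of the values f q differs from
  f s by at most \<open>L \<delta>\<close>.\<close>

lemma lipschitz_partition_of_unity:
  fixes S :: "'a::metric_space set"
  assumes S: "compact S" and Q: "S \<subseteq> closure Q" and \<delta>: "0 < \<delta>"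
  obtains Q0 and \<theta> :: "'a \<Rightarrow> 'a \<Rightarrow> real" where "finite Q0" "Q0 \<subseteq> Q"
    "\<And>q. \<theta> q \<in> borel_measurable borel" "\<And>q s. 0 \<le> \<theta> q s" "\<And>q s. q \<in> Q0 \<Longrightarrow> \<theta> q s \<le> 1"
    "\<And>f L s. s \<in> S \<Longrightarrow> 0 \<le> L \<Longrightarrow> (\<And>q. q \<in> Q0 \<Longrightarrow> \<bar>f s - f q\<bar> \<le> L * dist s q) \<Longrightarrow>
       \<bar>f s - (\<Sum>q\<in>Q0. \<theta> q s * f q)\<bar> \<le> L * \<delta>"
proof -
  have "S \<subseteq> (\<Union>q\<in>Q. ball q \<delta>)"
  proof
    fix s assume "s \<in> S"
    then have "s \<in> closure Q" using Q by blast
    then obtain q where "q \<in> Q" "dist q s < \<delta>" using \<delta> unfolding closure_approachable by blast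
    then show "s \<in> (\<Union>q\<in>Q. ball q \<delta>)" by auto
  qed
  then obtain Q0 where Q0: "Q0 \<subseteq> Q" "finite Q0" "S \<subseteq> (\<Union>q\<in>Q0. ball q \<delta>)"
    using compactE_image[OF S, of Q "\<lambda>q. ball q \<delta>"] by (metis open_ball)
  define h where "h q s = max 0 (\<delta> - dist s q)" for q s :: 'a
  define \<theta> where "\<theta> q s = h q s / (\<Sum>p\<in>Q0. h p s)" for q s
  have h0: "0 \<le> h q s" for q s by (simp add: h_def)
  have hm: "h q \<in> borel_measurable borel" for q
    unfolding h_def[abs_def] by (intro borel_measurable_continuous_onI continuous_intros)
  show thesis
  proof (rule that[of Q0 \<theta>])
    show "\<theta> q \<in> borel_measurable borel" for q
      unfolding \<theta>_def[abs_def] by (intro borel_measurable_divide borel_measurable_sum hm)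
    show "0 \<le> \<theta> q s" for q s unfolding \<theta>_def by (intro divide_nonneg_nonneg sum_nonneg h0)
    show "\<theta> q s \<le> 1" if "q \<in> Q0" for q s
    proof -
      have "h q s \<le> (\<Sum>p\<in>Q0. h p s)" using that h0 Q0(2) by (intro member_le_sum) auto
      then show ?thesis using h0[of q s] by (auto simp: \<theta>_def divide_le_eq_1)
    qed
    fix f :: "'a \<Rightarrow> real" and L s
    assume s: "s \<in> S" and L: "0 \<le> L" and lip: "\<And>q. q \<in> Q0 \<Longrightarrow> \<bar>f s - f q\<bar> \<le> L * dist s q"
    obtain p where p: "p \<in> Q0" "dist s p < \<delta>" using Q0(3) s by (auto simp: dist_commute)
    have "0 < h p s" using p by (simp add: h_def)
    also have "h p s \<le> (\<Sum>p\<in>Q0. h p s)" using p h0 Q0(2) by (intro member_le_sum) auto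
    finally have pos: "0 < (\<Sum>p\<in>Q0. h p s)" .
    have sum1: "(\<Sum>q\<in>Q0. \<theta> q s) = 1"
      using pos by (simp add: \<theta>_def sum_divide_distrib[symmetric])
    have "f s - (\<Sum>q\<in>Q0. \<theta> q s * f q) = (\<Sum>q\<in>Q0. \<theta> q s * (f s - f q))"
      by (simp add: right_diff_distrib sum_subtractf sum_distrib_right[symmetric] sum1)
    also have "\<bar>\<dots>\<bar> \<le> (\<Sum>q\<in>Q0. \<theta> q s * (L * \<delta>))"
    proof (rule order.trans[OF sum_abs sum_mono])
      fix q assume q: "q \<in> Q0"
      show "\<bar>\<theta> q s * (f s - f q)\<bar> \<le> \<theta> q s * (L * \<delta>)"
      proof (cases "dist s q < \<delta>")
        case True
        have "\<bar>f s - f q\<bar> \<le> L * \<delta>"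
          using lip[OF q] mult_left_mono[OF less_imp_le[OF True] L] by linarith
        moreover have "0 \<le> \<theta> q s" unfolding \<theta>_def by (intro divide_nonneg_nonneg sum_nonneg h0)
        ultimately show ?thesis by (simp add: abs_mult mult_left_mono)
      next
        case False
        then have "\<theta> q s = 0" by (simp add: \<theta>_def h_def)
        then show ?thesis by simp
      qed
    qed
    also have "\<dots> = L * \<delta>" by (simp add: sum_distrib_right[symmetric] sum1)
    finally show "\<bar>f s - (\<Sum>q\<in>Q0. \<theta> q s * f q)\<bar> \<le> L * \<delta>" .
  qed (use Q0 in auto)
qed

locale stochastic_domain = stochastic_setting P T + dom: bounded_domain D
  for P :: "'w::metric_space measure" and T D
begin

lemma orbit_mean_on:
  fixes f :: "'w \<Rightarrow> real"
  assumes f: "f \<in> borel_measurable P" and C: "AE \<omega> in P. \<bar>f \<omega>\<bar> \<le> C"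
  shows "AE \<omega> in P. (\<forall>\<epsilon>>0. (\<lambda>x. f (T (x /\<^sub>R \<epsilon>) \<omega>)) \<in> borel_measurable (lebesgue_on D)) \<and>
    (\<forall>k. integrable (lebesgue_on D) k \<longrightarrow>
      ((\<lambda>\<epsilon>. \<integral>x. k x * f (T (x /\<^sub>R \<epsilon>) \<omega>) \<partial>lebesgue_on D) \<longlongrightarrow> expectation f * (\<integral>x. k x \<partial>lebesgue_on D)) (at_right 0))"
  using orbit_mean[OF f C]
proof eventually_elim
  case (elim \<omega>)
  have "((\<lambda>\<epsilon>. \<integral>x. k x * f (T (x /\<^sub>R \<epsilon>) \<omega>) \<partial>lebesgue_on D) \<longlongrightarrow> expectation f * (\<integral>x. k x \<partial>lebesgue_on D)) (at_right 0)"
    if k: "integrable (lebesgue_on D) k" for k :: "real^3 \<Rightarrow> real"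
  proof -
    have "integrable lebesgue (\<lambda>x. indicator D x *\<^sub>R k x)"
      using k by (subst (asm) integrable_restrict_space) auto
    then have "((\<lambda>\<epsilon>. \<integral>x. (indicator D x *\<^sub>R k x) * f (T (x /\<^sub>R \<epsilon>) \<omega>) \<partial>lebesgue)
        \<longlongrightarrow> expectation f * (\<integral>x. indicator D x *\<^sub>R k x \<partial>lebesgue)) (at_right 0)"
      using elim by blast
    then show ?thesis by (simp add: integral_restrict_space mult.assoc)
  qed
  then show ?case using elim by (auto intro: measurable_restrict_space1)
qed

lemma AE_orbit_on:
  assumes "AE \<omega> in P. pr \<omega>"
  shows "AE \<omega> in P. \<forall>\<epsilon>>0. AE x in lebesgue_on D. pr (T (x /\<^sub>R \<epsilon>) \<omega>)"
  using AE_orbit_scaled[OF assms]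
proof eventually_elim
  case (elim \<omega>)
  then show ?case by (auto intro!: AE_completion simp: AE_restrict_space_iff elim!: eventually_mono)
qed

text \<open>Replacing \<open>m\<^sub>\<epsilon>\<close> by \<open>m\<^sub>0\<close> costs at most \<open>C \<integral>\<bar>h\<bar> \<bar>m\<^sub>\<epsilon> - m\<^sub>0\<bar>\<close>, which vanishes in the limit. What remains
  tests the oscillating magnetization against the integrable weight \<open>h \<bullet> m\<^sub>0\<close>.\<close>

lemma Zeeman_converges:
  assumes M: "Linfty P Msat" "\<And>\<omega>. 0 \<le> Msat \<omega> \<and> Msat \<omega> \<le> C"
    and h: "integrable (lebesgue_on D) h"
  shows "AE \<omega> in P. \<forall>m m0. dom.sphere_converges m m0 \<longrightarrow>
    ((\<lambda>\<epsilon>. Zeeman_energy T D \<mu>0 h Msat \<omega> \<epsilon> (m \<epsilon>)) \<longlongrightarrow> Zeeman_energy_hom P D \<mu>0 h Msat m0) (at_right 0)"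
proof -
  have Mm: "Msat \<in> borel_measurable P" using M by (simp add: Linfty_def)
  have Mb: "\<bar>Msat \<omega>\<bar> \<le> C" for \<omega> using M(2)[of \<omega>] by simp
  have C0: "0 \<le> C" using M(2)[of undefined] by simp
  show ?thesis
    using orbit_mean_on[OF Mm AE_I2[OF Mb]]
  proof eventually_elim
    case orb: (elim \<omega>)
    show ?case
    proof (intro allI impI)
      fix m m0 assume conv: "dom.sphere_converges m m0"
      have [measurable]: "h \<in> borel_measurable (lebesgue_on D)" using h by simp
      have S0: "m0 \<in> L2_sphere D" using conv by (simp add: dom.sphere_converges_def)
      let ?I = "\<lambda>\<epsilon> u. \<integral>x. h x \<bullet> (Msat (T (x /\<^sub>R \<epsilon>) \<omega>) *\<^sub>R u x) \<partial>lebesgue_on D"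
      have int: "integrable (lebesgue_on D) (\<lambda>x. h x \<bullet> (c x *\<^sub>R u x))"
        if u: "u \<in> L2_sphere D" and c: "c \<in> borel_measurable (lebesgue_on D)" "\<And>x. \<bar>c x\<bar> \<le> B" for u c B
      proof (rule Bochner_Integration.integrable_bound)
        have [measurable]: "u \<in> borel_measurable (lebesgue_on D)" using u by (auto simp: L2_sphere_def L2_def)
        note [measurable] = c(1)
        show "integrable (lebesgue_on D) (\<lambda>x. B * norm (h x))" using h by simp
        show "(\<lambda>x. h x \<bullet> (c x *\<^sub>R u x)) \<in> borel_measurable (lebesgue_on D)" by measurable
        have "AE x in lebesgue_on D. norm (u x) = 1"
          using u by (auto simp: L2_sphere_def elim: eventually_mono)
        then show "AE x in lebesgue_on D. norm (h x \<bullet> (c x *\<^sub>R u x)) \<le> norm (B * norm (h x))"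
        proof eventually_elim
          case (elim x)
          have "\<bar>h x \<bullet> u x\<bar> \<le> norm (h x)" using Cauchy_Schwarz_ineq2[of "h x" "u x"] elim by simp
          then have "\<bar>c x\<bar> * \<bar>h x \<bullet> u x\<bar> \<le> \<bar>B\<bar> * norm (h x)"
            using c(2)[of x] by (intro mult_mono) auto
          then show ?case by (simp add: abs_mult)
        qed
      qed
      have "((\<lambda>\<epsilon>. C * (\<integral>x. norm (h x) * norm (m \<epsilon> x - m0 x) \<partial>lebesgue_on D)) \<longlongrightarrow> 0) (at_right 0)"
        using h by (intro tendsto_mult_right_zero dom.sphere_converges_weighted[OF conv]) auto
      then have diff: "((\<lambda>\<epsilon>. ?I \<epsilon> (m \<epsilon>) - ?I \<epsilon> m0) \<longlongrightarrow> 0) (at_right 0)"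
      proof (rule Lim_null_comparison[rotated])
        have "eventually (\<lambda>\<epsilon>. m \<epsilon> \<in> L2_sphere D) (at_right 0)" "eventually (\<lambda>\<epsilon>::real. 0 < \<epsilon>) (at_right 0)"
          using conv by (auto simp: dom.sphere_converges_def eventually_at_right_less)
        then show "eventually (\<lambda>\<epsilon>. norm (?I \<epsilon> (m \<epsilon>) - ?I \<epsilon> m0)
            \<le> C * (\<integral>x. norm (h x) * norm (m \<epsilon> x - m0 x) \<partial>lebesgue_on D)) (at_right 0)"
        proof eventually_elim
          case (elim \<epsilon>)
          have Mo: "(\<lambda>x. Msat (T (x /\<^sub>R \<epsilon>) \<omega>)) \<in> borel_measurable (lebesgue_on D)"
            using orb elim(2) by blast
          note i = int[OF elim(1) Mo Mb] int[OF S0 Mo Mb]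
          have [measurable]: "m \<epsilon> \<in> borel_measurable (lebesgue_on D)" "m0 \<in> borel_measurable (lebesgue_on D)"
            using elim S0 by (auto simp: L2_sphere_def L2_def)
          have "norm (?I \<epsilon> (m \<epsilon>) - ?I \<epsilon> m0)
              = \<bar>\<integral>x. h x \<bullet> (Msat (T (x /\<^sub>R \<epsilon>) \<omega>) *\<^sub>R m \<epsilon> x) - h x \<bullet> (Msat (T (x /\<^sub>R \<epsilon>) \<omega>) *\<^sub>R m0 x) \<partial>lebesgue_on D\<bar>"
            using i by simp
          also have "\<dots> \<le> (\<integral>x. \<bar>h x \<bullet> (Msat (T (x /\<^sub>R \<epsilon>) \<omega>) *\<^sub>R m \<epsilon> x) - h x \<bullet> (Msat (T (x /\<^sub>R \<epsilon>) \<omega>) *\<^sub>R m0 x)\<bar> \<partial>lebesgue_on D)"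
            by (rule integral_abs_bound)
          also have "\<dots> \<le> (\<integral>x. C * (norm (h x) * norm (m \<epsilon> x - m0 x)) \<partial>lebesgue_on D)"
          proof (rule integral_mono)
            show "integrable (lebesgue_on D) (\<lambda>x. \<bar>h x \<bullet> (Msat (T (x /\<^sub>R \<epsilon>) \<omega>) *\<^sub>R m \<epsilon> x) - h x \<bullet> (Msat (T (x /\<^sub>R \<epsilon>) \<omega>) *\<^sub>R m0 x)\<bar>)"
              using i by simp
            show "integrable (lebesgue_on D) (\<lambda>x. C * (norm (h x) * norm (m \<epsilon> x - m0 x)))"
            proof (rule Bochner_Integration.integrable_bound)
              show "integrable (lebesgue_on D) (\<lambda>x. C * (2 * norm (h x)))" using h by simp
              have "AE x in lebesgue_on D. norm (m \<epsilon> x) = 1" "AE x in lebesgue_on D. norm (m0 x) = 1"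
                using elim(1) S0 by (auto simp: L2_sphere_def elim: eventually_mono)
              then show "AE x in lebesgue_on D. norm (C * (norm (h x) * norm (m \<epsilon> x - m0 x))) \<le> norm (C * (2 * norm (h x)))"
              proof eventually_elim
                case (elim x)
                then have "norm (m \<epsilon> x - m0 x) \<le> 2" using norm_triangle_ineq4[of "m \<epsilon> x" "m0 x"] by simp
                then have "norm (h x) * norm (m \<epsilon> x - m0 x) \<le> norm (h x) * 2" by (rule mult_left_mono) simp
                then show ?case using C0 by (simp add: abs_mult mult_left_mono mult.commute)
              qed
            qed measurable
            fix x
            have "\<bar>h x \<bullet> (m \<epsilon> x - m0 x)\<bar> \<le> norm (h x) * norm (m \<epsilon> x - m0 x)" by (rule Cauchy_Schwarz_ineq2)
            then have "\<bar>Msat (T (x /\<^sub>R \<epsilon>) \<omega>)\<bar> * \<bar>h x \<bullet> (m \<epsilon> x - m0 x)\<bar> \<le> C * (norm (h x) * norm (m \<epsilon> x - m0 x))"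
              using Mb C0 by (intro mult_mono) auto
            then show "\<bar>h x \<bullet> (Msat (T (x /\<^sub>R \<epsilon>) \<omega>) *\<^sub>R m \<epsilon> x) - h x \<bullet> (Msat (T (x /\<^sub>R \<epsilon>) \<omega>) *\<^sub>R m0 x)\<bar>
                \<le> C * (norm (h x) * norm (m \<epsilon> x - m0 x))"
              by (simp add: inner_diff_right right_diff_distrib[symmetric] abs_mult)
          qed
          finally show ?case by simp
        qed
      qed
      have "integrable (lebesgue_on D) (\<lambda>x. h x \<bullet> m0 x)"
        using int[OF S0, of "\<lambda>_. 1" 1] by simp
      then have "((\<lambda>\<epsilon>. \<integral>x. (h x \<bullet> m0 x) * Msat (T (x /\<^sub>R \<epsilon>) \<omega>) \<partial>lebesgue_on D)
          \<longlongrightarrow> expectation Msat * (\<integral>x. h x \<bullet> m0 x \<partial>lebesgue_on D)) (at_right 0)"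
        using orb by blast
      from tendsto_mult_left[OF tendsto_add[OF diff this], of "- \<mu>0"]
      show "((\<lambda>\<epsilon>. Zeeman_energy T D \<mu>0 h Msat \<omega> \<epsilon> (m \<epsilon>)) \<longlongrightarrow> Zeeman_energy_hom P D \<mu>0 h Msat m0) (at_right 0)"
        by (simp add: Zeeman_energy_def Zeeman_energy_hom_def mult.commute)
    qed
  qed
qed

end

section \<open>The anisotropy energy\<close>

text \<open>Completeness removes the measurability hypotheses of the usual congruence rule: if one function is
  not measurable, neither is the other, and both integrals are 0 by convention.\<close>

lemma (in complete_measure) integral_cong_AE_complete:
  fixes f g :: "'a \<Rightarrow> 'b::{banach, second_countable_topology}"
  assumes "AE x in M. f x = g x"
  shows "(\<integral>x. f x \<partial>M) = (\<integral>x. g x \<partial>M)"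
proof (cases "g \<in> borel_measurable M")
  case True
  then have "f \<in> borel_measurable M" using assms by (rule borel_measurable_AE_cong)
  then show ?thesis using True assms by (rule integral_cong_AE)
next
  case False
  moreover have "f \<notin> borel_measurable M"
  proof
    assume "f \<in> borel_measurable M"
    moreover have "AE x in M. g x = f x" using assms by eventually_elim simp
    ultimately show False using False borel_measurable_AE_cong by blast
  qed
  ultimately have "\<not> integrable M f" "\<not> integrable M g" by auto
  then show ?thesis by (simp add: not_integrable_integral_eq)
qed

lemma (in finite_measure) integral_diff_le:
  fixes f g :: "'a \<Rightarrow> real"
  assumes "integrable M f" "integrable M g" "AE x in M. \<bar>f x - g x\<bar> \<le> K"
  shows "\<bar>(\<integral>x. f x \<partial>M) - (\<integral>x. g x \<partial>M)\<bar> \<le> K * measure M (space M)"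
proof -
  have "\<bar>(\<integral>x. f x \<partial>M) - (\<integral>x. g x \<partial>M)\<bar> = \<bar>\<integral>x. f x - g x \<partial>M\<bar>" using assms by simp
  also have "\<dots> \<le> (\<integral>x. \<bar>f x - g x\<bar> \<partial>M)" by (rule integral_abs_bound)
  also have "\<dots> \<le> (\<integral>x. K \<partial>M)" using assms by (intro integral_mono_AE) auto
  finally show ?thesis by (simp add: mult.commute)
qed

lemma Linfty_AE_bound:
  assumes "Linfty P f"
  obtains C where "AE \<omega> in P. \<bar>f \<omega>\<bar> \<le> C"
proof -
  have fin: "esssup P (\<lambda>\<omega>. ereal \<bar>f \<omega>\<bar>) < \<infinity>" using assms by (simp add: Linfty_def)
  then obtain C where C: "esssup P (\<lambda>\<omega>. ereal \<bar>f \<omega>\<bar>) \<le> ereal C"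
    by (cases "esssup P (\<lambda>\<omega>. ereal \<bar>f \<omega>\<bar>)") auto
  have "AE \<omega> in P. \<bar>f \<omega>\<bar> \<le> C"
    using esssup_AE[of "\<lambda>\<omega>. ereal \<bar>f \<omega>\<bar>" P]
  proof eventually_elim
    case (elim \<omega>)
    then have "ereal \<bar>f \<omega>\<bar> \<le> ereal C" using C by (rule order.trans)
    then show ?case by simp
  qed
  then show thesis by (rule that)
qed

text \<open>For almost every \<open>\<omega>\<close> the density is Lipschitz on a countable dense subset Q of the sphere, and
  McShane's formula extends it from there. Each s on the sphere may be adjoined to Q at the price of
  another null set, so the extension agrees with \<open>\<phi>(\<cdot>,s)\<close> almost surely. A Caratheodory
  representative agrees with it almost surely on Q, hence, by continuity, on the sphere.\<close>

lemma (in stochastic_setting) anisotropy_representative: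
  assumes \<phi>: "anisotropy_density P \<phi> L"
  obtains \<rho> :: "'w \<Rightarrow> real^3 \<Rightarrow> real" and B
  where "\<And>\<omega> s t. \<bar>\<rho> \<omega> s - \<rho> \<omega> t\<bar> \<le> L * dist s t" "\<And>s. (\<lambda>\<omega>. \<rho> \<omega> s) \<in> borel_measurable P"
    "\<And>\<omega> s. s \<in> S2 \<Longrightarrow> \<bar>\<rho> \<omega> s\<bar> \<le> B" "\<And>s. s \<in> S2 \<Longrightarrow> AE \<omega> in P. \<rho> \<omega> s = \<phi> \<omega> s"
    "\<And>\<psi>. caratheodory_representative P \<phi> \<psi> \<Longrightarrow> AE \<omega> in P. \<forall>s\<in>S2. \<psi> \<omega> s = \<rho> \<omega> s"
proof -
  have L: "0 < L" using \<phi> by (simp add: anisotropy_density_def)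
  have m: "(\<lambda>\<omega>. \<phi> \<omega> s) \<in> borel_measurable P" if "s \<in> S2" for s
    using \<phi> that by (auto simp: anisotropy_density_def Linfty_def)
  have lip: "AE \<omega> in P. \<bar>\<phi> \<omega> s - \<phi> \<omega> t\<bar> \<le> L * dist s t" if "s \<in> S2" "t \<in> S2" for s t
    using esssup_AE[of "\<lambda>\<omega>. ereal \<bar>\<phi> \<omega> s - \<phi> \<omega> t\<bar>" P]
  proof eventually_elim
    case (elim \<omega>)
    have "esssup P (\<lambda>\<omega>. ereal \<bar>\<phi> \<omega> s - \<phi> \<omega> t\<bar>) \<le> ereal (L * norm (s - t))"
      using \<phi> that by (auto simp: anisotropy_density_def)
    with elim have "ereal \<bar>\<phi> \<omega> s - \<phi> \<omega> t\<bar> \<le> ereal (L * norm (s - t))" by (rule order.trans)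
    then show ?case by (simp add: dist_norm)
  qed
  obtain Q where Q: "countable Q" "Q \<subseteq> S2" "S2 \<subseteq> closure Q" by (rule separable)
  have "axis 1 1 \<in> S2" by simp
  then have neQ: "Q \<noteq> {}" using Q(3) by auto
  then obtain p where p: "p \<in> Q" by blast
  have "Linfty P (\<lambda>\<omega>. \<phi> \<omega> p)" using \<phi> p Q(2) by (auto simp: anisotropy_density_def)
  then obtain C0 where C0: "AE \<omega> in P. \<bar>\<phi> \<omega> p\<bar> \<le> C0" by (rule Linfty_AE_bound)
  have dist2: "dist s t \<le> 2" if "s \<in> S2" "t \<in> S2" for s t
    using that norm_triangle_ineq4[of s t] by (simp add: dist_norm)
  define C where "C = \<bar>C0\<bar> + L * 2"
  have C: "0 \<le> C" using L by (simp add: C_def)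
  \<comment> \<open>Clipping at the almost sure bound C makes the infimum finite, and so the extension Lipschitz, for
  every \<open>\<omega>\<close> instead of almost every one.\<close>
  define g where "g \<omega> q = max (- C) (min C (\<phi> \<omega> q))" for \<omega> q
  have gC: "- C \<le> g \<omega> q" "g \<omega> q \<le> C" for \<omega> q using C by (auto simp: g_def max_def min_def)
  define \<rho> where "\<rho> \<omega> s = (INF q\<in>Q. g \<omega> q + L * dist s q)" for \<omega> s
  have lb: "- C \<le> g \<omega> q + L * dist s q" for \<omega> q s
  proof -
    have "0 \<le> L * dist s q" using L by simp
    then show ?thesis using gC(1)[of \<omega> q] by linarith
  qed
  have bdd: "bdd_below ((\<lambda>q. g \<omega> q + L * dist s q) ` Q)" for \<omega> s
    using lb by (intro bdd_belowI2)
  have \<rho>_le: "\<rho> \<omega> s \<le> g \<omega> q + L * dist s q" if "q \<in> Q" for \<omega> s q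
    unfolding \<rho>_def by (rule cINF_lower[OF bdd that])
  have \<rho>_lip1: "\<rho> \<omega> s \<le> \<rho> \<omega> t + L * dist s t" for \<omega> s t
  proof -
    have "\<rho> \<omega> s - L * dist s t \<le> \<rho> \<omega> t"
      unfolding \<rho>_def[of \<omega> t]
    proof (rule cINF_greatest[OF neQ])
      fix q assume "q \<in> Q"
      have "L * dist s q \<le> L * (dist s t + dist t q)" using L dist_triangle by (intro mult_left_mono) auto
      then show "\<rho> \<omega> s - L * dist s t \<le> g \<omega> q + L * dist t q"
        using \<rho>_le[OF \<open>q \<in> Q\<close>, of \<omega> s] by (simp add: distrib_left)
    qed
    then show ?thesis by simp
  qed
  have \<rho>_lip: "\<bar>\<rho> \<omega> s - \<rho> \<omega> t\<bar> \<le> L * dist s t" for \<omega> s t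
    using \<rho>_lip1[of \<omega> s t] \<rho>_lip1[of \<omega> t s] by (simp add: abs_le_iff dist_commute)
  have \<rho>_m: "(\<lambda>\<omega>. \<rho> \<omega> s) \<in> borel_measurable P" for s
    unfolding \<rho>_def
  proof (rule borel_measurable_cINF[OF Q(1) _ bdd])
    fix q assume "q \<in> Q"
    then have [measurable]: "(\<lambda>\<omega>. \<phi> \<omega> q) \<in> borel_measurable P" using m Q(2) by blast
    show "(\<lambda>\<omega>. g \<omega> q + L * dist s q) \<in> borel_measurable P" unfolding g_def by measurable
  qed
  have \<rho>_bound: "\<bar>\<rho> \<omega> s\<bar> \<le> C + L * 2" if s: "s \<in> S2" for \<omega> s
  proof -
    have "- C \<le> \<rho> \<omega> s" unfolding \<rho>_def by (rule cINF_greatest[OF neQ lb])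
    moreover have "\<rho> \<omega> s \<le> C + L * 2"
    proof -
      have "L * dist s p \<le> L * 2" using L dist2[of s p] s p Q(2) by (intro mult_left_mono) auto
      then show ?thesis using \<rho>_le[OF p, of \<omega> s] gC(2)[of \<omega> p] by linarith
    qed
    ultimately show ?thesis using L by (simp add: abs_le_iff)
  qed
  have AE_g: "AE \<omega> in P. \<forall>q\<in>Q. g \<omega> q = \<phi> \<omega> q"
  proof -
    have "AE \<omega> in P. \<forall>q\<in>Q. \<bar>\<phi> \<omega> q - \<phi> \<omega> p\<bar> \<le> L * dist q p"
      using lip Q(2) p by (subst AE_ball_countable[OF Q(1)]) blast
    with C0 show ?thesis
    proof eventually_elim
      case (elim \<omega>)
      show ?case
      proof
        fix q assume q: "q \<in> Q"
        have "q \<in> S2" "p \<in> S2" using q p Q(2) by blast+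
        then have "L * dist q p \<le> L * 2" by (intro mult_left_mono dist2 less_imp_le[OF L])
        with elim q have "\<bar>\<phi> \<omega> q\<bar> \<le> C" unfolding C_def by (smt (verit))
        then show "g \<omega> q = \<phi> \<omega> q" by (auto simp: g_def)
      qed
    qed
  qed
  have \<rho>_eq: "AE \<omega> in P. \<rho> \<omega> s = \<phi> \<omega> s" if s: "s \<in> S2" for s
  proof -
    have "AE \<omega> in P. \<forall>q\<in>Q. \<bar>\<phi> \<omega> s - \<phi> \<omega> q\<bar> \<le> L * dist s q"
      using lip Q(2) s by (subst AE_ball_countable[OF Q(1)]) blast
    with AE_g show ?thesis
    proof eventually_elim
      case (elim \<omega>)
      have "\<phi> \<omega> s = (INF q\<in>Q. \<phi> \<omega> q + L * dist s q)"
        using elim(2) s Q(3) L by (intro lipschitz_eq_INF) auto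
      also have "\<dots> = \<rho> \<omega> s" unfolding \<rho>_def using elim(1) by (intro INF_cong) auto
      finally show ?case by simp
    qed
  qed
  have \<rho>_unique: "AE \<omega> in P. \<forall>s\<in>S2. \<psi> \<omega> s = \<rho> \<omega> s" if \<psi>: "caratheodory_representative P \<phi> \<psi>" for \<psi>
  proof -
    have "AE \<omega> in P. \<forall>q\<in>Q. \<psi> \<omega> q = \<phi> \<omega> q"
      using \<psi> Q(2) by (subst AE_ball_countable[OF Q(1)]) (auto simp: caratheodory_representative_def)
    moreover have "AE \<omega> in P. \<forall>q\<in>Q. \<rho> \<omega> q = \<phi> \<omega> q"
      using \<rho>_eq Q(2) by (subst AE_ball_countable[OF Q(1)]) blast
    moreover have "AE \<omega> in P. continuous_on S2 (\<psi> \<omega>)"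
      using \<psi> by (simp add: caratheodory_representative_def)
    ultimately show ?thesis
    proof eventually_elim
      case (elim \<omega>)
      have "continuous_on S2 (\<rho> \<omega>)"
        using \<rho>_lip L by (intro lipschitz_on_continuous_on[of L] lipschitz_onI) (auto simp: dist_real_def)
      with elim(3) have cont: "continuous_on S2 (\<lambda>s. \<psi> \<omega> s - \<rho> \<omega> s)" by (rule continuous_on_diff)
      show ?case
      proof
        fix s assume s: "s \<in> S2"
        then obtain X where X: "\<And>n. X n \<in> Q" "X \<longlonglongrightarrow> s"
          using Q(3) closure_sequential[of s Q] by blast
        have "(\<lambda>n. \<psi> \<omega> (X n) - \<rho> \<omega> (X n)) \<longlonglongrightarrow> \<psi> \<omega> s - \<rho> \<omega> s"
          using continuous_on_tendsto_compose[OF cont X(2) s] X(1) Q(2) by (simp add: subset_iff)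
        moreover have "(\<lambda>n. \<psi> \<omega> (X n) - \<rho> \<omega> (X n)) = (\<lambda>n. 0)" using elim(1,2) X(1) by auto
        ultimately have "\<psi> \<omega> s - \<rho> \<omega> s = 0" using LIMSEQ_unique tendsto_const by metis
        then show "\<psi> \<omega> s = \<rho> \<omega> s" by simp
      qed
    qed
  qed
  show thesis by (rule that[OF \<rho>_lip \<rho>_m \<rho>_bound \<rho>_eq \<rho>_unique])
qed

context stochastic_domain
begin

text \<open>After replacing \<open>m\<^sub>\<epsilon>\<close> by \<open>m\<^sub>0\<close>, a partition of unity on the sphere splits the density into finitely many
  products of a function of the field and a random variable \<open>\<rho>(\<cdot>,q)\<close>. The ergodic theorem applies to
  each of them. The splitting error is uniform in \<open>\<epsilon>\<close> and occurs once for the oscillating density and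
  once for its mean, which has the same Lipschitz constant.\<close>

lemma lipschitz_energy_converges:
  fixes \<rho> :: "'w \<Rightarrow> real^3 \<Rightarrow> real"
  assumes L: "0 \<le> L" and lip: "\<And>\<omega> s t. \<bar>\<rho> \<omega> s - \<rho> \<omega> t\<bar> \<le> L * dist s t"
    and meas: "\<And>s. (\<lambda>\<omega>. \<rho> \<omega> s) \<in> borel_measurable P"
    and bound: "\<And>\<omega> s. s \<in> S2 \<Longrightarrow> \<bar>\<rho> \<omega> s\<bar> \<le> B"
  shows "AE \<omega> in P. \<forall>m m0. dom.sphere_converges m m0 \<longrightarrow>
    ((\<lambda>\<epsilon>. \<integral>x. \<rho> (T (x /\<^sub>R \<epsilon>) \<omega>) (m \<epsilon> x) \<partial>lebesgue_on D)
      \<longlongrightarrow> (\<integral>x. expectation (\<lambda>\<theta>. \<rho> \<theta> (m0 x)) \<partial>lebesgue_on D)) (at_right 0)"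
proof -
  let ?V = "measure (lebesgue_on D) (space (lebesgue_on D))"
  obtain Q where Q: "countable Q" "Q \<subseteq> S2" "S2 \<subseteq> closure Q" by (rule separable)
  have e: "axis 1 1 \<in> S2" by simp
  then have neQ: "Q \<noteq> {}" using Q(3) by auto
  define c where "c s = expectation (\<lambda>\<theta>. \<rho> \<theta> s)" for s
  have int\<rho>: "integrable P (\<lambda>\<theta>. \<rho> \<theta> s)" for s
  proof (rule integrable_const_bound[where B="B + L * dist s (axis 1 1)"])
    show "AE \<theta> in P. norm (\<rho> \<theta> s) \<le> B + L * dist s (axis 1 1)"
    proof (rule AE_I2)
      fix \<theta>
      show "norm (\<rho> \<theta> s) \<le> B + L * dist s (axis 1 1)"
        using lip[of \<theta> s "axis 1 1"] bound[OF e, of \<theta>] by simp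
    qed
  qed (rule meas)
  have c_lip: "\<bar>c s - c t\<bar> \<le> L * dist s t" for s t
    using integral_diff_le[OF int\<rho>[of s] int\<rho>[of t], of "L * dist s t"] lip by (simp add: c_def prob_space)
  have c_bound: "\<bar>c s\<bar> \<le> B" if "s \<in> S2" for s
    using integral_diff_le[OF int\<rho>[of s] integrable_zero, of B] bound[OF that] by (simp add: c_def prob_space)
  have "AE \<omega> in P. \<forall>q\<in>Q. (\<forall>\<epsilon>>0. (\<lambda>x. \<rho> (T (x /\<^sub>R \<epsilon>) \<omega>) q) \<in> borel_measurable (lebesgue_on D)) \<and>
    (\<forall>k. integrable (lebesgue_on D) k \<longrightarrow>
      ((\<lambda>\<epsilon>. \<integral>x. k x * \<rho> (T (x /\<^sub>R \<epsilon>) \<omega>) q \<partial>lebesgue_on D) \<longlongrightarrow> c q * (\<integral>x. k x \<partial>lebesgue_on D)) (at_right 0))"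
    unfolding AE_ball_countable[OF Q(1)] c_def
    by (intro ballI orbit_mean_on[OF meas AE_I2[OF bound]]) (use Q(2) in blast)
  then show ?thesis
  proof eventually_elim
    case (elim \<omega>)
    show ?case
    proof (intro allI impI)
      fix m m0 assume conv: "dom.sphere_converges m m0"
      have S0: "m0 \<in> L2_sphere D" using conv by (simp add: dom.sphere_converges_def)
      have um: "u \<in> borel_measurable (lebesgue_on D)" and us: "AE x in lebesgue_on D. u x \<in> S2"
        if "u \<in> L2_sphere D" for u using that by (auto simp: L2_sphere_def L2_def)
      have int: "integrable (lebesgue_on D) (\<lambda>x. F x (u x))"
        if u: "u \<in> L2_sphere D" and F: "\<And>x s t. \<bar>F x s - F x t\<bar> \<le> L * dist s t"
          "\<And>q. q \<in> Q \<Longrightarrow> (\<lambda>x. F x q) \<in> borel_measurable (lebesgue_on D)" "\<And>x s. s \<in> S2 \<Longrightarrow> \<bar>F x s\<bar> \<le> B"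
        for u and F :: "real^3 \<Rightarrow> real^3 \<Rightarrow> real"
      proof (rule dom.integrable_const_bound[where B=B])
        have "AE x in lebesgue_on D. u x \<in> closure Q" using us[OF u] by eventually_elim (use Q(3) in auto)
        then show "(\<lambda>x. F x (u x)) \<in> borel_measurable (lebesgue_on D)"
          by (intro lipschitz_composite_measurable[OF L Q(1) neQ F(1,2) um[OF u] dom.complete_measure_axioms])
        show "AE x in lebesgue_on D. norm (F x (u x)) \<le> B"
          using us[OF u] by eventually_elim (use F(3) in auto)
      qed
      have Tm: "(\<lambda>x. \<rho> (T (x /\<^sub>R \<epsilon>) \<omega>) q) \<in> borel_measurable (lebesgue_on D)" if "0 < \<epsilon>" "q \<in> Q" for \<epsilon> q
        using elim that by blast
      have int_T: "integrable (lebesgue_on D) (\<lambda>x. \<rho> (T (x /\<^sub>R \<epsilon>) \<omega>) (u x))" if "u \<in> L2_sphere D" "0 < \<epsilon>" for u \<epsilon>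
        by (rule int[OF that(1), of "\<lambda>x. \<rho> (T (x /\<^sub>R \<epsilon>) \<omega>)", OF lip Tm[OF that(2)] bound])
      have int_c: "integrable (lebesgue_on D) (\<lambda>x. c (m0 x))"
        by (rule int[OF S0, of "\<lambda>x. c", OF c_lip _ c_bound]) auto
      have pos: "eventually (\<lambda>\<epsilon>::real. 0 < \<epsilon>) (at_right 0)" by (simp add: eventually_at_right_less)
      have sph: "eventually (\<lambda>\<epsilon>. m \<epsilon> \<in> L2_sphere D) (at_right 0)"
        using conv by (simp add: dom.sphere_converges_def)
      have "((\<lambda>\<epsilon>. \<integral>x. \<rho> (T (x /\<^sub>R \<epsilon>) \<omega>) (m \<epsilon> x) \<partial>lebesgue_on D) \<longlongrightarrow> (\<integral>x. c (m0 x) \<partial>lebesgue_on D)) (at_right 0)"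
      proof (rule tendstoI)
        fix r :: real assume r: "0 < r"
        define \<delta> where "\<delta> = r / (4 * (L * ?V + 1))"
        have LV: "0 \<le> L * ?V" using L by simp
        then have \<delta>: "0 < \<delta>" unfolding \<delta>_def by (intro divide_pos_pos r mult_pos_pos add_nonneg_pos) auto
        have L\<delta>: "L * \<delta> * ?V \<le> r / 4"
        proof -
          have "L * \<delta> * ?V = \<delta> * (L * ?V)" by simp
          also have "\<dots> \<le> \<delta> * (L * ?V + 1)" using \<delta> by (intro mult_left_mono) auto
          also have "\<dots> = r / 4"
          proof -
            have "r / (4 * b) * b = r / 4" if "b \<noteq> 0" for b :: real using that by simp
            moreover have "L * ?V + 1 \<noteq> 0" using LV by (metis add_nonneg_pos less_irrefl zero_less_one)
            ultimately show ?thesis unfolding \<delta>_def by blast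
          qed
          finally show ?thesis .
        qed
        obtain Q0 and \<theta> :: "real^3 \<Rightarrow> real^3 \<Rightarrow> real" where Q0: "finite Q0" "Q0 \<subseteq> Q"
          and \<theta>m [measurable]: "\<And>q. \<theta> q \<in> borel_measurable borel"
          and \<theta>0: "\<And>q s. 0 \<le> \<theta> q s" and \<theta>1: "\<And>q s. q \<in> Q0 \<Longrightarrow> \<theta> q s \<le> 1"
          and approx: "\<And>f L s. s \<in> S2 \<Longrightarrow> 0 \<le> L \<Longrightarrow> (\<And>q. q \<in> Q0 \<Longrightarrow> \<bar>f s - f q\<bar> \<le> L * dist s q) \<Longrightarrow>
             \<bar>f s - (\<Sum>q\<in>Q0. \<theta> q s * f q)\<bar> \<le> L * \<delta>"
          using lipschitz_partition_of_unity[OF compact_sphere Q(3) \<delta>] by blast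
        note [measurable] = um[OF S0]
        have int\<theta>: "integrable (lebesgue_on D) (\<lambda>x. \<theta> q (m0 x))" if "q \<in> Q0" for q
          using \<theta>0 \<theta>1[OF that] by (intro dom.integrable_const_bound[where B=1]) auto
        have int\<theta>': "integrable (lebesgue_on D) (\<lambda>x. \<theta> q (m0 x) * b x)"
          if q: "q \<in> Q0" and b: "b \<in> borel_measurable (lebesgue_on D)" "\<And>x. \<bar>b x\<bar> \<le> B" for q and b :: "real^3 \<Rightarrow> real"
        proof (rule dom.integrable_const_bound[where B="1 * B"])
          show "AE x in lebesgue_on D. norm (\<theta> q (m0 x) * b x) \<le> 1 * B"
            unfolding real_norm_def abs_mult
            using \<theta>0 \<theta>1[OF q] b(2) by (intro AE_I2 mult_mono) auto
        qed (use b(1) in measurable)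
        have step: "\<bar>(\<integral>x. F x (m0 x) \<partial>lebesgue_on D) - (\<integral>x. (\<Sum>q\<in>Q0. \<theta> q (m0 x) * F x q) \<partial>lebesgue_on D)\<bar> \<le> r / 4"
          if F: "\<And>x s t. \<bar>F x s - F x t\<bar> \<le> L * dist s t"
          "\<And>q. q \<in> Q \<Longrightarrow> (\<lambda>x. F x q) \<in> borel_measurable (lebesgue_on D)" "\<And>x s. s \<in> S2 \<Longrightarrow> \<bar>F x s\<bar> \<le> B"
          for F :: "real^3 \<Rightarrow> real^3 \<Rightarrow> real"
        proof -
          have "\<bar>(\<integral>x. F x (m0 x) \<partial>lebesgue_on D) - (\<integral>x. (\<Sum>q\<in>Q0. \<theta> q (m0 x) * F x q) \<partial>lebesgue_on D)\<bar> \<le> (L * \<delta>) * ?V"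
          proof (rule dom.integral_diff_le)
            show "integrable (lebesgue_on D) (\<lambda>x. F x (m0 x))" by (rule int[OF S0 F])
            show "integrable (lebesgue_on D) (\<lambda>x. \<Sum>q\<in>Q0. \<theta> q (m0 x) * F x q)"
              using Q0(2) Q(2) F by (intro Bochner_Integration.integrable_sum int\<theta>') auto
            show "AE x in lebesgue_on D. \<bar>F x (m0 x) - (\<Sum>q\<in>Q0. \<theta> q (m0 x) * F x q)\<bar> \<le> L * \<delta>"
              using us[OF S0] by eventually_elim (rule approx[OF _ L F(1)])
          qed
          also have "\<dots> \<le> r / 4" by (rule L\<delta>)
          finally show ?thesis .
        qed
        let ?S = "\<lambda>\<epsilon>. \<integral>x. (\<Sum>q\<in>Q0. \<theta> q (m0 x) * \<rho> (T (x /\<^sub>R \<epsilon>) \<omega>) q) \<partial>lebesgue_on D"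
        let ?R = "\<integral>x. (\<Sum>q\<in>Q0. \<theta> q (m0 x) * c q) \<partial>lebesgue_on D"
        have S_lim: "(?S \<longlongrightarrow> ?R) (at_right 0)"
        proof -
          have "((\<lambda>\<epsilon>. \<Sum>q\<in>Q0. \<integral>x. \<theta> q (m0 x) * \<rho> (T (x /\<^sub>R \<epsilon>) \<omega>) q \<partial>lebesgue_on D)
              \<longlongrightarrow> (\<Sum>q\<in>Q0. c q * (\<integral>x. \<theta> q (m0 x) \<partial>lebesgue_on D))) (at_right 0)"
            using elim Q0(2) int\<theta> by (intro tendsto_sum) blast
          moreover have "(\<Sum>q\<in>Q0. c q * (\<integral>x. \<theta> q (m0 x) \<partial>lebesgue_on D)) = ?R"
            using int\<theta> by (subst Bochner_Integration.integral_sum) (auto simp: mult.commute)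
          moreover have "eventually (\<lambda>\<epsilon>. (\<Sum>q\<in>Q0. \<integral>x. \<theta> q (m0 x) * \<rho> (T (x /\<^sub>R \<epsilon>) \<omega>) q \<partial>lebesgue_on D) = ?S \<epsilon>) (at_right 0)"
            using pos
          proof eventually_elim
            case (elim \<epsilon>)
            show ?case
              by (rule Bochner_Integration.integral_sum[symmetric])
                (use Tm[OF elim] bound Q0(2) Q(2) in \<open>auto intro!: int\<theta>'\<close>)
          qed
          ultimately show ?thesis using Lim_transform_eventually by force
        qed
        have "((\<lambda>\<epsilon>. \<integral>x. L * norm (m \<epsilon> x - m0 x) \<partial>lebesgue_on D) \<longlongrightarrow> 0) (at_right 0)"
          using L by (intro dom.sphere_converges_weighted[OF conv]) auto
        from tendstoD[OF this, of "r / 4"] r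
        have "eventually (\<lambda>\<epsilon>. (\<integral>x. L * norm (m \<epsilon> x - m0 x) \<partial>lebesgue_on D) < r / 4) (at_right 0)"
          by (auto simp: dist_real_def elim: eventually_mono)
        moreover have "eventually (\<lambda>\<epsilon>. dist (?S \<epsilon>) ?R < r / 4) (at_right 0)"
          using tendstoD[OF S_lim, of "r / 4"] r by simp
        moreover note pos sph
        ultimately show "eventually (\<lambda>\<epsilon>. dist (\<integral>x. \<rho> (T (x /\<^sub>R \<epsilon>) \<omega>) (m \<epsilon> x) \<partial>lebesgue_on D)
            (\<integral>x. c (m0 x) \<partial>lebesgue_on D) < r) (at_right 0)"
        proof eventually_elim
          case (elim \<epsilon>)
          let ?A = "\<lambda>u. \<integral>x. \<rho> (T (x /\<^sub>R \<epsilon>) \<omega>) (u x) \<partial>lebesgue_on D"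
          note i = int_T[OF elim(4,3)] int_T[OF S0 elim(3)]
          have "\<bar>?A (m \<epsilon>) - ?A m0\<bar> \<le> (\<integral>x. \<bar>\<rho> (T (x /\<^sub>R \<epsilon>) \<omega>) (m \<epsilon> x) - \<rho> (T (x /\<^sub>R \<epsilon>) \<omega>) (m0 x)\<bar> \<partial>lebesgue_on D)"
            using i integral_abs_bound[of "lebesgue_on D" "\<lambda>x. \<rho> (T (x /\<^sub>R \<epsilon>) \<omega>) (m \<epsilon> x) - \<rho> (T (x /\<^sub>R \<epsilon>) \<omega>) (m0 x)"]
            by simp
          also have "\<dots> \<le> (\<integral>x. L * norm (m \<epsilon> x - m0 x) \<partial>lebesgue_on D)"
          proof (rule integral_mono)
            have "m \<epsilon> \<in> L2 D" "m0 \<in> L2 D" using elim(4) S0 by (auto simp: L2_sphere_def)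
            then have n: "integrable (lebesgue_on D) (\<lambda>x. norm (m \<epsilon> x))" "integrable (lebesgue_on D) (\<lambda>x. norm (m0 x))"
              by (auto intro: dom.L2_norm_integrable)
            show "integrable (lebesgue_on D) (\<lambda>x. L * norm (m \<epsilon> x - m0 x))"
            proof (rule integrable_mult_right, rule Bochner_Integration.integrable_bound)
              show "integrable (lebesgue_on D) (\<lambda>x. norm (m \<epsilon> x) + norm (m0 x))" using n by simp
              note [measurable] = um[OF elim(4)]
              show "(\<lambda>x. norm (m \<epsilon> x - m0 x)) \<in> borel_measurable (lebesgue_on D)" by measurable
              show "AE x in lebesgue_on D. norm (norm (m \<epsilon> x - m0 x)) \<le> norm (norm (m \<epsilon> x) + norm (m0 x))"
                by (intro AE_I2) (simp add: norm_triangle_ineq4)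
            qed
            show "\<bar>\<rho> (T (x /\<^sub>R \<epsilon>) \<omega>) (m \<epsilon> x) - \<rho> (T (x /\<^sub>R \<epsilon>) \<omega>) (m0 x)\<bar> \<le> L * norm (m \<epsilon> x - m0 x)" for x
              using lip by (simp add: dist_norm)
          qed (use i in auto)
          also have "\<dots> < r / 4" by (rule elim(1))
          finally have a1: "\<bar>?A (m \<epsilon>) - ?A m0\<bar> < r / 4" .
          have a2: "\<bar>?A m0 - ?S \<epsilon>\<bar> \<le> r / 4"
            by (rule step[of "\<lambda>x. \<rho> (T (x /\<^sub>R \<epsilon>) \<omega>)", OF lip Tm[OF elim(3)] bound])
          have a3: "\<bar>?S \<epsilon> - ?R\<bar> < r / 4" using elim(2) by (simp add: dist_real_def)
          have a4: "\<bar>(\<integral>x. c (m0 x) \<partial>lebesgue_on D) - ?R\<bar> \<le> r / 4"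
            by (rule step[of "\<lambda>x. c", OF c_lip _ c_bound]) auto
          show ?case using a1 a2 a3 a4 unfolding dist_real_def by linarith
        qed
      qed
      then show "((\<lambda>\<epsilon>. \<integral>x. \<rho> (T (x /\<^sub>R \<epsilon>) \<omega>) (m \<epsilon> x) \<partial>lebesgue_on D)
        \<longlongrightarrow> (\<integral>x. expectation (\<lambda>\<theta>. \<rho> \<theta> (m0 x)) \<partial>lebesgue_on D)) (at_right 0)"
        by (simp add: c_def)
    qed
  qed
qed

text \<open>Along almost every orbit, at every scale and for almost every x, the representative \<open>\<psi>\<close> coincides on
  the sphere with the Lipschitz version of \<open>\<phi>\<close>.\<close>

lemma anisotropy_converges:
  assumes \<phi>: "anisotropy_density P \<phi> L" and \<psi>: "caratheodory_representative P \<phi> \<psi>"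
  shows "AE \<omega> in P. \<forall>m m0. dom.sphere_converges m m0 \<longrightarrow>
    ((\<lambda>\<epsilon>. anisotropy_energy T D \<psi> \<omega> \<epsilon> (m \<epsilon>)) \<longlongrightarrow> anisotropy_energy_hom P D \<phi> m0) (at_right 0)"
proof -
  obtain \<rho> B where \<rho>: "\<And>\<omega> s t. \<bar>\<rho> \<omega> s - \<rho> \<omega> t\<bar> \<le> L * dist s t" "\<And>s. (\<lambda>\<omega>. \<rho> \<omega> s) \<in> borel_measurable P"
    "\<And>\<omega> s. s \<in> S2 \<Longrightarrow> \<bar>\<rho> \<omega> s\<bar> \<le> B" "\<And>s. s \<in> S2 \<Longrightarrow> AE \<omega> in P. \<rho> \<omega> s = \<phi> \<omega> s"
    "\<And>\<psi>. caratheodory_representative P \<phi> \<psi> \<Longrightarrow> AE \<omega> in P. \<forall>s\<in>S2. \<psi> \<omega> s = \<rho> \<omega> s"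
    using anisotropy_representative[OF \<phi>] by blast
  have L: "0 \<le> L" using \<phi> by (simp add: anisotropy_density_def)
  have E: "expectation (\<lambda>\<omega>. \<rho> \<omega> s) = expectation (\<lambda>\<omega>. \<phi> \<omega> s)" if "s \<in> S2" for s
    by (rule integral_cong_AE_complete[OF \<rho>(4)[OF that]])
  have "AE \<omega> in P. \<forall>m m0. dom.sphere_converges m m0 \<longrightarrow>
    ((\<lambda>\<epsilon>. \<integral>x. \<rho> (T (x /\<^sub>R \<epsilon>) \<omega>) (m \<epsilon> x) \<partial>lebesgue_on D)
      \<longlongrightarrow> (\<integral>x. expectation (\<lambda>\<theta>. \<rho> \<theta> (m0 x)) \<partial>lebesgue_on D)) (at_right 0)"
    by (rule lipschitz_energy_converges[OF L \<rho>(1,2,3)])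
  then show ?thesis
    using AE_orbit_on[OF \<rho>(5)[OF \<psi>]]
  proof eventually_elim
    case orb: (elim \<omega>)
    show ?case
    proof (intro allI impI)
      fix m m0 assume conv: "dom.sphere_converges m m0"
      then have sph: "eventually (\<lambda>\<epsilon>. m \<epsilon> \<in> L2_sphere D) (at_right 0)" and S0: "m0 \<in> L2_sphere D"
        by (auto simp: dom.sphere_converges_def)
      have "AE x in lebesgue_on D. expectation (\<lambda>\<theta>. \<rho> \<theta> (m0 x)) = expectation (\<lambda>\<theta>. \<phi> \<theta> (m0 x))"
        using S0 E by (auto simp: L2_sphere_def elim!: eventually_mono)
      then have hom: "(\<integral>x. expectation (\<lambda>\<theta>. \<rho> \<theta> (m0 x)) \<partial>lebesgue_on D) = anisotropy_energy_hom P D \<phi> m0"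
        unfolding anisotropy_energy_hom_def by (rule dom.integral_cong_AE_complete)
      have "eventually (\<lambda>\<epsilon>::real. 0 < \<epsilon>) (at_right 0)" by (simp add: eventually_at_right_less)
      with sph have "eventually (\<lambda>\<epsilon>. (\<integral>x. \<rho> (T (x /\<^sub>R \<epsilon>) \<omega>) (m \<epsilon> x) \<partial>lebesgue_on D)
          = anisotropy_energy T D \<psi> \<omega> \<epsilon> (m \<epsilon>)) (at_right 0)"
      proof eventually_elim
        case (elim \<epsilon>)
        have "AE x in lebesgue_on D. m \<epsilon> x \<in> S2" using elim(1) by (simp add: L2_sphere_def)
        moreover have "AE x in lebesgue_on D. \<forall>s\<in>S2. \<psi> (T (x /\<^sub>R \<epsilon>) \<omega>) s = \<rho> (T (x /\<^sub>R \<epsilon>) \<omega>) s"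
          using orb(2) elim(2) by blast
        ultimately have "AE x in lebesgue_on D. \<rho> (T (x /\<^sub>R \<epsilon>) \<omega>) (m \<epsilon> x) = \<psi> (T (x /\<^sub>R \<epsilon>) \<omega>) (m \<epsilon> x)"
          by eventually_elim simp
        then show ?case unfolding anisotropy_energy_def by (rule dom.integral_cong_AE_complete)
      qed
      moreover have "((\<lambda>\<epsilon>. \<integral>x. \<rho> (T (x /\<^sub>R \<epsilon>) \<omega>) (m \<epsilon> x) \<partial>lebesgue_on D)
        \<longlongrightarrow> anisotropy_energy_hom P D \<phi> m0) (at_right 0)"
        using orb(1)[rule_format, OF conv] by (simp only: hom)
      ultimately show "((\<lambda>\<epsilon>. anisotropy_energy T D \<psi> \<omega> \<epsilon> (m \<epsilon>)) \<longlongrightarrow> anisotropy_energy_hom P D \<phi> m0) (at_right 0)"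
        by (rule Lim_transform_eventually[rotated])
    qed
  qed
qed

end

lemma (in stochastic_setting) caratheodory_representative_exists:
  assumes \<phi>: "anisotropy_density P \<phi> L"
  shows "\<exists>\<psi>. caratheodory_representative P \<phi> \<psi>"
proof (rule anisotropy_representative[OF \<phi>])
  fix \<rho> :: "'w \<Rightarrow> real^3 \<Rightarrow> real"
  assume \<rho>: "\<And>\<omega> s t. \<bar>\<rho> \<omega> s - \<rho> \<omega> t\<bar> \<le> L * dist s t"
    "\<And>s. s \<in> S2 \<Longrightarrow> AE \<omega> in P. \<rho> \<omega> s = \<phi> \<omega> s"
  have "0 \<le> L" using \<phi> by (simp add: anisotropy_density_def)
  then have "continuous_on S2 (\<rho> \<omega>)" for \<omega>
    using \<rho>(1) by (intro lipschitz_on_continuous_on[of L] lipschitz_onI) (auto simp: dist_real_def)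
  with \<rho>(2) show ?thesis
    unfolding caratheodory_representative_def by (intro exI[of _ \<rho>]) simp
qed

theorem proposition2p9:
  fixes P :: "'w::metric_space measure"
    and T :: "real^3 \<Rightarrow> 'w \<Rightarrow> 'w"
    and a \<kappa> Msat :: "'w \<Rightarrow> real"
    and c_ex C_ex C_DMI C_sat L_an \<mu>0 :: real
    and \<phi> :: "'w \<Rightarrow> real^3 \<Rightarrow> real"
    and D :: "(real^3) set"
    and h_a :: "real^3 \<Rightarrow> real^3"
  assumes "stochastic_setting P T"
    and "random_parameters P a \<kappa> Msat c_ex C_ex C_DMI C_sat"
    and "anisotropy_density P \<phi> L_an"
    and "open D" "connected D" "bounded D" "lipschitz_boundary D"
    and "integrable (lebesgue_on D) h_a"
    and "0 < \<mu>0"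
  shows "(\<exists>\<psi>. caratheodory_representative P \<phi> \<psi>) \<and>
    (\<forall>\<psi>. caratheodory_representative P \<phi> \<psi> \<longrightarrow>
      (AE \<omega> in P.
        continuously_Gamma_converges (strong_L2_sphere D)
          (anisotropy_energy T D \<psi> \<omega>) (anisotropy_energy_hom P D \<phi>) \<and>
        continuously_Gamma_converges (strong_L2_sphere D)
          (Zeeman_energy T D \<mu>0 h_a Msat \<omega>) (Zeeman_energy_hom P D \<mu>0 h_a Msat) \<and>
        continuously_Gamma_converges (weak_H1_sphere D)
          (anisotropy_energy T D \<psi> \<omega>) (anisotropy_energy_hom P D \<phi>) \<and>
        continuously_Gamma_converges (weak_H1_sphere D)
          (Zeeman_energy T D \<mu>0 h_a Msat \<omega>) (Zeeman_energy_hom P D \<mu>0 h_a Msat)))"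
proof -
  interpret stochastic_setting P T by fact
  interpret bounded_domain D by unfold_locales fact+
  interpret stochastic_domain P T D ..
  have M: "Linfty P Msat" "\<And>\<omega>. 0 \<le> Msat \<omega> \<and> Msat \<omega> \<le> C_sat"
    using assms(2) by (auto simp: random_parameters_def space_Omega)
  have "AE \<omega> in P.
        continuously_Gamma_converges (strong_L2_sphere D)
          (anisotropy_energy T D \<psi> \<omega>) (anisotropy_energy_hom P D \<phi>) \<and>
        continuously_Gamma_converges (strong_L2_sphere D)
          (Zeeman_energy T D \<mu>0 h_a Msat \<omega>) (Zeeman_energy_hom P D \<mu>0 h_a Msat) \<and>
        continuously_Gamma_converges (weak_H1_sphere D)
          (anisotropy_energy T D \<psi> \<omega>) (anisotropy_energy_hom P D \<phi>) \<and>
        continuously_Gamma_converges (weak_H1_sphere D)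
          (Zeeman_energy T D \<mu>0 h_a Msat \<omega>) (Zeeman_energy_hom P D \<mu>0 h_a Msat)"
    if \<psi>: "caratheodory_representative P \<phi> \<psi>" for \<psi>
    using anisotropy_converges[OF assms(3) \<psi>] Zeeman_converges[OF M assms(8), of \<mu>0]
    by eventually_elim
      (unfold continuously_Gamma_converges_def, use strong_limit weak_limit in blast)
  then show ?thesis using caratheodory_representative_exists[OF assms(3)] by blast
qed

end
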